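(* Consider the multivariate Fay-Herriot model described in the context, and assume: (i) $0<k<\infty$ and $0<s<\infty$ are fixed (not depending on $m$); (ii) there exist positive constants $\underline d,\overline d$ not depending on $m$ such that $\underline d\, I_k\le D_i\le \overline d\, I_k$ (Loewner order) for $i=1,\dots,m$; (iii) $X^\top X$ is nonsingular and $X^\top X/m$ converges to a positive definite matrix as $m\to\infty$. Let $\widehat\Psi$ denote either of the estimators $\widehat\Psi_0$, $\widehat\Psi_1$ defined in the context. Then, as $m\to\infty$: (1) $E[\widehat\Psi_0]-\Psi=\mathrm{Bias}_{\widehat\Psi_0}(\Psi)=O(m^{-1})$, while $\widehat\Psi_1$ is a second-order unbiased estimator of $\Psi$, i.e. $E[\widehat\Psi_1]=\Psi+O(m^{-3/2})$. (2) $\widehat\Psi-\Psi=O_p(m^{-1/2})$ and $\widehat\beta(\widehat\Psi)-\beta=O_p(m^{-1/2})$. (3) The nonnegative definite matrix $\widehat\Psi^+$ is consistent for $\Psi$, and $P(\widehat\Psi^+\neq\widehat\Psi)=O(m^{-K})$ for any $K>0$.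
   Context: Model: for $i=1,\dots,m$, $y_i=X_i\beta+v_i+\varepsilon_i$, where $y_i\in\mathbb R^k$ is observed, $X_i$ is a known nonrandom $k\times s$ matrix, $\beta\in\mathbb R^s$ is a fixed unknown vector, and all the $v_i,\varepsilon_i$ are mutually independent with $v_i\sim\mathcal N_k(0,\Psi)$, $\varepsilon_i\sim\mathcal N_k(0,D_i)$. Here $\Psi$ is a fixed unknown nonsingular $k\times k$ covariance matrix and the $D_i$ are known $k\times k$ covariance matrices. The asymptotics are $m\to\infty$ along a sequence $(X_i,D_i)_{i\ge1}$ with $k,s,\beta,\Psi$ fixed. Write $y=(y_1^\top,\dots,y_m^\top)^\top$ and $X=(X_1^\top,\dots,X_m^\top)^\top$. Generalized least squares: for a matrix $\Psi$, $$\widehat\beta(\Psi)=\Big\{\sum_{i=1}^m X_i^\top(\Psi+D_i)^{-1}X_i\Big\}^{-1}\sum_{i=1}^m X_i^\top(\Psi+D_i)^{-1}y_i .$$ Ordinary least squares: $\widetilde\beta=(X^\top X)^{-1}X^\top y$. Estimators of $\Psi$: $$\widehat\Psi_0=\frac1m\sum_{i=1}^m\big\{(y_i-X_i\widetilde\beta)(y_i-X_i\widetilde\beta)^\top-D_i\big\},\qquad \widehat\Psi_1=\widehat\Psi_0-\mathrm{Bias}_{\widehat\Psi_0}(\widehat\Psi_0),$$ where, for a symmetric $k\times k$ matrix $\Psi$, $$\mathrm{Bias}_{\widehat\Psi_0}(\Psi)=\frac1m\sum_{i=1}^m X_i(X^\top X)^{-1}\Big\{\sum_{j=1}^m X_j^\top(\Psi+D_j)X_j\Big\}(X^\top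 X)^{-1}X_i^\top-\frac1m\sum_{i=1}^m(\Psi+D_i)X_i(X^\top X)^{-1}X_i^\top-\frac1m\sum_{i=1}^m X_i(X^\top X)^{-1}X_i^\top(\Psi+D_i).$$ Nonnegative definite modification: if $\widehat\Psi=H\Lambda H^\top$ with $H$ orthogonal and $\Lambda=\mathrm{diag}(\lambda_1,\dots,\lambda_k)$, then $\widehat\Psi^+=H\Lambda^+H^\top$ with $\Lambda^+=\mathrm{diag}(\max\{0,\lambda_1\},\dots,\max\{0,\lambda_k\})$. Since $\widehat\Psi$ need not be nonnegative definite, $\widehat\beta(\widehat\Psi)$ is given by the formula above whenever the inverses exist (in particular when $\widehat\Psi$ is nonnegative definite) and may be defined arbitrarily otherwise. *)

theory Defs
  imports "HOL-Probability.Probability" "HOL-Library.Landau_Symbols"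
begin

section \<open>Definiteness\<close>

definition symmetric_matrix :: "real^'n^'n \<Rightarrow> bool" where
  "symmetric_matrix A \<longleftrightarrow> transpose A = A"

definition nonneg_definite :: "real^'n^'n \<Rightarrow> bool" where
  "nonneg_definite A \<longleftrightarrow> symmetric_matrix A \<and> (\<forall>x. 0 \<le> x \<bullet> (A *v x))"

definition pos_definite :: "real^'n^'n \<Rightarrow> bool" where
  "pos_definite A \<longleftrightarrow> symmetric_matrix A \<and> (\<forall>x. x \<noteq> 0 \<longrightarrow> 0 < x \<bullet> (A *v x))"

text \<open>The order \<open>\<le>\<close> that the library puts on vectors and matrices is the componentwise one,
  so the Loewner order needs its own name.\<close>

definition loewner_le :: "real^'n^'n \<Rightarrow> real^'n^'n \<Rightarrow> bool" where
  "loewner_le A B \<longleftrightarrow> nonneg_definite (B - A)"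

definition diag_matrix :: "real^'n \<Rightarrow> real^'n^'n" where
  "diag_matrix l = (\<chi> i j. if i = j then l $ i else 0)"

text \<open>\<open>H \<Lambda>\<^sup>+ H\<^sup>T\<close> for a spectral decomposition \<open>A = H \<Lambda> H\<^sup>T\<close>. Its value does not depend on the
  decomposition, whence the definite description; it is meaningful for symmetric \<open>A\<close> only.\<close>

definition nonneg_part :: "real^'n^'n \<Rightarrow> real^'n^'n" where
  "nonneg_part A = (THE B. \<exists>H l. orthogonal_matrix H \<and>
      A = H ** diag_matrix l ** transpose H \<and>
      B = H ** diag_matrix (\<chi> i. max 0 (l $ i)) ** transpose H)"


section \<open>Normal random vectors\<close>

text \<open>The parameter \<open>s2\<close> is the variance; the law is a point mass if it vanishes.\<close>

definition normal_variable :: "'w measure \<Rightarrow> ('w \<Rightarrow> real) \<Rightarrow> real \<Rightarrow> real \<Rightarrow> bool" where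
  "normal_variable M Z mu s2 \<longleftrightarrow>
     (if s2 = 0 then Z \<in> borel_measurable M \<and> (AE \<omega> in M. Z \<omega> = mu)
      else distributed M lborel Z (normal_density mu (sqrt s2)))"

text \<open>\<open>V \<sim> N(mu, S)\<close>, defined by the requirement that every linear functional \<open>a\<^sup>T V\<close> be
  univariate normal with mean \<open>a\<^sup>T mu\<close> and variance \<open>a\<^sup>T S a\<close>; \<open>S\<close> may be singular.\<close>

definition normal_vector :: "'w measure \<Rightarrow> ('w \<Rightarrow> real^'n) \<Rightarrow> real^'n \<Rightarrow> real^'n^'n \<Rightarrow> bool" where
  "normal_vector M V mu S \<longleftrightarrow>
     nonneg_definite S \<and> V \<in> borel_measurable M \<and>
     (\<forall>a. normal_variable M (\<lambda>\<omega>. a \<bullet> V \<omega>) (a \<bullet> mu) (a \<bullet> (S *v a)))"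


section \<open>Stochastic order and consistency\<close>

text \<open>The measurability clauses exclude sets without a probability, to which \<^const>\<open>measure\<close>
  assigns the value \<open>0\<close>.\<close>

definition bigo_prob ::
  "'w measure \<Rightarrow> (nat \<Rightarrow> 'w \<Rightarrow> 'b::real_normed_vector) \<Rightarrow> (nat \<Rightarrow> real) \<Rightarrow> bool" where
  "bigo_prob M T r \<longleftrightarrow>
     (\<forall>\<^sub>F m in sequentially. T m \<in> borel_measurable M) \<and>
     (\<forall>\<epsilon>>0. \<exists>C>0. \<forall>\<^sub>F m in sequentially.
        measure M {\<omega> \<in> space M. norm (T m \<omega>) > C * r m} \<le> \<epsilon>)"

definition consistent_for ::
  "'w measure \<Rightarrow> (nat \<Rightarrow> 'w \<Rightarrow> 'b::metric_space) \<Rightarrow> 'b \<Rightarrow> bool" where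
  "consistent_for M T \<theta> \<longleftrightarrow>
     (\<forall>\<^sub>F m in sequentially. T m \<in> borel_measurable M) \<and>
     (\<forall>\<epsilon>>0. (\<lambda>m. measure M {\<omega> \<in> space M. dist (T m \<omega>) \<theta> > \<epsilon>}) \<longlonglongrightarrow> 0)"


section \<open>Estimators\<close>

text \<open>Design matrices \<open>X i\<close>, covariance matrices \<open>D i\<close> and observations \<open>y i\<close> are indexed by
  \<open>i \<ge> 1\<close>, and only the indices \<open>1, \<dots>, m\<close> enter. As \<open>m\<close> varies, the stacked matrix
  \<open>(X 1\<^sup>T, \<dots>, X m\<^sup>T)\<^sup>T\<close> has no fixed type; the products \<open>X\<^sup>T X\<close> and \<open>X\<^sup>T y\<close> are therefore written
  out blockwise.\<close>

definition gram :: "(nat \<Rightarrow> real^'s^'k) \<Rightarrow> nat \<Rightarrow> real^'s^'s" where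
  "gram X m = (\<Sum>i=1..m. transpose (X i) ** X i)"

definition ols :: "(nat \<Rightarrow> real^'s^'k) \<Rightarrow> nat \<Rightarrow> (nat \<Rightarrow> real^'k) \<Rightarrow> real^'s" where
  "ols X m y = matrix_inv (gram X m) *v (\<Sum>i=1..m. transpose (X i) *v y i)"

definition gls_gram ::
  "(nat \<Rightarrow> real^'s^'k) \<Rightarrow> (nat \<Rightarrow> real^'k^'k) \<Rightarrow> nat \<Rightarrow> real^'k^'k \<Rightarrow> real^'s^'s" where
  "gls_gram X D m P = (\<Sum>i=1..m. transpose (X i) ** matrix_inv (P + D i) ** X i)"

definition gls_defined ::
  "(nat \<Rightarrow> real^'s^'k) \<Rightarrow> (nat \<Rightarrow> real^'k^'k) \<Rightarrow> nat \<Rightarrow> real^'k^'k \<Rightarrow> bool" where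
  "gls_defined X D m P \<longleftrightarrow>
     (\<forall>i\<in>{1..m}. invertible (P + D i)) \<and> invertible (gls_gram X D m P)"

definition gls ::
  "(nat \<Rightarrow> real^'s^'k) \<Rightarrow> (nat \<Rightarrow> real^'k^'k) \<Rightarrow> nat \<Rightarrow> real^'k^'k \<Rightarrow> (nat \<Rightarrow> real^'k) \<Rightarrow> real^'s"
  where
  "gls X D m P y =
     matrix_inv (gls_gram X D m P) *v
       (\<Sum>i=1..m. (transpose (X i) ** matrix_inv (P + D i)) *v y i)"

definition outer_square :: "real^'n \<Rightarrow> real^'n^'n" where
  "outer_square u = (columnvector u :: real^1^'n) ** rowvector u"

definition psi_hat0 ::
  "(nat \<Rightarrow> real^'s^'k) \<Rightarrow> (nat \<Rightarrow> real^'k^'k) \<Rightarrow> nat \<Rightarrow> (nat \<Rightarrow> real^'k) \<Rightarrow> real^'k^'k" where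
  "psi_hat0 X D m y = (1 / real m) *\<^sub>R
     (\<Sum>i=1..m. outer_square (y i - X i *v ols X m y) - D i)"

definition bias0 ::
  "(nat \<Rightarrow> real^'s^'k) \<Rightarrow> (nat \<Rightarrow> real^'k^'k) \<Rightarrow> nat \<Rightarrow> real^'k^'k \<Rightarrow> real^'k^'k" where
  "bias0 X D m P =
     (1 / real m) *\<^sub>R (\<Sum>i=1..m. X i ** matrix_inv (gram X m)
        ** (\<Sum>j=1..m. transpose (X j) ** (P + D j) ** X j)
        ** matrix_inv (gram X m) ** transpose (X i))
   - (1 / real m) *\<^sub>R (\<Sum>i=1..m. (P + D i) ** X i ** matrix_inv (gram X m) ** transpose (X i))
   - (1 / real m) *\<^sub>R (\<Sum>i=1..m. X i ** matrix_inv (gram X m) ** transpose (X i) ** (P + D i))"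

definition psi_hat1 ::
  "(nat \<Rightarrow> real^'s^'k) \<Rightarrow> (nat \<Rightarrow> real^'k^'k) \<Rightarrow> nat \<Rightarrow> (nat \<Rightarrow> real^'k) \<Rightarrow> real^'k^'k" where
  "psi_hat1 X D m y = psi_hat0 X D m y - bias0 X D m (psi_hat0 X D m y)"

end

theory Submission
  imports Defs "HOL-Real_Asymp.Real_Asymp"
begin

text \<open>Put \<open>u\<^sub>i = v\<^sub>i + \<epsilon>\<^sub>i\<close> and \<open>S\<^sub>i = \<Psi> + D\<^sub>i\<close>. All stochastic statements reduce to three noise averages:
  the centered squares \<open>\<Sum> (u\<^sub>i u\<^sub>i\<^sup>T - S\<^sub>i)\<close> and the linear forms \<open>\<Sum> X\<^sub>i\<^sup>T u\<^sub>i\<close> and \<open>\<Sum> X\<^sub>i\<^sup>T S\<^sub>i\<^sup>-\<^sup>1 u\<^sub>i\<close>.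
  Chernoff bounds show that, outside an event of probability \<open>O(exp (- p x\<^sup>2 m))\<close>, each of them has
  norm at most \<open>x m\<close>. On the good event, purely deterministic estimates bound the errors of both
  estimators of \<open>\<Psi>\<close> and of the generalized least squares estimator by a multiple of \<open>x + 1 / m\<close>. Taking
  \<open>x\<close> of order \<open>m\<^sup>-\<^sup>1\<^sup>/\<^sup>2\<close> gives the rates in probability, and a constant \<open>x\<close> gives exponentially small
  probabilities, which covers the nonnegative definite modification: it is the metric projection
  onto the semidefinite cone, hence nonexpansive, and it fixes matrices close to \<open>\<Psi>\<close>. The crude bound
  \<open>|\<Sum> X\<^sub>i\<^sup>T ((P + D\<^sub>i)\<^sup>-\<^sup>1 - S\<^sub>i\<^sup>-\<^sup>1) u\<^sub>i| \<le> O(m) |P - \<Psi>|\<close> suffices for the dependence of the weights on the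
  data. The bias correction is affine in \<open>\<Psi>\<close> with linear part of norm \<open>O(1 / m)\<close>, so the bias of the
  corrected estimator is even \<open>O(1 / m\<^sup>2)\<close>.\<close>

section \<open>Frobenius norm and coercive matrices\<close>

text \<open>Convergence of X^T X / m leaves the individual \<open>X i\<close> unbounded; what it
  gives is that the sum of |X_i|^2 is eventually at most h m. Every estimate is therefore arranged
  so that a summand carries two factors \<open>X i\<close>, or one \<open>X i\<close> and one noise
  vector. The estimated weights depend on all of the noise, so independence says nothing about sums
  formed with them. A deterministic inequality on the good event avoids this: an error t in \<Psi>
  changes the normalized sum by at most a constant times t, and t is itself of order x + 1 / m.
  Squares of normal variables have exponential moments only near 0, which restricts the tail bound
  to x <= x0; both choices of x respect this, since m^(-1/2) is eventually small. The norm of a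
  matrix is the library norm of nested vectors, that is the Frobenius norm. It is submultiplicative,
  and passing to it from operator bounds costs factors k or s, which are fixed.\<close>

lemma matrix_vector_mult_transpose_inner:
  fixes A :: "real^'n^'m"
  shows "(A *v x) \<bullet> y = x \<bullet> (transpose A *v y)"
  by (metis dot_lmul_matrix inner_commute transpose_matrix_vector)

lemma symmetric_matrix_inner:
  "symmetric_matrix A \<Longrightarrow> (A *v x) \<bullet> y = x \<bullet> (A *v y)"
  by (metis matrix_vector_mult_transpose_inner symmetric_matrix_def)

lemma norm_sum_components: "(norm x)\<^sup>2 = (\<Sum>i\<in>UNIV. (norm (x $ i))\<^sup>2)"
  by (simp add: norm_vec_def L2_set_def sum_nonneg)

lemma norm_matrix_transpose: "norm (transpose A) = norm (A :: real^'n^'m)"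
proof -
  have "(norm (transpose A))\<^sup>2 = (norm A)\<^sup>2"
    by (simp add: norm_sum_components transpose_def, rule sum.swap)
  then show ?thesis by simp
qed

lemma norm_matrix_vector_mult_le: "norm (A *v x) \<le> norm A * norm (x :: real^'n)"
  for A :: "real^'n^'m"
proof -
  have "(norm (A *v x))\<^sup>2 = (\<Sum>i\<in>UNIV. (A $ i \<bullet> x)\<^sup>2)"
    by (simp add: norm_sum_components matrix_vector_mul_component)
  also have "\<dots> \<le> (\<Sum>i\<in>UNIV. (norm (A $ i))\<^sup>2 * (norm x)\<^sup>2)"
    by (intro sum_mono) (metis Cauchy_Schwarz_ineq dot_square_norm)
  also have "\<dots> = (norm A * norm x)\<^sup>2"
    by (simp add: norm_sum_components[of A] power_mult_distrib sum_distrib_right)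
  finally show ?thesis by (rule power2_le_imp_le) simp
qed

lemma norm_matrix_mult_le: "norm (A ** B) \<le> norm A * norm B"
  for A :: "real^'n^'m" and B :: "real^'p^'n"
proof -
  have row: "(A ** B) $ i = transpose B *v (A $ i)" for i
    by (simp add: vec_eq_iff matrix_matrix_mult_def transpose_def matrix_vector_mult_def
        mult.commute del: transpose_matrix_vector)
  have "(norm (A ** B))\<^sup>2 = (\<Sum>i\<in>UNIV. (norm (transpose B *v (A $ i)))\<^sup>2)"
    by (simp only: norm_sum_components[of "A ** B"] row)
  also have "\<dots> \<le> (\<Sum>i\<in>UNIV. (norm B * norm (A $ i))\<^sup>2)"
    by (intro sum_mono power_mono)
      (metis norm_matrix_vector_mult_le norm_matrix_transpose, simp)
  also have "\<dots> = (norm A * norm B)\<^sup>2"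
    by (simp add: norm_sum_components[of A] power_mult_distrib sum_distrib_left mult.commute)
  finally show ?thesis by (rule power2_le_imp_le) simp
qed

lemma bounded_bilinear_matrix_mult:
  "bounded_bilinear ((**) :: real^'n^'m \<Rightarrow> real^'p^'n \<Rightarrow> real^'p^'m)"
proof
  show "\<exists>K. \<forall>a b. norm ((a :: real^'n^'m) ** (b :: real^'p^'n)) \<le> norm a * norm b * K"
    by (rule exI[of _ 1]) (simp add: norm_matrix_mult_le)
qed (simp_all add: vec_eq_iff matrix_matrix_mult_def algebra_simps sum.distrib sum_distrib_left)

lemma bounded_bilinear_matrix_vector_mult:
  "bounded_bilinear ((*v) :: real^'n^'m \<Rightarrow> real^'n \<Rightarrow> real^'m)"
proof
  show "\<exists>K. \<forall>a b. norm ((a :: real^'n^'m) *v b) \<le> norm a * norm b * K"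
    by (rule exI[of _ 1]) (simp add: norm_matrix_vector_mult_le)
qed (simp_all add: algebra_simps scaleR_matrix_vector_assoc matrix_vector_mult_scaleR)

lemma bounded_linear_transpose: "bounded_linear (transpose :: real^'n^'m \<Rightarrow> real^'m^'n)"
  by (rule bounded_linear_intro[where K = 1])
    (simp_all add: vec_eq_iff transpose_def norm_matrix_transpose[unfolded transpose_def])

interpretation mat_mult: bounded_bilinear "(**) :: real^'n^'m \<Rightarrow> real^'p^'n \<Rightarrow> real^'p^'m"
  by (rule bounded_bilinear_matrix_mult)

interpretation mat_vec: bounded_bilinear "(*v) :: real^'n^'m \<Rightarrow> real^'n \<Rightarrow> real^'m"
  by (rule bounded_bilinear_matrix_vector_mult)

lemmas transpose_zero = linear_0[OF bounded_linear.linear[OF bounded_linear_transpose]]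
  and transpose_add = linear_add[OF bounded_linear.linear[OF bounded_linear_transpose]]
  and transpose_diff = linear_diff[OF bounded_linear.linear[OF bounded_linear_transpose]]
  and transpose_sum = linear_sum[OF bounded_linear.linear[OF bounded_linear_transpose]]

text \<open>Two arguments instead of one make bilinearity available, so the square of a difference
  expands into separate cross terms.\<close>

definition outer :: "real^'m \<Rightarrow> real^'n \<Rightarrow> real^'n^'m" where
  "outer u v = (\<chi> i j. u $ i * v $ j)"

lemma outer_square_outer: "outer_square u = outer u u"
  by (simp add: outer_square_def outer_def matrix_matrix_mult_def columnvector_def rowvector_def)

lemma norm_outer: "norm (outer u v) = norm u * norm v"
proof -
  have "(norm (outer u v))\<^sup>2 = (norm u * norm v)\<^sup>2"
    by (simp add: norm_sum_components power_mult_distrib sum_product outer_def)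
  then show ?thesis by simp
qed

lemma bounded_bilinear_outer: "bounded_bilinear (outer :: real^'m \<Rightarrow> real^'n \<Rightarrow> real^'n^'m)"
proof
  show "\<exists>K. \<forall>a b. norm (outer (a :: real^'m) (b :: real^'n)) \<le> norm a * norm b * K"
    by (rule exI[of _ 1]) (simp add: norm_outer)
qed (simp_all add: vec_eq_iff outer_def algebra_simps)

interpretation outer_bilin: bounded_bilinear "outer :: real^'m \<Rightarrow> real^'n \<Rightarrow> real^'n^'m"
  by (rule bounded_bilinear_outer)

lemma transpose_outer: "transpose (outer u v) = outer v u"
  by (simp add: vec_eq_iff transpose_def outer_def mult.commute)

lemma outer_mult_left: "outer (A *v u) v = A ** outer u v"
  by (simp add: vec_eq_iff outer_def matrix_matrix_mult_def matrix_vector_mult_def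
      sum_distrib_right mult.assoc)

lemma outer_mult_right: "outer u (A *v v) = outer u v ** transpose A"
  by (simp add: vec_eq_iff outer_def matrix_matrix_mult_def matrix_vector_mult_def
      transpose_def sum_distrib_left mult_ac)

lemma quadratic_form_outer: "a \<bullet> (outer u v *v a) = (a \<bullet> u) * (a \<bullet> v)"
proof -
  have "outer u v *v a = (a \<bullet> v) *\<^sub>R u"
    by (simp add: vec_eq_iff inner_vec_def outer_def matrix_vector_mult_def sum_distrib_left
        sum_distrib_right mult_ac)
  then show ?thesis by simp
qed

lemma quadratic_form_le: "\<bar>x \<bullet> (A *v x)\<bar> \<le> norm A * (norm x)\<^sup>2" for A :: "real^'n^'n"
proof -
  have "\<bar>x \<bullet> (A *v x)\<bar> \<le> norm x * norm (A *v x)" by (rule Cauchy_Schwarz_ineq2)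
  also have "\<dots> \<le> norm x * (norm A * norm x)"
    by (intro mult_left_mono norm_matrix_vector_mult_le) simp
  finally show ?thesis by (simp add: power2_eq_square mult_ac)
qed

lemma norm_matrix_le_entries:
  fixes A :: "real^'n^'m"
  assumes "\<And>i j. \<bar>A $ i $ j\<bar> \<le> c"
  shows "norm A \<le> real CARD('m) * real CARD('n) * c"
proof -
  have "norm A \<le> (\<Sum>i\<in>UNIV. norm (A $ i))"
    unfolding norm_vec_def by (rule L2_set_le_sum) simp
  also have "\<dots> \<le> (\<Sum>i\<in>(UNIV :: 'm set). \<Sum>j\<in>(UNIV :: 'n set). c)"
    by (intro sum_mono order_trans[OF norm_le_l1_cart] assms)
  finally show ?thesis by simp
qed

text \<open>The columns are the images of the unit vectors, so each has norm at most c; adding the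
  column norms loses the factor \<open>CARD('n)\<close>.\<close>

lemma norm_matrix_le_operator:
  fixes A :: "real^'n^'m"
  assumes "\<And>x. norm (A *v x) \<le> c * norm x"
  shows "norm A \<le> real CARD('n) * c"
proof -
  have "norm A = norm (transpose A)" by (simp add: norm_matrix_transpose)
  also have "\<dots> \<le> (\<Sum>j\<in>UNIV. norm (transpose A $ j))"
    unfolding norm_vec_def by (rule L2_set_le_sum) simp
  also have "\<dots> \<le> (\<Sum>j\<in>(UNIV :: 'n set). c)"
  proof (rule sum_mono)
    fix j
    have "transpose A $ j = A *v axis j 1"
      by (simp add: matrix_vector_mult_basis column_def transpose_def)
    then show "norm (transpose A $ j) \<le> c" using assms[of "axis j 1"] by simp
  qed
  finally show ?thesis by simp
qed

text \<open>On symmetric matrices the values of the quadratic form at these finitely many vectors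
  determine every entry, so a tail bound for a random symmetric matrix reduces to finitely many
  scalar ones. The choice i = j contributes 2 e_i, whence the norm bound 2.\<close>

definition polarization_vectors :: "(real^'n) set" where
  "polarization_vectors =
     range (\<lambda>i. axis i 1) \<union> range (\<lambda>(i, j). axis i 1 + axis j 1)"

lemma finite_polarization_vectors: "finite (polarization_vectors :: (real^'n) set)"
  by (simp add: polarization_vectors_def)

lemma norm_polarization_vectors: "a \<in> polarization_vectors \<Longrightarrow> norm a \<le> 2"
  by (auto simp: polarization_vectors_def intro: order_trans[OF norm_triangle_ineq])

lemma nonzero_polarization_vectors: "a \<in> polarization_vectors \<Longrightarrow> a \<noteq> (0 :: real^'n)"
proof -
  have "axis i 1 + axis j 1 \<noteq> (0 :: real^'n)" for i j
  proof
    assume "axis i 1 + axis j 1 = (0 :: real^'n)"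
    then have "(axis i 1 + axis j 1) $ i = (0 :: real)" by simp
    then show False by (simp add: axis_def split: if_splits)
  qed
  then show "a \<in> polarization_vectors \<Longrightarrow> a \<noteq> (0 :: real^'n)"
    by (auto simp: polarization_vectors_def)
qed

lemma matrix_entry: "A $ i $ j = axis i 1 \<bullet> (A *v axis j 1)" for A :: "real^'n^'m"
  by (simp add: inner_axis' matrix_vector_mult_basis column_def)

lemma symmetric_matrix_entry_polarization:
  fixes A :: "real^'n^'n"
  assumes "symmetric_matrix A"
  shows "2 * A $ i $ j = (axis i 1 + axis j 1) \<bullet> (A *v (axis i 1 + axis j 1))
    - axis i 1 \<bullet> (A *v axis i 1) - axis j 1 \<bullet> (A *v axis j 1)"
proof -
  have "A $ j $ i = A $ i $ j"
    using assms by (metis (no_types) symmetric_matrix_def transpose_def vec_lambda_beta)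
  then show ?thesis
    by (simp add: matrix_vector_right_distrib inner_add_left inner_add_right matrix_entry[symmetric])
qed

lemma norm_symmetric_matrix_le:
  fixes A :: "real^'n^'n"
  assumes "symmetric_matrix A"
    and "\<And>a. a \<in> polarization_vectors \<Longrightarrow> \<bar>a \<bullet> (A *v a)\<bar> \<le> c"
  shows "norm A \<le> 2 * (real CARD('n))\<^sup>2 * c"
proof -
  \<comment> \<open>Three values of the form bound 2 |A_ij| by 3 c; the resulting 3 c / 2 is rounded
    up to 2 c.\<close>
  have "\<bar>A $ i $ j\<bar> \<le> 2 * c" for i j
  proof -
    have "axis i 1 \<in> (polarization_vectors :: (real^'n) set)"
      "axis j 1 \<in> (polarization_vectors :: (real^'n) set)"
      "axis i 1 + axis j 1 \<in> (polarization_vectors :: (real^'n) set)"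
      by (auto simp: polarization_vectors_def)
    from this[THEN assms(2)] show ?thesis
      using symmetric_matrix_entry_polarization[OF assms(1), of i j] by linarith
  qed
  from norm_matrix_le_entries[of A "2 * c", OF this] show ?thesis
    by (simp add: power2_eq_square mult_ac)
qed

lemma matrix_eq_entries: "(\<And>i j. A $ i $ j = B $ i $ j) \<Longrightarrow> A = B"
  by (simp add: vec_eq_iff)

section \<open>Inverses of coercive matrices\<close>

lemma matrix_inv_mult:
  fixes A :: "real^'n^'n"
  assumes "invertible A"
  shows "matrix_inv A ** A = mat 1" "A ** matrix_inv A = mat 1"
  using someI_ex[OF assms[unfolded invertible_def]] by (simp_all add: matrix_inv_def)

lemma matrix_inv_symmetric:
  fixes A :: "real^'n^'n"
  assumes "invertible A" "symmetric_matrix A"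
  shows "transpose (matrix_inv A) = matrix_inv A"
proof -
  have "transpose (matrix_inv A) ** A = mat 1"
    using arg_cong[OF matrix_inv_mult(2)[OF assms(1)], of transpose] assms(2)
    by (simp add: matrix_transpose_mul symmetric_matrix_def)
  then have "transpose (matrix_inv A) ** A ** matrix_inv A = matrix_inv A" by simp
  then show ?thesis
    by (simp add: matrix_mul_assoc[symmetric] matrix_inv_mult(2)[OF assms(1)])
qed

text \<open>Coercivity is the quantitative form of positive definiteness used throughout: it
  survives perturbations smaller than c in norm, and it also makes sense for matrices that may fail
  to be symmetric, such as \<open>P + D i\<close> with arbitrary \<open>P\<close>.\<close>

lemma coercive_lower_bound:
  fixes A :: "real^'n^'n"
  assumes "\<And>x. c * (norm x)\<^sup>2 \<le> x \<bullet> (A *v x)"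
  shows "c * norm x \<le> norm (A *v x)"
proof (cases "x = 0")
  case False
  have "norm x * (c * norm x) \<le> x \<bullet> (A *v x)"
    using assms[of x] by (simp add: power2_eq_square mult_ac)
  also have "\<dots> \<le> norm x * norm (A *v x)" by (rule norm_cauchy_schwarz)
  finally show ?thesis using False by simp
qed simp

lemma coercive_invertible:
  fixes A :: "real^'n^'n"
  assumes "0 < c" "\<And>x. c * (norm x)\<^sup>2 \<le> x \<bullet> (A *v x)"
  shows "invertible A"
proof -
  have "x = 0" if "A *v x = 0" for x
    using coercive_lower_bound[of c A x] assms that by (auto simp: mult_le_0_iff)
  then show ?thesis by (auto simp: invertible_left_inverse matrix_left_invertible_ker)
qed

text \<open>Coercivity bounds the operator norm of the inverse by 1 / c; the factor
  \<open>CARD('n)\<close> is the price of the Frobenius norm.\<close>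

lemma norm_matrix_inv_le:
  fixes A :: "real^'n^'n"
  assumes "0 < c" "\<And>x. c * (norm x)\<^sup>2 \<le> x \<bullet> (A *v x)"
  shows "norm (matrix_inv A) \<le> real CARD('n) / c"
proof -
  have "norm (matrix_inv A *v x) \<le> 1 / c * norm x" for x
    using coercive_lower_bound[of c A "matrix_inv A *v x", OF assms(2)] assms(1)
    by (simp add: matrix_vector_mul_assoc matrix_inv_mult[OF coercive_invertible[OF assms]]
        field_simps)
  from norm_matrix_le_operator[OF this] show ?thesis by simp
qed

text \<open>Substituting z = A w turns the form of the inverse into that of A at w, which is at
  least c |w|^2, and |z| <= C |w| expresses this bound in z.\<close>

lemma coercive_matrix_inv:
  fixes A :: "real^'n^'n"
  assumes "0 < c" "\<And>x. c * (norm x)\<^sup>2 \<le> x \<bullet> (A *v x)" "norm A \<le> C"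
  shows "c / C\<^sup>2 * (norm z)\<^sup>2 \<le> z \<bullet> (matrix_inv A *v z)"
proof -
  define w where "w = matrix_inv A *v z"
  have z: "z = A *v w"
    by (simp add: w_def matrix_vector_mul_assoc matrix_inv_mult[OF coercive_invertible[OF assms(1,2)]])
  have "norm z \<le> C * norm w"
    unfolding z by (rule order_trans[OF norm_matrix_vector_mult_le mult_right_mono[OF assms(3)]]) simp
  then have "(norm z)\<^sup>2 \<le> C\<^sup>2 * (norm w)\<^sup>2"
    by (metis norm_ge_zero power_mono power_mult_distrib)
  then have "c / C\<^sup>2 * (norm z)\<^sup>2 \<le> c / C\<^sup>2 * (C\<^sup>2 * (norm w)\<^sup>2)"
    using assms(1) by (intro mult_left_mono) auto
  \<comment> \<open>For C = 0 the quotient c / C^2 is 0, so the left-hand side vanishes.\<close>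
  also have "\<dots> \<le> c * (norm w)\<^sup>2" using assms(1) by (cases "C = 0") auto
  also have "\<dots> \<le> w \<bullet> z" using assms(2)[of w] by (simp add: z)
  finally show ?thesis by (simp add: w_def inner_commute)
qed

text \<open>The form attains its minimum on the compact unit sphere, so the minimum is positive;
  homogeneity of degree two does the rest.\<close>

lemma pos_definite_coercive:
  fixes A :: "real^'n^'n"
  assumes "pos_definite A"
  obtains c where "0 < c" "\<And>x. c * (norm x)\<^sup>2 \<le> x \<bullet> (A *v x)"
proof -
  have "continuous_on (sphere 0 1) (\<lambda>x. x \<bullet> (A *v x))"
    by (intro continuous_intros)
  moreover have "sphere (0 :: real^'n) 1 \<noteq> {}"
    by (metis empty_iff mem_sphere_0 norm_axis_1)
  ultimately obtain x0 where x0: "x0 \<in> sphere 0 1"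
    and min: "\<And>x. x \<in> sphere 0 1 \<Longrightarrow> x0 \<bullet> (A *v x0) \<le> x \<bullet> (A *v x)"
    using continuous_attains_inf[OF compact_sphere] by blast
  define c where "c = x0 \<bullet> (A *v x0)"
  have "x0 \<noteq> 0" using x0 by auto
  then have c: "0 < c" using assms by (simp add: c_def pos_definite_def)
  have "c * (norm x)\<^sup>2 \<le> x \<bullet> (A *v x)" for x
  proof (cases "x = 0")
    case False
    have "c \<le> (x /\<^sub>R norm x) \<bullet> (A *v (x /\<^sub>R norm x))"
      unfolding c_def using False by (intro min) simp
    also have "\<dots> = (x \<bullet> (A *v x)) / (norm x)\<^sup>2"
      by (simp add: matrix_vector_mult_scaleR power2_eq_square divide_simps)
    finally show ?thesis using False by (simp add: field_simps)
  qed simp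
  with c show thesis by (rule that)
qed

text \<open>A nonzero null vector x would minimize the form, yet moving from x against
  \<open>A *v x\<close>, which is nonzero by invertibility, makes the form negative.\<close>

lemma nonneg_definite_invertible_pos_definite:
  fixes A :: "real^'n^'n"
  assumes "nonneg_definite A" "invertible A"
  shows "pos_definite A"
proof -
  have nn: "\<And>x. 0 \<le> x \<bullet> (A *v x)"
    using assms(1) by (auto simp: nonneg_definite_def)
  have "0 < x \<bullet> (A *v x)" if "x \<noteq> 0" for x
  proof (rule ccontr)
    assume "\<not> 0 < x \<bullet> (A *v x)"
    then have q0: "x \<bullet> (A *v x) = 0" using nn[of x] by linarith
    define w where "w = A *v x"
    define q where "q = w \<bullet> (A *v w)"
    have "x \<bullet> (A *v w) = w \<bullet> w"
      using symmetric_matrix_inner[of A x w] assms(1) by (simp add: w_def nonneg_definite_def)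
    then have expand: "(x - t *\<^sub>R w) \<bullet> (A *v (x - t *\<^sub>R w)) = t * (t * q - 2 * (w \<bullet> w))" for t
      using q0 by (simp add: q_def w_def[symmetric] mat_vec.diff_right mat_vec.scaleR_right inner_diff_left
          inner_diff_right algebra_simps)
    \<comment> \<open>The added 1 keeps the denominator positive and gives t q <= |w|^2, so the term
      linear in t dominates the expansion.\<close>
    define t where "t = (w \<bullet> w) / (q + 1)"
    have q: "0 \<le> q" using nn[of w] by (simp add: q_def)
    have "w \<noteq> 0"
    proof
      assume "w = 0"
      then have "matrix_inv A *v (A *v x) = 0" by (simp add: w_def)
      then show False using that by (simp add: matrix_vector_mul_assoc matrix_inv_mult[OF assms(2)])
    qed
    then have ww: "0 < w \<bullet> w" by simp
    have "0 < t" using ww q by (simp add: t_def)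
    moreover have "t * q - 2 * (w \<bullet> w) < 0"
    proof -
      have "t * q \<le> w \<bullet> w" using q ww by (simp add: t_def field_simps)
      then show ?thesis using ww by linarith
    qed
    ultimately have "t * (t * q - 2 * (w \<bullet> w)) < 0" by (rule mult_pos_neg)
    then show False using expand[of t] nn[of "x - t *\<^sub>R w"] by linarith
  qed
  then show ?thesis using assms(1) by (simp add: pos_definite_def nonneg_definite_def)
qed


section \<open>Spectral decomposition and the projection onto the semidefinite cone\<close>

text \<open>A maximizer of \<open>x \<bullet> A x\<close> on the unit sphere of an invariant subspace is an eigenvector:
  otherwise moving along \<open>A x - (x \<bullet> A x) x\<close>, which lies in the subspace, increases the
  Rayleigh quotient.\<close>

lemma symmetric_eigenvector_in_subspace:
  fixes A :: "real^'n^'n"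
  assumes sym: "symmetric_matrix A" and S: "subspace S" "S \<noteq> {0}"
    and inv: "\<And>x. x \<in> S \<Longrightarrow> A *v x \<in> S"
  obtains x l where "x \<in> S" "norm x = 1" "A *v x = l *\<^sub>R x"
proof -
  let ?q = "\<lambda>x. x \<bullet> (A *v x)"
  have "compact (sphere 0 1 \<inter> S)"
    by (intro compact_Int_closed compact_sphere closed_subspace S)
  moreover have "sphere 0 1 \<inter> S \<noteq> {}"
  proof -
    obtain z where "z \<in> S" "z \<noteq> 0" using S subspace_0 by blast
    then have "z /\<^sub>R norm z \<in> sphere 0 1 \<inter> S" using S(1) by (simp add: subspace_scale)
    then show ?thesis by blast
  qed
  moreover have "continuous_on (sphere 0 1 \<inter> S) ?q" by (intro continuous_intros)
  ultimately obtain x where x: "x \<in> S" "norm x = 1"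
    and max: "\<And>z. z \<in> S \<Longrightarrow> norm z = 1 \<Longrightarrow> ?q z \<le> ?q x"
    using continuous_attains_sup[of "sphere 0 1 \<inter> S" ?q] by (metis IntE IntI mem_sphere_0)
  define l where "l = ?q x"
  have max': "?q z \<le> l * (z \<bullet> z)" if "z \<in> S" for z
  proof (cases "z = 0")
    case False
    have scale: "?q (inverse (norm z) *\<^sub>R z) = (inverse (norm z))\<^sup>2 * ?q z"
      by (simp add: mat_vec.scaleR_right power2_eq_square)
    have "?q (inverse (norm z) *\<^sub>R z) \<le> l"
      unfolding l_def using False that S(1) by (intro max) (auto simp: subspace_scale)
    then have "(inverse (norm z))\<^sup>2 * ?q z \<le> l" unfolding scale .
    then show ?thesis using False by (simp add: field_simps dot_square_norm)
  qed simp
  define w where "w = A *v x - l *\<^sub>R x"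
  have wS: "w \<in> S" using x inv S(1) by (simp add: w_def subspace_diff subspace_scale)
  have xx: "x \<bullet> x = 1" using x(2) by (simp add: norm_eq_1)
  have xw: "x \<bullet> w = 0" using xx by (simp add: w_def inner_diff_right l_def)
  have Aw: "x \<bullet> (A *v w) = w \<bullet> w"
  proof -
    have "x \<bullet> (A *v w) = (A *v x) \<bullet> w"
      using symmetric_matrix_inner[OF sym, of x w] by simp
    also have "\<dots> = (w + l *\<^sub>R x) \<bullet> w" by (simp add: w_def)
    finally show ?thesis using xw by (simp add: inner_add_left)
  qed
  have wA: "w \<bullet> (A *v x) = w \<bullet> w"
    using xw by (simp add: w_def inner_diff_right inner_commute)
  define q where "q = ?q w"
  \<comment> \<open>Maximality at x + t w: the constant terms cancel and the first-order coefficient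
    is 2 |w|^2, so a small positive t forces w = 0.\<close>
  have key: "t * (2 * (w \<bullet> w) + t * (q - l * (w \<bullet> w))) \<le> 0" for t
  proof -
    have e: "?q (x + t *\<^sub>R w) = l + t * (2 * (w \<bullet> w) + t * q)"
      using Aw wA by (simp add: q_def l_def[symmetric] mat_vec.add_right mat_vec.scaleR_right inner_add_left
          inner_add_right algebra_simps)
    have n: "(x + t *\<^sub>R w) \<bullet> (x + t *\<^sub>R w) = 1 + t * (t * (w \<bullet> w))"
      using xw xx by (simp add: inner_add_left inner_add_right inner_commute)
    show ?thesis
      using max'[of "x + t *\<^sub>R w"] x wS S(1)
      by (simp only: e n) (simp add: subspace_add subspace_scale algebra_simps)
  qed
  have "w = 0"
  proof (rule ccontr)
    assume "w \<noteq> 0"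
    then have ww: "0 < w \<bullet> w" by simp
    define r where "r = q - l * (w \<bullet> w)"
    \<comment> \<open>With this step |t r| <= |w|^2, so the second-order part cannot cancel 2 |w|^2;
      the added 1 covers r = 0.\<close>
    define t where "t = (w \<bullet> w) / (\<bar>r\<bar> + 1)"
    have t: "0 < t" using ww by (simp add: t_def)
    have "\<bar>t * r\<bar> \<le> w \<bullet> w" using ww by (simp add: t_def abs_mult field_simps)
    then have "0 < 2 * (w \<bullet> w) + t * r" using ww by linarith
    then have "0 < t * (2 * (w \<bullet> w) + t * r)" using t by simp
    then show False using key[of t] by (simp add: r_def)
  qed
  then have "A *v x = l *\<^sub>R x" by (simp add: w_def)
  with x show thesis by (rule that)
qed

text \<open>By symmetry the orthogonal complement of the eigenvectors found so far is invariant, and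
  it is nonzero as long as they are fewer than the dimension; hence it contains one more unit
  eigenvector.\<close>

lemma symmetric_orthonormal_eigenvectors:
  fixes A :: "real^'n^'n"
  assumes sym: "symmetric_matrix A" and "n \<le> CARD('n)"
  shows "\<exists>B. finite B \<and> card B = n \<and> pairwise orthogonal B \<and>
    (\<forall>x\<in>B. norm x = 1 \<and> (\<exists>l. A *v x = l *\<^sub>R x))"
  using assms(2)
proof (induction n)
  case 0
  show ?case by (rule exI[of _ "{}"]) simp
next
  case (Suc n)
  then obtain B where B: "finite B" "card B = n" "pairwise orthogonal B"
    "\<And>x. x \<in> B \<Longrightarrow> norm x = 1" "\<And>x. x \<in> B \<Longrightarrow> \<exists>l. A *v x = l *\<^sub>R x"
    by (metis Suc_leD)
  define S where "S = {x. \<forall>b\<in>B. b \<bullet> x = 0}"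
  have S: "subspace S"
    by (auto simp: S_def subspace_def inner_add_right)
  have "span B \<noteq> UNIV"
  proof
    assume "span B = UNIV"
    then have "dim (UNIV :: (real^'n) set) \<le> card B"
      by (metis B(1) dim_le_card dim_span order_refl)
    then show False using Suc.prems B(2) by simp
  qed
  then have "span B \<subset> (UNIV :: (real^'n) set)" by blast
  then obtain z where z: "z \<noteq> 0" "\<And>x. x \<in> span B \<Longrightarrow> orthogonal z x"
    using orthogonal_to_subspace_exists_gen[of B UNIV] by auto
  then have "z \<in> S"
    by (auto simp: S_def span_base orthogonal_def inner_commute)
  then have "S \<noteq> {0}" using z(1) by auto
  moreover have "A *v x \<in> S" if "x \<in> S" for x
    unfolding S_def
  proof safe
    fix b assume b: "b \<in> B"
    then obtain l where l: "A *v b = l *\<^sub>R b" using B(5) by blast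
    have "b \<bullet> (A *v x) = (A *v b) \<bullet> x"
      using symmetric_matrix_inner[OF sym, of b x] by simp
    then show "b \<bullet> (A *v x) = 0" using that b by (simp add: l S_def)
  qed
  ultimately obtain x l where x: "x \<in> S" "norm x = 1" "A *v x = l *\<^sub>R x"
    using symmetric_eigenvector_in_subspace[OF sym S] by blast
  have "x \<notin> B"
  proof
    assume "x \<in> B"
    then have "x \<bullet> x = 0" using x(1) by (simp add: S_def)
    then show False using x(2) by simp
  qed
  then show ?case
    using B x
    by (intro exI[of _ "insert x B"])
      (auto simp: pairwise_insert S_def orthogonal_def[of x] orthogonal_def[of _ x] inner_commute)
qed

lemma matrix_mult_diag_transpose:
  fixes H :: "real^'n^'n"
  shows "(H ** diag_matrix l ** transpose H) $ i $ j = (\<Sum>p\<in>UNIV. l $ p * (H $ i $ p * H $ j $ p))"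
proof -
  have "(H ** diag_matrix l) $ i $ p = H $ i $ p * l $ p" for p
    by (simp add: matrix_matrix_mult_def diag_matrix_def if_distrib[of "\<lambda>x. _ * x"] sum.delta
        cong: if_cong)
  then show ?thesis
    by (subst matrix_matrix_mult_def) (simp add: transpose_def mult_ac)
qed

lemma spectral_sum:
  fixes H :: "real^'n^'n"
  shows "H ** diag_matrix l ** transpose H
    = (\<Sum>p\<in>UNIV. l $ p *\<^sub>R outer (column p H) (column p H))"
  by (rule matrix_eq_entries) (simp add: matrix_mult_diag_transpose outer_def column_def)

lemma spectral_decomposition:
  fixes A :: "real^'n^'n"
  assumes sym: "symmetric_matrix A"
  obtains H l where "orthogonal_matrix H" "A = H ** diag_matrix l ** transpose H"
proof -
  obtain B where B: "finite B" "card B = CARD('n)" "pairwise orthogonal B"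
    "\<And>x. x \<in> B \<Longrightarrow> norm x = 1" "\<And>x. x \<in> B \<Longrightarrow> \<exists>l. A *v x = l *\<^sub>R x"
    using symmetric_orthonormal_eigenvectors[OF sym order_refl] by metis
  obtain h where h: "bij_betw h (UNIV :: 'n set) B"
    using finite_same_card_bij[of "UNIV :: 'n set" B] B(1,2) by auto
  have hB: "h p \<in> B" for p using h by (auto simp: bij_betw_def)
  obtain e where e: "\<And>x. x \<in> B \<Longrightarrow> A *v x = e x *\<^sub>R x" using B(5) by metis
  define H :: "real^'n^'n" where "H = (\<chi> i p. h p $ i)"
  define l :: "real^'n" where "l = (\<chi> p. e (h p))"
  have col: "column p H = h p" for p by (simp add: column_def H_def vec_eq_iff)
  have orth: "orthogonal_matrix H"
    unfolding orthogonal_matrix_orthonormal_columns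
  proof safe
    fix i j :: 'n
    show "norm (column i H) = 1" using B(4) hB by (simp add: col)
    assume "i \<noteq> j"
    then have "h i \<noteq> h j" using h by (meson UNIV_I bij_betw_imp_inj_on inj_onD)
    then show "orthogonal (column i H) (column j H)"
      using B(3) hB by (simp add: col pairwise_def)
  qed
  have "A ** H = H ** diag_matrix l"
  proof (rule matrix_eq_entries)
    fix i p
    have "(A ** H) $ i $ p = (A *v h p) $ i"
      by (simp add: matrix_matrix_mult_def matrix_vector_mult_def H_def)
    also have "\<dots> = (H ** diag_matrix l) $ i $ p"
      by (simp add: e[OF hB] matrix_matrix_mult_def diag_matrix_def H_def l_def
          if_distrib[of "\<lambda>x. _ * x"] sum.delta mult.commute cong: if_cong)
    finally show "(A ** H) $ i $ p = (H ** diag_matrix l) $ i $ p" .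
  qed
  then have "A ** (H ** transpose H) = H ** diag_matrix l ** transpose H"
    by (simp add: matrix_mul_assoc)
  then have "A = H ** diag_matrix l ** transpose H"
    using orth by (simp add: orthogonal_matrix_def)
  with orth show thesis by (rule that)
qed

section \<open>The semidefinite cone and its metric projection\<close>

definition psd_cone :: "(real^'n^'n) set" where
  "psd_cone = {A. nonneg_definite A}"

lemma psd_cone_nonempty: "psd_cone \<noteq> {}"
proof -
  have "0 \<in> psd_cone" by (simp add: psd_cone_def nonneg_definite_def symmetric_matrix_def transpose_zero)
  then show ?thesis by blast
qed

lemma convex_psd_cone: "convex psd_cone"
  by (auto simp: convex_def psd_cone_def nonneg_definite_def symmetric_matrix_def transpose_add transpose_scalar
      mat_vec.add_left mat_vec.scaleR_left inner_add_right)

lemma closed_psd_cone: "closed psd_cone"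
proof -
  have "closed {A :: real^'n^'n. transpose A = A}"
    by (intro closed_Collect_eq continuous_intros bounded_linear.continuous_on[OF bounded_linear_transpose])
  moreover have "closed {A :: real^'n^'n. \<forall>x. 0 \<le> x \<bullet> (A *v x)}"
    by (intro closed_Collect_all closed_Collect_le continuous_intros mat_vec.continuous_on)
  ultimately show ?thesis
    using closed_Int by (fastforce simp: psd_cone_def nonneg_definite_def symmetric_matrix_def
        Collect_conj_eq)
qed

text \<open>The inner product of matrices is the Frobenius one, so pairing with a rank-one matrix
  evaluates a bilinear form.\<close>

lemma inner_outer: "outer u v \<bullet> C = u \<bullet> (C *v v)"
  by (simp add: inner_vec_def outer_def matrix_vector_mult_def sum_distrib_left mult_ac)

text \<open>With \<open>A = \<Sum> l\<^sub>p h\<^sub>p h\<^sub>p\<^sup>T\<close>, the difference \<open>A - B\<close> is \<open>\<Sum> min 0 l\<^sub>p h\<^sub>p h\<^sub>p\<^sup>T\<close>, which has nonpositive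
  inner product with the semidefinite cone and is orthogonal to \<open>B\<close>. So \<open>B\<close> is the metric
  projection of \<open>A\<close>, whatever the decomposition.\<close>

lemma positive_part_closest_point:
  fixes H :: "real^'n^'n"
  assumes orth: "orthogonal_matrix H"
    and A: "A = H ** diag_matrix l ** transpose H"
    and B: "B = H ** diag_matrix (\<chi> i. max 0 (l $ i)) ** transpose H"
  shows "B = closest_point psd_cone A"
proof (rule closest_point_unique[OF convex_psd_cone closed_psd_cone])
  let ?h = "\<lambda>p. column p H"
  have hh: "?h p \<bullet> ?h q = (if p = q then 1 else 0)" for p q
    using orth by (auto simp: orthogonal_matrix_orthonormal_columns orthogonal_def norm_eq_1)
  have Bsum: "B = (\<Sum>p\<in>UNIV. max 0 (l $ p) *\<^sub>R outer (?h p) (?h p))"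
    by (simp add: B spectral_sum)
  have AB: "A - B = (\<Sum>p\<in>UNIV. min 0 (l $ p) *\<^sub>R outer (?h p) (?h p))"
    unfolding A B spectral_sum sum_subtractf[symmetric] scaleR_left_diff_distrib[symmetric]
    by (intro sum.cong refl arg_cong2[where f = scaleR]) auto
  have ABC: "(A - B) \<bullet> C = (\<Sum>p\<in>UNIV. min 0 (l $ p) * (?h p \<bullet> (C *v ?h p)))" for C
    by (simp add: AB inner_sum_left inner_outer)
  have qB: "x \<bullet> (B *v x) = (\<Sum>p\<in>UNIV. max 0 (l $ p) * (x \<bullet> ?h p)\<^sup>2)" for x
    by (simp add: Bsum mat_vec.sum_left mat_vec.scaleR_left inner_sum_right quadratic_form_outer power2_eq_square)
  show "B \<in> psd_cone"
    unfolding psd_cone_def nonneg_definite_def symmetric_matrix_def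
    by (simp add: qB sum_nonneg) (simp add: Bsum transpose_sum transpose_scalar transpose_outer)
  have "?h p \<bullet> (B *v ?h p) = max 0 (l $ p)" for p
    by (simp add: qB hh if_distrib[of "\<lambda>x. x\<^sup>2"] if_distrib[of "\<lambda>x. _ * x"] cong: if_cong)
  \<comment> \<open>For each p one of \<open>min 0 (l $ p)\<close> and \<open>max 0 (l $ p)\<close>
    vanishes.\<close>
  then have ABB: "(A - B) \<bullet> B = 0"
    unfolding ABC by (intro sum.neutral) (auto simp: min_def max_def)
  show "\<forall>C\<in>psd_cone. dist A B \<le> dist A C"
  proof
    fix C :: "real^'n^'n" assume C: "C \<in> psd_cone"
    have "(A - B) \<bullet> C \<le> 0"
      unfolding ABC using C
      by (intro sum_nonpos mult_nonpos_nonneg) (auto simp: psd_cone_def nonneg_definite_def)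
    then have "0 \<le> (A - B) \<bullet> (B - C)" by (simp add: inner_diff_right ABB)
    moreover have "A - C = (A - B) + (B - C)" by simp
    ultimately have "(norm (A - B))\<^sup>2 \<le> (norm (A - C))\<^sup>2"
      unfolding power2_norm_eq_inner by (simp only: inner_add_left inner_add_right)
        (simp add: inner_commute)
    then have "norm (A - B) \<le> norm (A - C)" by (rule power2_le_imp_le) simp
    then show "dist A B \<le> dist A C" by (simp add: dist_norm)
  qed
qed

text \<open>The spectral decomposition gives existence, and uniqueness holds because every
  decomposition leads to the same projection. Measurability and the Lipschitz property are then
  inherited from the projection onto a closed convex set.\<close>

lemma nonneg_part_closest_point:
  fixes A :: "real^'n^'n"
  assumes "symmetric_matrix A"
  shows "nonneg_part A = closest_point psd_cone A"
  unfolding nonneg_part_def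
proof (rule the_equality)
  obtain H l where "orthogonal_matrix H" "A = H ** diag_matrix l ** transpose H"
    using spectral_decomposition[OF assms] .
  then show "\<exists>H l. orthogonal_matrix H \<and> A = H ** diag_matrix l ** transpose H \<and>
      closest_point psd_cone A = H ** diag_matrix (\<chi> i. max 0 (l $ i)) ** transpose H"
    using positive_part_closest_point by metis
qed (use positive_part_closest_point in blast)


text \<open>As a simp rule this fact rewrites products of a transposed matrix with a vector into
  \<open>v*\<close>, which hides the forms used from here on.\<close>

declare transpose_matrix_vector [simp del]

section \<open>Deterministic error bounds\<close>

text \<open>The bias formula with the covariances replaced by an arbitrary family \<open>F\<close>,
  in which it is linear. Constant families give the linear part of the bias correction, and
  \<open>F = D\<close> gives its offset.\<close>

definition bias_map ::
  "(nat \<Rightarrow> real^'s^'k) \<Rightarrow> nat \<Rightarrow> (nat \<Rightarrow> real^'k^'k) \<Rightarrow> real^'k^'k" where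
  "bias_map X m F =
     (1 / real m) *\<^sub>R (\<Sum>i=1..m. X i ** matrix_inv (gram X m)
        ** (\<Sum>j=1..m. transpose (X j) ** F j ** X j)
        ** matrix_inv (gram X m) ** transpose (X i))
   - (1 / real m) *\<^sub>R (\<Sum>i=1..m. F i ** X i ** matrix_inv (gram X m) ** transpose (X i))
   - (1 / real m) *\<^sub>R (\<Sum>i=1..m. X i ** matrix_inv (gram X m) ** transpose (X i) ** F i)"

lemma bias0_bias_map: "bias0 X D m P = bias_map X m (\<lambda>i. P + D i)"
  by (simp add: bias0_def bias_map_def)

lemma bias_map_add: "bias_map X m (\<lambda>i. F i + H i) = bias_map X m F + bias_map X m H"
  by (simp add: bias_map_def mat_mult.add_left mat_mult.add_right mat_mult.sum_left mat_mult.sum_right sum.distrib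
      scaleR_right_distrib algebra_simps)

lemma bias_map_scaleR: "bias_map X m (\<lambda>i. r *\<^sub>R F i) = r *\<^sub>R bias_map X m F"
  by (simp add: bias_map_def mat_mult.scaleR_left mat_mult.scaleR_right mat_mult.sum_left mat_mult.sum_right
      scaleR_sum_right[symmetric] scaleR_right_diff_distrib mult.commute)

lemma bounded_linear_bias_map: "bounded_linear (\<lambda>P. bias_map X m (\<lambda>_. P))"
  by (simp add: linear_conv_bounded_linear[symmetric] linear_iff bias_map_add bias_map_scaleR)

lemma symmetric_gram: "symmetric_matrix (gram X m)"
  by (simp add: symmetric_matrix_def gram_def transpose_sum matrix_transpose_mul)

lemma symmetric_bias_map:
  assumes "invertible (gram X m)" "\<And>i. i \<in> {1..m} \<Longrightarrow> symmetric_matrix (F i)"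
  shows "symmetric_matrix (bias_map X m F)"
proof -
  have F: "transpose (F i) = F i" if "i \<in> {1..m}" for i
    using assms(2)[OF that] by (simp add: symmetric_matrix_def)
  have "transpose (\<Sum>j=1..m. transpose (X j) ** F j ** X j) = (\<Sum>j=1..m. transpose (X j) ** F j ** X j)"
    unfolding transpose_sum by (intro sum.cong refl) (simp add: matrix_transpose_mul F matrix_mul_assoc)
  moreover have "transpose (\<Sum>i=1..m. F i ** X i ** matrix_inv (gram X m) ** transpose (X i))
      = (\<Sum>i=1..m. X i ** matrix_inv (gram X m) ** transpose (X i) ** F i)"
    unfolding transpose_sum
    by (intro sum.cong refl) (simp add: matrix_transpose_mul F matrix_mul_assoc
        matrix_inv_symmetric[OF assms(1) symmetric_gram])
  moreover have "transpose (\<Sum>i=1..m. X i ** matrix_inv (gram X m) ** transpose (X i) ** F i)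
      = (\<Sum>i=1..m. F i ** X i ** matrix_inv (gram X m) ** transpose (X i))"
    unfolding transpose_sum
    by (intro sum.cong refl) (simp add: matrix_transpose_mul F matrix_mul_assoc
        matrix_inv_symmetric[OF assms(1) symmetric_gram])
  ultimately show ?thesis
    by (simp add: symmetric_matrix_def bias_map_def transpose_diff transpose_scalar transpose_sum
        matrix_transpose_mul matrix_mul_assoc matrix_inv_symmetric[OF assms(1) symmetric_gram])
qed

lemma symmetric_psi_hat0:
  assumes "\<And>i. i \<in> {1..m} \<Longrightarrow> symmetric_matrix (D i)"
  shows "symmetric_matrix (psi_hat0 X D m y)"
  using assms
  by (simp add: symmetric_matrix_def psi_hat0_def transpose_scalar transpose_sum transpose_diff
      outer_square_outer transpose_outer)

lemma symmetric_matrix_add: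
  "symmetric_matrix A \<Longrightarrow> symmetric_matrix B \<Longrightarrow> symmetric_matrix (A + B)"
  by (simp add: symmetric_matrix_def transpose_add)

lemma symmetric_psi_hat1:
  assumes "invertible (gram X m)" "\<And>i. i \<in> {1..m} \<Longrightarrow> symmetric_matrix (D i)"
  shows "symmetric_matrix (psi_hat1 X D m y)"
proof -
  have "symmetric_matrix (bias0 X D m (psi_hat0 X D m y))"
    unfolding bias0_bias_map
    by (intro symmetric_bias_map symmetric_matrix_add symmetric_psi_hat0 assms)
  then show ?thesis
    using symmetric_psi_hat0[of m D X y] assms(2)
    by (simp add: psi_hat1_def symmetric_matrix_def transpose_diff)
qed

lemma gram_mult_vector: "gram X m *v x = (\<Sum>i=1..m. transpose (X i) *v (X i *v x))"
  by (simp add: gram_def mat_vec.sum_left matrix_vector_mul_assoc)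

lemma quadratic_form_gram: "x \<bullet> (gram X m *v x) = (\<Sum>i=1..m. (norm (X i *v x))\<^sup>2)"
  by (simp add: gram_mult_vector inner_sum_right matrix_vector_mult_transpose_inner[symmetric]
      power2_norm_eq_inner)

lemma ols_error:
  assumes "invertible (gram X m)" "\<And>i. i \<in> {1..m} \<Longrightarrow> y i = X i *v \<beta> + u i"
  shows "ols X m y = \<beta> + matrix_inv (gram X m) *v (\<Sum>i=1..m. transpose (X i) *v u i)"
proof -
  have "(\<Sum>i=1..m. transpose (X i) *v y i) = gram X m *v \<beta> + (\<Sum>i=1..m. transpose (X i) *v u i)"
    by (simp add: assms(2) mat_vec.add_right gram_mult_vector sum.distrib)
  then show ?thesis
    by (simp add: ols_def mat_vec.add_right matrix_vector_mul_assoc matrix_inv_mult[OF assms(1)])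
qed

definition centered_squares ::
  "(nat \<Rightarrow> real^'k^'k) \<Rightarrow> nat \<Rightarrow> (nat \<Rightarrow> real^'k) \<Rightarrow> real^'k^'k" where
  "centered_squares S m u = (\<Sum>i=1..m. outer (u i) (u i) - S i)"

text \<open>The residual is u_i - X_i b, where b is the error of ordinary least squares and is
  common to all i; the four sums come from expanding its outer square.\<close>

lemma psi_hat0_error:
  assumes "m \<ge> 1" "invertible (gram X m)" "\<And>i. i \<in> {1..m} \<Longrightarrow> y i = X i *v \<beta> + u i"
    and b: "b = matrix_inv (gram X m) *v (\<Sum>i=1..m. transpose (X i) *v u i)"
  shows "psi_hat0 X D m y - \<Psi> = (1 / real m) *\<^sub>R
    (centered_squares (\<lambda>i. \<Psi> + D i) m u
      - (\<Sum>i=1..m. outer (u i) (X i *v b)) - (\<Sum>i=1..m. outer (X i *v b) (u i))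
      + (\<Sum>i=1..m. outer (X i *v b) (X i *v b)))"
proof -
  have ols: "ols X m y = \<beta> + b"
    using ols_error[OF assms(2,3)] b by simp
  have res: "y i - X i *v ols X m y = u i - X i *v b" if "i \<in> {1..m}" for i
    using that by (simp add: ols assms(3) mat_vec.add_right)
  have "psi_hat0 X D m y - \<Psi>
      = (1 / real m) *\<^sub>R (\<Sum>i=1..m. outer_square (y i - X i *v ols X m y) - D i - \<Psi>)"
  proof -
    have "(\<Sum>i=1..m. \<Psi>) = real m *\<^sub>R \<Psi>" by (simp only: sum_constant_scaleR) simp
    then show ?thesis
      using assms(1) unfolding psi_hat0_def by (simp only: sum_subtractf scaleR_right_diff_distrib) simp
  qed
  also have "(\<Sum>i=1..m. outer_square (y i - X i *v ols X m y) - D i - \<Psi>)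
      = (\<Sum>i=1..m. (outer (u i) (u i) - (\<Psi> + D i)) - outer (u i) (X i *v b)
          - outer (X i *v b) (u i) + outer (X i *v b) (X i *v b))"
    by (intro sum.cong refl)
      (simp add: res outer_square_outer outer_bilin.diff_left outer_bilin.diff_right algebra_simps)
  finally show ?thesis
    by (simp add: centered_squares_def sum.distrib sum_subtractf)
qed

lemma norm_matrix_mult_mono:
  assumes "norm (A :: real^'n^'m) \<le> a" "norm (B :: real^'p^'n) \<le> b"
  shows "norm (A ** B) \<le> a * b"
  by (rule order_trans[OF norm_matrix_mult_le])
    (use assms in \<open>auto intro!: mult_mono order_trans[OF norm_ge_zero]\<close>)

text \<open>The trace of u u^T; through it a bound on the centered squares controls the total noise
  energy.\<close>

lemma diag_sum_norm_sq: "(norm u)\<^sup>2 = (\<Sum>a\<in>UNIV. outer u u $ a $ a)"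
  by (simp add: power2_norm_eq_inner inner_vec_def outer_def)

lemma entry_le_norm: "\<bar>A $ i $ j\<bar> \<le> norm A" for A :: "real^'n^'m"
  using component_le_norm_cart[of "A $ i" j] Finite_Cartesian_Product.norm_nth_le[where x = A and i = i] by linarith

section \<open>Error bounds for designs that are controlled on average\<close>

locale bounded_design =
  fixes X :: "nat \<Rightarrow> real^'s^'k" and D :: "nat \<Rightarrow> real^'k^'k" and \<Psi> :: "real^'k^'k"
    and m1 :: nat and g h c d :: real
  assumes m1: "m1 \<ge> 1" and pos: "0 < g" "0 < h" "0 < c" "0 < d"
    and gram_coercive: "\<And>m x. m \<ge> m1 \<Longrightarrow> g * real m * (norm x)\<^sup>2 \<le> x \<bullet> (gram X m *v x)"
    and design_sq: "\<And>m. m \<ge> m1 \<Longrightarrow> (\<Sum>i=1..m. (norm (X i))\<^sup>2) \<le> h * real m"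
    and cov_coercive: "\<And>i x. i \<ge> 1 \<Longrightarrow> d * (norm x)\<^sup>2 \<le> x \<bullet> ((\<Psi> + D i) *v x)"
    and cov_norm: "\<And>i. i \<ge> 1 \<Longrightarrow> norm (\<Psi> + D i) \<le> c"
begin

lemma m_pos: "m \<ge> m1 \<Longrightarrow> 0 < real m"
  using m1 by simp

lemma gram_invertible: "m \<ge> m1 \<Longrightarrow> invertible (gram X m)"
  using coercive_invertible[of "g * real m" "gram X m"] gram_coercive pos(1) m_pos by simp

lemma norm_inv_gram: "m \<ge> m1 \<Longrightarrow> norm (matrix_inv (gram X m)) \<le> real CARD('s) / (g * real m)"
  using norm_matrix_inv_le[of "g * real m" "gram X m"] gram_coercive pos(1) m_pos by simp

text \<open>The common summation step: as only the sum of |X_i|^2 is controlled, each summand has to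
  be bounded with two factors \<open>X i\<close>.\<close>

lemma sum_norm_le_design_sq:
  assumes "m \<ge> m1" "0 \<le> f" "\<And>i. i \<in> {1..m} \<Longrightarrow> norm (Z i) \<le> f * (norm (X i))\<^sup>2"
  shows "norm (\<Sum>i=1..m. Z i) \<le> f * (h * real m)"
proof -
  have "norm (\<Sum>i=1..m. Z i) \<le> (\<Sum>i=1..m. f * (norm (X i))\<^sup>2)"
    by (intro order_trans[OF norm_sum] sum_mono assms(3))
  also have "\<dots> = f * (\<Sum>i=1..m. (norm (X i))\<^sup>2)" by (simp add: sum_distrib_left)
  also have "\<dots> \<le> f * (h * real m)" by (intro mult_left_mono design_sq assms)
  finally show ?thesis .
qed

text \<open>Each inverse Gram matrix contributes a factor 1 / m and each sum over the design a
  factor m; with the averaging factor every one of the three terms has order 1 / m. The constant is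
  (a h)^2 + 2 a h, where a / m bounds the inverse.\<close>

lemma bias_map_bound:
  obtains \<kappa> where "0 < \<kappa>"
    "\<And>m F f. m \<ge> m1 \<Longrightarrow> 0 \<le> f \<Longrightarrow> (\<And>i. i \<in> {1..m} \<Longrightarrow> norm (F i) \<le> f) \<Longrightarrow>
       norm (bias_map X m F) \<le> \<kappa> * f / real m"
proof
  define a where "a = real CARD('s) / g"
  have a: "0 < a" using pos by (simp add: a_def)
  show "0 < (a * h)\<^sup>2 + 2 * (a * h)" using a pos by (simp add: add_pos_pos)
  fix m F f
  assume m: "m \<ge> m1" and f: "0 \<le> f" and F: "\<And>i. i \<in> {1..m} \<Longrightarrow> norm (F i :: real^'k^'k) \<le> f"
  define A where "A = matrix_inv (gram X m)"
  have mp: "0 < real m" by (rule m_pos[OF m])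
  have A: "norm A \<le> a / real m"
    using norm_inv_gram[OF m] by (simp add: A_def a_def divide_divide_eq_left)
  define J where "J = (\<Sum>j=1..m. transpose (X j) ** F j ** X j)"
  have J: "norm J \<le> f * (h * real m)"
    unfolding J_def
  proof (rule sum_norm_le_design_sq[OF m f])
    fix i assume "i \<in> {1..m}"
    then have "norm (transpose (X i) ** F i ** X i) \<le> norm (X i) * f * norm (X i)"
      by (intro norm_matrix_mult_mono F) (auto simp: norm_matrix_transpose)
    then show "norm (transpose (X i) ** F i ** X i) \<le> f * (norm (X i))\<^sup>2"
      by (simp add: power2_eq_square mult_ac)
  qed
  have s1: "norm (\<Sum>i=1..m. X i ** A ** J ** A ** transpose (X i))
      \<le> (a / real m * (f * (h * real m)) * (a / real m)) * (h * real m)"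
  proof (rule sum_norm_le_design_sq[OF m])
    show "0 \<le> a / real m * (f * (h * real m)) * (a / real m)" using a f pos by simp
    fix i
    have "norm (X i ** A ** J ** A ** transpose (X i))
        \<le> norm (X i) * (a / real m) * (f * (h * real m)) * (a / real m) * norm (X i)"
      by (intro norm_matrix_mult_mono A J) (auto simp: norm_matrix_transpose)
    then show "norm (X i ** A ** J ** A ** transpose (X i))
        \<le> (a / real m * (f * (h * real m)) * (a / real m)) * (norm (X i))\<^sup>2"
      by (simp only: power2_eq_square mult_ac)
  qed
  have s2: "norm (\<Sum>i=1..m. F i ** X i ** A ** transpose (X i)) \<le> (f * (a / real m)) * (h * real m)"
  proof (rule sum_norm_le_design_sq[OF m])
    show "0 \<le> f * (a / real m)" using a f by simp
    fix i assume "i \<in> {1..m}"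
    then have "norm (F i ** X i ** A ** transpose (X i)) \<le> f * norm (X i) * (a / real m) * norm (X i)"
      by (intro norm_matrix_mult_mono A F) (auto simp: norm_matrix_transpose)
    then show "norm (F i ** X i ** A ** transpose (X i)) \<le> (f * (a / real m)) * (norm (X i))\<^sup>2"
      by (simp add: power2_eq_square mult_ac)
  qed
  have s3: "norm (\<Sum>i=1..m. X i ** A ** transpose (X i) ** F i) \<le> (f * (a / real m)) * (h * real m)"
  proof (rule sum_norm_le_design_sq[OF m])
    show "0 \<le> f * (a / real m)" using a f by simp
    fix i assume "i \<in> {1..m}"
    then have "norm (X i ** A ** transpose (X i) ** F i) \<le> norm (X i) * (a / real m) * norm (X i) * f"
      by (intro norm_matrix_mult_mono A F) (auto simp: norm_matrix_transpose)
    then show "norm (X i ** A ** transpose (X i) ** F i) \<le> (f * (a / real m)) * (norm (X i))\<^sup>2"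
      by (simp add: power2_eq_square mult_ac)
  qed
  have tri: "norm (x - y - z) \<le> norm x + norm y + norm z" for x y z :: "real^'k^'k"
    using norm_triangle_ineq4[of "x - y" z] norm_triangle_ineq4[of x y] by linarith
  have "norm (bias_map X m F) \<le> 1 / real m * norm (\<Sum>i=1..m. X i ** A ** J ** A ** transpose (X i))
      + 1 / real m * norm (\<Sum>i=1..m. F i ** X i ** A ** transpose (X i))
      + 1 / real m * norm (\<Sum>i=1..m. X i ** A ** transpose (X i) ** F i)"
    unfolding bias_map_def A_def[symmetric] J_def[symmetric]
    by (rule order_trans[OF tri]) simp
  also have "\<dots> \<le> 1 / real m * ((a / real m * (f * (h * real m)) * (a / real m)) * (h * real m))
      + 1 / real m * ((f * (a / real m)) * (h * real m))
      + 1 / real m * ((f * (a / real m)) * (h * real m))"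
    by (intro add_mono mult_left_mono s1 s2 s3) auto
  also have "\<dots> = ((a * h)\<^sup>2 + 2 * (a * h)) * f / real m"
    using mp by (simp add: field_simps power2_eq_square)
  finally show "norm (bias_map X m F) \<le> ((a * h)\<^sup>2 + 2 * (a * h)) * f / real m" .
qed

text \<open>Compare traces: the noise energy is the trace of the centered squares plus that of the
  covariances, and each of the k diagonal entries is at most m + c m.\<close>

lemma noise_sq_bound:
  assumes m: "m \<ge> m1" and Q: "norm (centered_squares (\<lambda>i. \<Psi> + D i) m u) \<le> real m"
  shows "(\<Sum>i=1..m. (norm (u i))\<^sup>2) \<le> real CARD('k) * (1 + c) * real m"
proof -
  let ?Q = "centered_squares (\<lambda>i. \<Psi> + D i) m u"
  have "(\<Sum>i=1..m. (norm (u i))\<^sup>2) = (\<Sum>a\<in>UNIV. \<Sum>i=1..m. outer (u i) (u i) $ a $ a)"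
    unfolding diag_sum_norm_sq by (rule sum.swap)
  also have "\<dots> = (\<Sum>a\<in>UNIV. ?Q $ a $ a + (\<Sum>i=1..m. (\<Psi> + D i) $ a $ a))"
    by (simp add: centered_squares_def sum_subtractf)
  also have "\<dots> \<le> (\<Sum>a\<in>(UNIV :: 'k set). real m + (\<Sum>i=1..m. c))"
  proof (intro sum_mono add_mono)
    fix a i
    show "?Q $ a $ a \<le> real m" using entry_le_norm[of ?Q a a] Q by linarith
    assume "i \<in> {1..m}"
    then show "(\<Psi> + D i) $ a $ a \<le> c"
      using entry_le_norm[of "\<Psi> + D i" a a] cov_norm[of i] by simp
  qed
  also have "\<dots> = real CARD('k) * (1 + c) * real m" by (simp add: algebra_simps)
  finally show ?thesis .
qed

text \<open>Both the cross terms of the residuals and the perturbed weights lead to this sum. Its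
  order m suffices because it always comes multiplied by a small factor.\<close>

lemma noise_design_bound:
  obtains r where "0 < r"
    "\<And>m u. m \<ge> m1 \<Longrightarrow> norm (centered_squares (\<lambda>i. \<Psi> + D i) m u) \<le> real m \<Longrightarrow>
       (\<Sum>i=1..m. norm (X i) * norm (u i)) \<le> r * real m"
proof
  show "0 < real CARD('k) * (1 + c) + h" using pos by (simp add: add_nonneg_pos)
  fix m u
  assume m: "m \<ge> m1" and Q: "norm (centered_squares (\<lambda>i. \<Psi> + D i) m u) \<le> real m"
  have "x * y \<le> y\<^sup>2 + x\<^sup>2" if "0 \<le> x" "0 \<le> y" for x y :: real
    using sum_squares_bound[of x y] that mult_nonneg_nonneg[OF that] by linarith
  then have "(\<Sum>i=1..m. norm (X i) * norm (u i)) \<le> (\<Sum>i=1..m. (norm (u i))\<^sup>2 + (norm (X i))\<^sup>2)"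
    by (intro sum_mono) simp
  also have "\<dots> \<le> real CARD('k) * (1 + c) * real m + h * real m"
    unfolding sum.distrib by (intro add_mono noise_sq_bound[OF m Q] design_sq m)
  finally show "(\<Sum>i=1..m. norm (X i) * norm (u i)) \<le> (real CARD('k) * (1 + c) + h) * real m"
    by (simp add: algebra_simps)
qed

text \<open>The least squares error satisfies |b| <= a x. A cross term is at most a x times the sum
  of |X_i| |u_i|, which has order m, and the term quadratic in b has order x^2 m before
  averaging.\<close>

lemma psi_hat0_bound:
  obtains C where "0 < C"
    "\<And>m u y \<beta> x. m \<ge> m1 \<Longrightarrow> 0 \<le> x \<Longrightarrow> x \<le> 1 \<Longrightarrow> (\<And>i. i \<in> {1..m} \<Longrightarrow> y i = X i *v \<beta> + u i) \<Longrightarrow>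
       norm (centered_squares (\<lambda>i. \<Psi> + D i) m u) \<le> x * real m \<Longrightarrow>
       norm (\<Sum>i=1..m. transpose (X i) *v u i) \<le> x * real m \<Longrightarrow>
       norm (psi_hat0 X D m y - \<Psi>) \<le> C * x"
proof -
  obtain r where r: "0 < r"
    "\<And>m u. m \<ge> m1 \<Longrightarrow> norm (centered_squares (\<lambda>i. \<Psi> + D i) m u) \<le> real m \<Longrightarrow>
       (\<Sum>i=1..m. norm (X i) * norm (u i)) \<le> r * real m"
    using noise_design_bound by blast
  define a where "a = real CARD('s) / g"
  have a: "0 < a" using pos by (simp add: a_def)
  show thesis
  proof
    show "0 < 1 + 2 * (a * r) + a\<^sup>2 * h"
      using a r(1) pos by (intro add_pos_pos) auto
    fix m u y \<beta> x
    assume m: "m \<ge> m1" and x: "0 \<le> x" "x \<le> 1"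
      and y: "\<And>i. i \<in> {1..m} \<Longrightarrow> y i = X i *v \<beta> + u i"
      and Q: "norm (centered_squares (\<lambda>i. \<Psi> + D i) m u) \<le> x * real m"
      and T: "norm (\<Sum>i=1..m. transpose (X i) *v u i) \<le> x * real m"
    have mp: "0 < real m" by (rule m_pos[OF m])
    define b where "b = matrix_inv (gram X m) *v (\<Sum>i=1..m. transpose (X i) *v u i)"
    have b: "norm b \<le> a * x"
    proof -
      have "norm b \<le> real CARD('s) / (g * real m) * (x * real m)"
        unfolding b_def
        by (rule order_trans[OF norm_matrix_vector_mult_le])
          (intro mult_mono norm_inv_gram m T, use pos mp in auto)
      then show ?thesis using mp by (simp add: a_def)
    qed
    have "norm (centered_squares (\<lambda>i. \<Psi> + D i) m u) \<le> real m"
      using Q x mult_right_mono[of x 1 "real m"] by simp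
    note R = r(2)[OF m this]
    have Xb: "norm (X i *v b) \<le> norm (X i) * (a * x)" for i
      by (rule order_trans[OF norm_matrix_vector_mult_le mult_left_mono[OF b]]) simp
    have cross: "(\<Sum>i=1..m. norm (u i) * norm (X i *v b)) \<le> a * r * x * real m"
    proof -
      have "(\<Sum>i=1..m. norm (u i) * norm (X i *v b)) \<le> (\<Sum>i=1..m. (a * x) * (norm (X i) * norm (u i)))"
        by (intro sum_mono) (use mult_left_mono[OF Xb norm_ge_zero] in \<open>simp add: mult_ac\<close>)
      also have "\<dots> = (a * x) * (\<Sum>i=1..m. norm (X i) * norm (u i))"
        by (simp only: sum_distrib_left)
      also have "\<dots> \<le> (a * x) * (r * real m)"
        using a x by (intro mult_left_mono R) simp
      finally show ?thesis by (simp add: mult_ac)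
    qed
    have c1: "norm (\<Sum>i=1..m. outer (u i) (X i *v b)) \<le> a * r * x * real m"
      using cross by (intro order_trans[OF norm_sum]) (simp add: norm_outer)
    have c2: "norm (\<Sum>i=1..m. outer (X i *v b) (u i)) \<le> a * r * x * real m"
      using cross by (intro order_trans[OF norm_sum]) (simp add: norm_outer mult.commute)
    have c3: "norm (\<Sum>i=1..m. outer (X i *v b) (X i *v b)) \<le> (a * x)\<^sup>2 * (h * real m)"
    proof (rule sum_norm_le_design_sq[OF m])
      fix i
      have "(norm (X i *v b))\<^sup>2 \<le> (norm (X i) * (a * x))\<^sup>2" by (intro power_mono Xb) simp
      then show "norm (outer (X i *v b) (X i *v b)) \<le> (a * x)\<^sup>2 * (norm (X i))\<^sup>2"
        by (simp add: norm_outer power2_eq_square mult_ac)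
    qed simp
    have "norm (psi_hat0 X D m y - \<Psi>)
        \<le> 1 / real m * (x * real m + a * r * x * real m + a * r * x * real m + (a * x)\<^sup>2 * (h * real m))"
    proof -
      have "norm (psi_hat0 X D m y - \<Psi>) = 1 / real m * norm (centered_squares (\<lambda>i. \<Psi> + D i) m u
        - (\<Sum>i=1..m. outer (u i) (X i *v b)) - (\<Sum>i=1..m. outer (X i *v b) (u i))
        + (\<Sum>i=1..m. outer (X i *v b) (X i *v b)))"
        using m m1 by (subst psi_hat0_error[OF _ gram_invertible[OF m] y b_def]) auto
      also have "\<dots> \<le> 1 / real m * (x * real m + a * r * x * real m + a * r * x * real m + (a * x)\<^sup>2 * (h * real m))"
        by (intro mult_left_mono order_trans[OF norm_triangle_ineq] add_mono c3
            order_trans[OF norm_triangle_ineq4] c2 c1 Q) simp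
      finally show ?thesis .
    qed
    also have "\<dots> = x + 2 * (a * r) * x + a\<^sup>2 * h * (x * x)"
      using mp by (simp add: field_simps power2_eq_square)
    \<comment> \<open>Here x <= 1 turns x^2 into x.\<close>
    also have "\<dots> \<le> x + 2 * (a * r) * x + a\<^sup>2 * h * x"
      using x pos a r(1) mult_left_mono[of x 1 x] by (intro add_mono mult_left_mono) auto
    finally show "norm (psi_hat0 X D m y - \<Psi>) \<le> (1 + 2 * (a * r) + a\<^sup>2 * h) * x"
      by (simp add: algebra_simps)
  qed
qed

text \<open>The correction is the bias map of a family bounded by x + c, so it costs at most
  \<kappa> (x + c) / m. The part that does not vanish with x is the origin of the 1 / m in
  \<open>concentrates\<close>.\<close>

lemma psi_hat1_bound:
  obtains C where "0 < C"
    "\<And>m y x. m \<ge> m1 \<Longrightarrow> norm (psi_hat0 X D m y - \<Psi>) \<le> x \<Longrightarrow>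
       norm (psi_hat1 X D m y - \<Psi>) \<le> C * (x + 1 / real m)"
proof -
  obtain \<kappa> where \<kappa>: "0 < \<kappa>"
    "\<And>m F f. m \<ge> m1 \<Longrightarrow> 0 \<le> f \<Longrightarrow> (\<And>i. i \<in> {1..m} \<Longrightarrow> norm (F i) \<le> f) \<Longrightarrow>
       norm (bias_map X m F) \<le> \<kappa> * f / real m"
    using bias_map_bound by blast
  show thesis
  proof
    show "0 < 1 + \<kappa> + \<kappa> * c" using \<kappa>(1) pos by (intro add_pos_pos) auto
    fix m y x
    assume m: "m \<ge> m1" and x: "norm (psi_hat0 X D m y - \<Psi>) \<le> x"
    have mp: "1 \<le> real m" using m m1 by simp
    have x0: "0 \<le> x" using x norm_ge_zero order_trans by blast
    have "norm (psi_hat0 X D m y + D i) \<le> x + c" if "i \<in> {1..m}" for i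
    proof -
      have "psi_hat0 X D m y + D i = (psi_hat0 X D m y - \<Psi>) + (\<Psi> + D i)" by simp
      then show ?thesis
        using x cov_norm[of i] that by (metis add_mono atLeastAtMost_iff norm_triangle_mono)
    qed
    then have "norm (bias0 X D m (psi_hat0 X D m y)) \<le> \<kappa> * (x + c) / real m"
      unfolding bias0_bias_map using m x0 pos by (intro \<kappa>) auto
    then have "norm (psi_hat1 X D m y - \<Psi>) \<le> x + \<kappa> * (x + c) / real m"
      unfolding psi_hat1_def using x norm_triangle_ineq4[of "psi_hat0 X D m y - \<Psi>" "bias0 X D m (psi_hat0 X D m y)"]
      by (simp add: algebra_simps)
    also have "\<dots> \<le> (1 + \<kappa> + \<kappa> * c) * (x + 1 / real m)"
    proof -
      define q where "q = 1 / real m"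
      have q: "0 \<le> q" "q \<le> 1" using mp by (auto simp: q_def)
      have "0 \<le> \<kappa> * x * (1 - q)" "0 \<le> \<kappa> * c * x" "0 \<le> \<kappa> * q"
        using x0 \<kappa>(1) pos q by auto
      then have "x + \<kappa> * (x + c) * q \<le> (1 + \<kappa> + \<kappa> * c) * (x + q)"
        using q(1) by (simp add: algebra_simps)
      then show ?thesis by (simp add: q_def)
    qed
    finally show "norm (psi_hat1 X D m y - \<Psi>) \<le> (1 + \<kappa> + \<kappa> * c) * (x + 1 / real m)" .
  qed
qed

lemma norm_inv_cov:
  assumes "i \<ge> 1"
  shows "norm (matrix_inv (\<Psi> + D i)) \<le> real CARD('k) / d"
  by (rule norm_matrix_inv_le[OF pos(4) cov_coercive[OF assms]])

text \<open>Within distance d / 2 of \<Psi> every \<open>P + D i\<close> keeps the coercivity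
  constant d / 2, so the weights exist, vary in a Lipschitz way with \<open>P\<close>, and give a
  coercive weighted Gram matrix.\<close>

lemma gls_bound:
  obtains C where "0 < C"
    "\<And>m u y \<beta> x t P. m \<ge> m1 \<Longrightarrow> (\<And>i. i \<in> {1..m} \<Longrightarrow> y i = X i *v \<beta> + u i) \<Longrightarrow>
       norm (centered_squares (\<lambda>i. \<Psi> + D i) m u) \<le> real m \<Longrightarrow>
       norm (\<Sum>i=1..m. (transpose (X i) ** matrix_inv (\<Psi> + D i)) *v u i) \<le> x * real m \<Longrightarrow>
       norm (P - \<Psi>) \<le> t \<Longrightarrow> t \<le> d / 2 \<Longrightarrow>
       gls_defined X D m P \<and> norm (gls X D m P y - \<beta>) \<le> C * (x + t)"
proof -
  obtain r where r: "0 < r"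
    "\<And>m u. m \<ge> m1 \<Longrightarrow> norm (centered_squares (\<lambda>i. \<Psi> + D i) m u) \<le> real m \<Longrightarrow>
       (\<Sum>i=1..m. norm (X i) * norm (u i)) \<le> r * real m"
    using noise_design_bound by blast
  \<comment> \<open>The constant that \<open>coercive_matrix_inv\<close> yields for a matrix with
    coercivity d / 2 and norm at most c + d.\<close>
  define \<gamma> where "\<gamma> = d / 2 / (c + d)\<^sup>2"
  have \<gamma>: "0 < \<gamma>" using pos by (simp add: \<gamma>_def)
  define n where "n = real CARD('k)"
  \<comment> \<open>The product of the norm bounds for the two inverses in the resolvent identity
    below.\<close>
  define w where "w = n / (d / 2) * (n / d)"
  define a where "a = real CARD('s) / (\<gamma> * g)"
  have w: "0 < w" "0 < a" using pos \<gamma> by (auto simp: w_def n_def a_def)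
  show thesis
  proof
    show "0 < a * (1 + w * r)" using w r(1) by (intro mult_pos_pos add_pos_pos) auto
    fix m u y \<beta> x t P
    assume m: "m \<ge> m1" and y: "\<And>i. i \<in> {1..m} \<Longrightarrow> y i = X i *v \<beta> + u i"
      and Q: "norm (centered_squares (\<lambda>i. \<Psi> + D i) m u) \<le> real m"
      and W: "norm (\<Sum>i=1..m. (transpose (X i) ** matrix_inv (\<Psi> + D i)) *v u i) \<le> x * real m"
      and P: "norm (P - \<Psi>) \<le> t" "t \<le> d / 2"
    have mp: "0 < real m" by (rule m_pos[OF m])
    have t0: "0 \<le> t" using P(1) norm_ge_zero order_trans by blast
    have x0: "0 \<le> x" using order_trans[OF norm_ge_zero W] mp by (simp add: zero_le_mult_iff)
    have coer: "d / 2 * (norm z)\<^sup>2 \<le> z \<bullet> ((P + D i) *v z)" if "i \<in> {1..m}" for i z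
    proof -
      have "P + D i = (\<Psi> + D i) + (P - \<Psi>)" by simp
      then have "z \<bullet> ((P + D i) *v z) = z \<bullet> ((\<Psi> + D i) *v z) + z \<bullet> ((P - \<Psi>) *v z)"
        by (metis inner_add_right mat_vec.add_left)
      moreover have "\<bar>z \<bullet> ((P - \<Psi>) *v z)\<bar> \<le> d / 2 * (norm z)\<^sup>2"
        using P by (intro order_trans[OF quadratic_form_le mult_right_mono]) auto
      moreover have "d * (norm z)\<^sup>2 \<le> z \<bullet> ((\<Psi> + D i) *v z)" using cov_coercive that by simp
      ultimately show ?thesis by (simp add: abs_le_iff)
    qed
    have nrm: "norm (P + D i) \<le> c + d" if "i \<in> {1..m}" for i
    proof -
      have "P + D i = (\<Psi> + D i) + (P - \<Psi>)" by simp
      moreover have "norm (\<Psi> + D i) \<le> c" using cov_norm that by simp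
      moreover have "norm (P - \<Psi>) \<le> d" using P pos by simp
      ultimately show ?thesis by (metis norm_triangle_mono)
    qed
    have d2: "0 < d / 2" using pos by simp
    have inv: "invertible (P + D i)" if "i \<in> {1..m}" for i
      using coercive_invertible[OF d2 coer[OF that]] .
    let ?M = "\<lambda>i. matrix_inv (P + D i)" and ?N = "\<lambda>i. matrix_inv (\<Psi> + D i)"
    let ?G = "gls_gram X D m P"
    have gq: "z \<bullet> (?G *v z) = (\<Sum>i=1..m. (X i *v z) \<bullet> (?M i *v (X i *v z)))" for z
      unfolding gls_gram_def mat_vec.sum_left inner_sum_right
      by (simp add: matrix_vector_mul_assoc[symmetric] matrix_vector_mult_transpose_inner[symmetric])
    have Gcoer: "\<gamma> * g * real m * (norm z)\<^sup>2 \<le> z \<bullet> (?G *v z)" for z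
    proof -
      have "\<gamma> * (g * real m * (norm z)\<^sup>2) \<le> \<gamma> * (z \<bullet> (gram X m *v z))"
        using \<gamma> by (intro mult_left_mono gram_coercive m) simp
      also have "\<dots> = (\<Sum>i=1..m. \<gamma> * (norm (X i *v z))\<^sup>2)"
        by (simp add: quadratic_form_gram sum_distrib_left)
      also have "\<dots> \<le> z \<bullet> (?G *v z)"
        unfolding gq \<gamma>_def by (intro sum_mono coercive_matrix_inv d2 coer nrm)
      finally show ?thesis by (simp add: mult_ac)
    qed
    have gp: "0 < \<gamma> * g * real m" using \<gamma> pos mp by simp
    have Ginv: "invertible ?G" by (rule coercive_invertible[OF gp Gcoer])
    have Gn: "norm (matrix_inv ?G) \<le> a / real m"
      using norm_matrix_inv_le[OF gp Gcoer] by (simp add: a_def)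
    let ?W = "\<Sum>i=1..m. (transpose (X i) ** ?N i) *v u i"
    let ?R = "\<Sum>i=1..m. (transpose (X i) ** (?M i - ?N i)) *v u i"
    \<comment> \<open>The estimated weights are split into the true, nonrandom ones and their
      perturbation.\<close>
    have err: "gls X D m P y - \<beta> = matrix_inv ?G *v (?W + ?R)"
    proof -
      have "(\<Sum>i=1..m. (transpose (X i) ** ?M i) *v y i) = ?G *v \<beta> + (?W + ?R)"
        by (simp add: y mat_vec.add_right mat_vec.add_left mat_vec.sum_left sum.distrib gls_gram_def
            matrix_vector_mul_assoc mat_mult.diff_right mat_vec.diff_left sum_subtractf)
      then show ?thesis
        by (simp add: gls_def mat_vec.add_right matrix_vector_mul_assoc matrix_inv_mult[OF Ginv])
    qed
    have diff: "norm (?M i - ?N i) \<le> w * t" if i: "i \<in> {1..m}" for i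
    proof -
      have i1: "i \<ge> 1" using i by simp
      have inv0: "invertible (\<Psi> + D i)" by (rule coercive_invertible[OF pos(4) cov_coercive[OF i1]])
      \<comment> \<open>The resolvent identity M - N = M (N^-1 - M^-1) N.\<close>
      have "?M i ** ((\<Psi> + D i) - (P + D i)) ** ?N i = ?M i ** ((\<Psi> + D i) ** ?N i) - (?M i ** (P + D i)) ** ?N i"
        by (simp only: mat_mult.diff_left mat_mult.diff_right matrix_mul_assoc)
      also have "\<dots> = ?M i - ?N i"
        by (simp add: matrix_inv_mult[OF inv0] matrix_inv_mult[OF inv[OF i]])
      finally have "norm (?M i - ?N i) = norm (?M i ** ((\<Psi> + D i) - (P + D i)) ** ?N i)" by simp
      also have "\<dots> \<le> n / (d / 2) * t * (n / d)"
        unfolding n_def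
        by (intro norm_matrix_mult_mono norm_inv_cov i1 norm_matrix_inv_le d2 coer i)
          (use P(1) in \<open>simp add: norm_minus_commute\<close>)
      finally show ?thesis by (simp add: w_def mult_ac)
    qed
    have R: "norm ?R \<le> w * t * (r * real m)"
    proof -
      have "norm ?R \<le> (\<Sum>i=1..m. w * t * (norm (X i) * norm (u i)))"
      proof (intro order_trans[OF norm_sum] sum_mono)
        fix i assume i: "i \<in> {1..m}"
        have "norm (transpose (X i) ** (?M i - ?N i)) \<le> norm (X i) * (w * t)"
          by (intro norm_matrix_mult_mono diff i) (simp add: norm_matrix_transpose)
        then have "norm ((transpose (X i) ** (?M i - ?N i)) *v u i) \<le> norm (X i) * (w * t) * norm (u i)"
          by (rule order_trans[OF norm_matrix_vector_mult_le mult_right_mono]) simp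
        then show "norm ((transpose (X i) ** (?M i - ?N i)) *v u i) \<le> w * t * (norm (X i) * norm (u i))"
          by (simp add: mult_ac)
      qed
      also have "\<dots> = w * t * (\<Sum>i=1..m. norm (X i) * norm (u i))" by (simp only: sum_distrib_left)
      also have "\<dots> \<le> w * t * (r * real m)" using w t0 by (intro mult_left_mono r(2) m Q) simp
      finally show ?thesis .
    qed
    have "norm (gls X D m P y - \<beta>) \<le> a / real m * (x * real m + w * t * (r * real m))"
      unfolding err
      by (rule order_trans[OF norm_matrix_vector_mult_le])
        (intro mult_mono Gn order_trans[OF norm_triangle_ineq] add_mono W R, use w in auto)
    also have "\<dots> = a * (x + w * r * t)" using mp by (simp add: field_simps)
    also have "\<dots> \<le> a * ((1 + w * r) * (x + t))"
      using w r(1) x0 t0 by (intro mult_left_mono) (auto simp: algebra_simps)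
    finally show "gls_defined X D m P \<and> norm (gls X D m P y - \<beta>) \<le> a * (1 + w * r) * (x + t)"
      using inv Ginv by (simp add: gls_defined_def mult.assoc)
  qed
qed

end


section \<open>Gaussian exponential moments and tail bounds\<close>

lemma nn_integral_normal_density:
  assumes "0 < \<sigma>"
  shows "(\<integral>\<^sup>+x. ennreal (normal_density \<mu> \<sigma> x) \<partial>lborel) = 1"
  using assms by (simp add: nn_integral_eq_integral)

text \<open>Complete the square: the tilted density is a multiple of the normal density with mean t
  \<sigma>^2. Nonnegative integrals avoid integrability side conditions.\<close>

lemma nn_integral_exp_normal:
  assumes "0 < \<sigma>" "distributed M lborel Z (normal_density 0 \<sigma>)"
  shows "(\<integral>\<^sup>+\<omega>. ennreal (exp (t * Z \<omega>)) \<partial>M) = ennreal (exp (t\<^sup>2 * \<sigma>\<^sup>2 / 2))"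
proof -
  have dens: "normal_density 0 \<sigma> x * exp (t * x)
      = exp (t\<^sup>2 * \<sigma>\<^sup>2 / 2) * normal_density (t * \<sigma>\<^sup>2) \<sigma> x" for x
  proof -
    have "t\<^sup>2 * \<sigma>\<^sup>2 / 2 + - (x - t * \<sigma>\<^sup>2)\<^sup>2 / (2 * \<sigma>\<^sup>2) = - x\<^sup>2 / (2 * \<sigma>\<^sup>2) + t * x"
      using assms(1) by (simp add: field_simps power2_eq_square)
    then show ?thesis
      by (simp add: normal_density_def exp_add[symmetric] mult.commute mult.left_commute)
  qed
  have "(\<integral>\<^sup>+\<omega>. ennreal (exp (t * Z \<omega>)) \<partial>M)
      = (\<integral>\<^sup>+x. ennreal (normal_density 0 \<sigma> x) * ennreal (exp (t * x)) \<partial>lborel)"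
    by (rule distributed_nn_integral[OF assms(2), symmetric]) simp
  also have "\<dots> = (\<integral>\<^sup>+x. ennreal (exp (t\<^sup>2 * \<sigma>\<^sup>2 / 2)) * ennreal (normal_density (t * \<sigma>\<^sup>2) \<sigma> x) \<partial>lborel)"
    by (simp add: ennreal_mult[symmetric] dens)
  also have "\<dots> = ennreal (exp (t\<^sup>2 * \<sigma>\<^sup>2 / 2))"
    by (simp add: nn_integral_cmult nn_integral_normal_density[OF assms(1)])
  finally show ?thesis .
qed

text \<open>Tilting by exp (t x^2) changes the variance from \<sigma>^2 to \<sigma>^2 / q^2 with q^2
  = 1 - 2 t \<sigma>^2, and the change of normalization is the factor 1 / q.\<close>

lemma nn_integral_exp_normal_square:
  assumes "0 < \<sigma>" "distributed M lborel Z (normal_density 0 \<sigma>)" "2 * t * \<sigma>\<^sup>2 < 1"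
  shows "(\<integral>\<^sup>+\<omega>. ennreal (exp (t * (Z \<omega>)\<^sup>2)) \<partial>M) = ennreal (1 / sqrt (1 - 2 * t * \<sigma>\<^sup>2))"
proof -
  define q where "q = sqrt (1 - 2 * t * \<sigma>\<^sup>2)"
  have q: "0 < q" "q\<^sup>2 = 1 - 2 * t * \<sigma>\<^sup>2" using assms(3) by (auto simp: q_def)
  have dens: "normal_density 0 \<sigma> x * exp (t * x\<^sup>2) = 1 / q * normal_density 0 (\<sigma> / q) x" for x
  proof -
    have "- x\<^sup>2 / (2 * (\<sigma> / q)\<^sup>2) = - x\<^sup>2 * q\<^sup>2 / (2 * \<sigma>\<^sup>2)"
      by (simp add: power_divide)
    also have "\<dots> = - x\<^sup>2 / (2 * \<sigma>\<^sup>2) + t * x\<^sup>2"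
      unfolding q(2) using assms(1) by (simp add: field_simps)
    finally have "exp (- x\<^sup>2 / (2 * (\<sigma> / q)\<^sup>2)) = exp (- x\<^sup>2 / (2 * \<sigma>\<^sup>2)) * exp (t * x\<^sup>2)"
      by (simp only: exp_add[symmetric])
    then show ?thesis
      using q(1) assms(1)
      by (simp add: normal_density_def real_sqrt_mult power_divide real_sqrt_divide)
  qed
  have "(\<integral>\<^sup>+\<omega>. ennreal (exp (t * (Z \<omega>)\<^sup>2)) \<partial>M)
      = (\<integral>\<^sup>+x. ennreal (normal_density 0 \<sigma> x) * ennreal (exp (t * x\<^sup>2)) \<partial>lborel)"
    by (rule distributed_nn_integral[OF assms(2), symmetric]) simp
  also have "\<dots> = (\<integral>\<^sup>+x. ennreal (1 / q) * ennreal (normal_density 0 (\<sigma> / q) x) \<partial>lborel)"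
    using q(1) by (simp only: ennreal_mult[symmetric] dens normal_density_nonneg exp_ge_zero
        zero_le_divide_1_iff less_imp_le)
  also have "\<dots> = ennreal (1 / q)"
    using q(1) assms(1) by (simp add: nn_integral_cmult nn_integral_normal_density)
  finally show ?thesis by (simp add: q_def)
qed

text \<open>With z = 2 t \<sigma>^2 the centered moment is exp (- z / 2) / sqrt (1 - z). The
  condition on t says |z| <= 1 / 2, where ln (1 - z) >= - z - 2 z^2, and this bounds the moment by
  exp (z^2).\<close>

lemma nn_integral_exp_centered_normal_square:
  assumes "0 < \<sigma>" "distributed M lborel Z (normal_density 0 \<sigma>)" "\<bar>t\<bar> * (4 * \<sigma>\<^sup>2) \<le> 1"
  shows "(\<integral>\<^sup>+\<omega>. ennreal (exp (t * ((Z \<omega>)\<^sup>2 - \<sigma>\<^sup>2))) \<partial>M) \<le> ennreal (exp (4 * (\<sigma>\<^sup>2)\<^sup>2 * t\<^sup>2))"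
proof -
  define z where "z = 2 * t * \<sigma>\<^sup>2"
  have "\<bar>z\<bar> = (\<bar>t\<bar> * (4 * \<sigma>\<^sup>2)) / 2" by (simp add: z_def abs_mult)
  then have z: "\<bar>- z\<bar> \<le> 1 / 2" using assms(3) by simp
  then have z1: "z < 1" by linarith
  have Z: "Z \<in> borel_measurable M" using distributed_measurable[OF assms(2)] by simp
  have "ln (1 + - z) \<ge> - z - 2 * z\<^sup>2"
    using abs_ln_one_plus_x_minus_x_bound[OF z] by (simp add: abs_le_iff)
  then have "exp (- z - 2 * z\<^sup>2) \<le> 1 - z"
    using z1 by (simp add: ln_ge_iff)
  then have "sqrt (exp (- z - 2 * z\<^sup>2)) \<le> sqrt (1 - z)" by (rule real_sqrt_le_mono)
  moreover have "sqrt (exp (- z - 2 * z\<^sup>2)) = exp (- z / 2 - z\<^sup>2)"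
    by (rule real_sqrt_unique) (simp_all add: power2_eq_square exp_add[symmetric])
  ultimately have "exp (- z / 2 - z\<^sup>2) \<le> sqrt (1 - z)" by simp
  then have "exp (- z / 2) * (1 / sqrt (1 - z)) \<le> exp (- z / 2) * (1 / exp (- z / 2 - z\<^sup>2))"
    using z1 by (intro mult_left_mono divide_left_mono) auto
  also have "\<dots> = exp (- z / 2 - (- z / 2 - z\<^sup>2))"
    by (simp only: exp_diff[of "- z / 2"] times_divide_eq_right mult_1_right)
  also have "\<dots> = exp (z\<^sup>2)" by simp
  finally have bound: "exp (- z / 2) * (1 / sqrt (1 - z)) \<le> exp (z\<^sup>2)" .
  have "(\<integral>\<^sup>+\<omega>. ennreal (exp (t * ((Z \<omega>)\<^sup>2 - \<sigma>\<^sup>2))) \<partial>M)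
      = (\<integral>\<^sup>+\<omega>. ennreal (exp (- z / 2)) * ennreal (exp (t * (Z \<omega>)\<^sup>2)) \<partial>M)"
    by (simp add: ennreal_mult[symmetric] exp_add[symmetric] z_def algebra_simps)
  also have "\<dots> = ennreal (exp (- z / 2)) * ennreal (1 / sqrt (1 - z))"
    using nn_integral_exp_normal_square[OF assms(1,2), of t] z1 Z
    by (simp add: nn_integral_cmult z_def)
  also have "\<dots> = ennreal (exp (- z / 2) * (1 / sqrt (1 - z)))"
    using z1 by (intro ennreal_mult[symmetric]) auto
  also have "\<dots> \<le> ennreal (exp (z\<^sup>2))" by (rule ennreal_leI[OF bound])
  also have "z\<^sup>2 = 4 * (\<sigma>\<^sup>2)\<^sup>2 * t\<^sup>2" by (simp add: z_def power_mult_distrib)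
  finally show ?thesis .
qed

text \<open>The chosen t minimizes the exponent \<kappa> t^2 - t r; the minimum is - r^2 / (4
  \<kappa>).\<close>

lemma (in prob_space) chernoff_sum_upper:
  fixes Z :: "'i \<Rightarrow> 'a \<Rightarrow> real"
  assumes I: "finite I" and ind: "indep_vars (\<lambda>_. borel) Z I"
    and mgf: "\<And>i. i \<in> I \<Longrightarrow> (\<integral>\<^sup>+\<omega>. ennreal (exp (t * Z i \<omega>)) \<partial>M) \<le> ennreal (exp (K i * t\<^sup>2))"
    and \<kappa>: "0 < \<kappa>" "(\<Sum>i\<in>I. K i) \<le> \<kappa>" and r: "0 < r" and t: "t = r / (2 * \<kappa>)"
  shows "prob {\<omega> \<in> space M. r \<le> (\<Sum>i\<in>I. Z i \<omega>)} \<le> exp (- (r\<^sup>2 / (4 * \<kappa>)))"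
proof -
  have meas: "Z i \<in> borel_measurable M" if "i \<in> I" for i
    using ind that by (auto simp: indep_vars_def)
  have sumM: "(\<lambda>\<omega>. \<Sum>i\<in>I. Z i \<omega>) \<in> borel_measurable M" by (intro borel_measurable_sum meas)
  have t0: "0 < t" using r \<kappa> by (simp add: t)
  have ind': "indep_vars (\<lambda>_. borel) (\<lambda>i \<omega>. ennreal (exp (t * Z i \<omega>))) I"
    by (rule indep_vars_compose2[OF ind, where Y = "\<lambda>i x. ennreal (exp (t * x))"]) simp
  have "(\<integral>\<^sup>+\<omega>. ennreal (exp (t * (\<Sum>i\<in>I. Z i \<omega>))) \<partial>M)
      = (\<integral>\<^sup>+\<omega>. (\<Prod>i\<in>I. ennreal (exp (t * Z i \<omega>))) \<partial>M)"
    by (simp add: sum_distrib_left exp_sum[OF I] prod_ennreal)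
  also have "\<dots> = (\<Prod>i\<in>I. \<integral>\<^sup>+\<omega>. ennreal (exp (t * Z i \<omega>)) \<partial>M)"
    by (rule indep_vars_nn_integral[OF I ind']) simp
  also have "\<dots> \<le> (\<Prod>i\<in>I. ennreal (exp (K i * t\<^sup>2)))"
    by (rule prod_mono_ennreal) (rule mgf)
  also have "\<dots> = ennreal (exp ((\<Sum>i\<in>I. K i) * t\<^sup>2))"
    by (simp add: prod_ennreal exp_sum[OF I] sum_distrib_right)
  also have "\<dots> \<le> ennreal (exp (\<kappa> * t\<^sup>2))"
    by (intro ennreal_leI) (simp add: mult_right_mono \<kappa>)
  finally have mgf_sum: "(\<integral>\<^sup>+\<omega>. ennreal (exp (t * (\<Sum>i\<in>I. Z i \<omega>))) \<partial>M) \<le> ennreal (exp (\<kappa> * t\<^sup>2))" .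
  have "emeasure M {\<omega> \<in> space M. r \<le> (\<Sum>i\<in>I. Z i \<omega>)}
      \<le> ennreal (exp (- t * r)) * (\<integral>\<^sup>+\<omega>. ennreal (exp (t * (\<Sum>i\<in>I. Z i \<omega>))) * indicator (space M) \<omega> \<partial>M)"
    by (rule Chernoff_ineq_nn_integral_ge[OF t0]) (use sumM in auto)
  also have "(\<integral>\<^sup>+\<omega>. ennreal (exp (t * (\<Sum>i\<in>I. Z i \<omega>))) * indicator (space M) \<omega> \<partial>M)
      = (\<integral>\<^sup>+\<omega>. ennreal (exp (t * (\<Sum>i\<in>I. Z i \<omega>))) \<partial>M)"
    by (intro nn_integral_cong) simp
  also have "ennreal (exp (- t * r)) * \<dots> \<le> ennreal (exp (- t * r)) * ennreal (exp (\<kappa> * t\<^sup>2))"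
    by (intro mult_left_mono mgf_sum) simp
  also have "\<dots> = ennreal (exp (- t * r + \<kappa> * t\<^sup>2))"
    by (simp only: ennreal_mult[symmetric] exp_ge_zero exp_add)
  also have "- t * r + \<kappa> * t\<^sup>2 = - (r\<^sup>2 / (4 * \<kappa>))"
    using \<kappa>(1) by (simp add: t field_simps power2_eq_square)
  finally show ?thesis by (simp add: emeasure_eq_measure)
qed

text \<open>The moment bound may hold only near 0; the condition r / (2 \<kappa>) <= t0 makes the
  optimal t admissible with either sign.\<close>

lemma (in prob_space) chernoff_sum:
  fixes Z :: "'i \<Rightarrow> 'a \<Rightarrow> real"
  assumes I: "finite I" and ind: "indep_vars (\<lambda>_. borel) Z I"
    and mgf: "\<And>i t. i \<in> I \<Longrightarrow> \<bar>t\<bar> \<le> t0 \<Longrightarrow>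
      (\<integral>\<^sup>+\<omega>. ennreal (exp (t * Z i \<omega>)) \<partial>M) \<le> ennreal (exp (K i * t\<^sup>2))"
    and \<kappa>: "0 < \<kappa>" "(\<Sum>i\<in>I. K i) \<le> \<kappa>" and r: "0 \<le> r" "r / (2 * \<kappa>) \<le> t0"
  shows "prob {\<omega> \<in> space M. r < \<bar>\<Sum>i\<in>I. Z i \<omega>\<bar>} \<le> 2 * exp (- (r\<^sup>2 / (4 * \<kappa>)))"
proof (cases "r = 0")
  case True
  \<comment> \<open>Here the optimal t would be 0, but the claimed bound is 2.\<close>
  then show ?thesis by (simp add: order_trans[OF prob_le_1])
next
  case False
  then have r0: "0 < r" using r by simp
  define t where "t = r / (2 * \<kappa>)"
  have t: "\<bar>t\<bar> \<le> t0" "\<bar>- t\<bar> \<le> t0" using r r0 \<kappa>(1) by (auto simp: t_def)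
  have meas: "Z i \<in> borel_measurable M" if "i \<in> I" for i
    using ind that by (auto simp: indep_vars_def)
  have sumM [measurable]: "(\<lambda>\<omega>. \<Sum>i\<in>I. Z i \<omega>) \<in> borel_measurable M"
    by (intro borel_measurable_sum meas)
  let ?P = "{\<omega> \<in> space M. r \<le> (\<Sum>i\<in>I. Z i \<omega>)}"
  let ?N = "{\<omega> \<in> space M. r \<le> (\<Sum>i\<in>I. - Z i \<omega>)}"
  have P: "prob ?P \<le> exp (- (r\<^sup>2 / (4 * \<kappa>)))"
    by (rule chernoff_sum_upper[OF I ind mgf[OF _ t(1)] \<kappa> r0 t_def])
  have ind': "indep_vars (\<lambda>_. borel) (\<lambda>i \<omega>. - Z i \<omega>) I"
    by (rule indep_vars_compose2[OF ind, where Y = "\<lambda>i x. - x"]) simp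
  have "(\<integral>\<^sup>+\<omega>. ennreal (exp (t * - Z i \<omega>)) \<partial>M) \<le> ennreal (exp (K i * t\<^sup>2))" if "i \<in> I" for i
    using mgf[OF that t(2)] by simp
  then have N: "prob ?N \<le> exp (- (r\<^sup>2 / (4 * \<kappa>)))"
    by (rule chernoff_sum_upper[OF I ind' _ \<kappa> r0 t_def])
  have "prob {\<omega> \<in> space M. r < \<bar>\<Sum>i\<in>I. Z i \<omega>\<bar>} \<le> prob (?P \<union> ?N)"
    by (rule finite_measure_mono) (auto simp: sum_negf abs_if split: if_splits)
  also have "\<dots> \<le> prob ?P + prob ?N"
    by (rule measure_Un_le) (simp_all add: sum_negf)
  finally show ?thesis using P N by linarith
qed

text \<open>Expansion in the matrix units reduces the expectation of a random matrix to those of its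
  entries.\<close>

lemma has_bochner_integral_matrix:
  fixes f :: "'a \<Rightarrow> real^'n^'m"
  assumes "\<And>p q. has_bochner_integral M (\<lambda>\<omega>. f \<omega> $ p $ q) (A $ p $ q)"
  shows "has_bochner_integral M f A"
proof -
  have pull: "(\<Sum>q\<in>UNIV. if P then g q else 0) = (if P then sum g UNIV else 0)"
    for P and g :: "'n \<Rightarrow> real" by simp
  have expand: "B = (\<Sum>p\<in>UNIV. \<Sum>q\<in>UNIV. B $ p $ q *\<^sub>R axis p (axis q 1))" for B :: "real^'n^'m"
    by (rule matrix_eq_entries)
      (simp add: pull axis_def if_distrib[of "\<lambda>x. x $ _"] if_distrib[of "\<lambda>x. _ * x"] cong: if_cong)
  have "has_bochner_integral M (\<lambda>\<omega>. \<Sum>p\<in>UNIV. \<Sum>q\<in>UNIV. f \<omega> $ p $ q *\<^sub>R (axis p (axis q 1) :: real^'n^'m))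
     (\<Sum>p\<in>UNIV. \<Sum>q\<in>UNIV. A $ p $ q *\<^sub>R axis p (axis q 1))"
    by (intro has_bochner_integral_sum has_bochner_integral_scaleR_left assms)
  then show ?thesis by (simp only: expand[symmetric])
qed

section \<open>Tails and moments of independent Gaussian noise\<close>

locale gaussian_noise = prob_space M for M :: "'w measure" +
  fixes u :: "nat \<Rightarrow> 'w \<Rightarrow> real^'k" and S :: "nat \<Rightarrow> real^'k^'k" and c :: real
  assumes indep_noise: "indep_vars (\<lambda>_. borel) u {1..}"
    and cov_symmetric: "\<And>i. i \<ge> 1 \<Longrightarrow> symmetric_matrix (S i)"
    and variance_pos: "\<And>i a. i \<ge> 1 \<Longrightarrow> a \<noteq> 0 \<Longrightarrow> 0 < a \<bullet> (S i *v a)"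
    and normal_noise: "\<And>i a. i \<ge> 1 \<Longrightarrow> a \<noteq> 0 \<Longrightarrow>
      distributed M lborel (\<lambda>\<omega>. a \<bullet> u i \<omega>) (normal_density 0 (sqrt (a \<bullet> (S i *v a))))"
    and c_pos: "0 < c" and variance_le: "\<And>i a. i \<ge> 1 \<Longrightarrow> a \<bullet> (S i *v a) \<le> c * (norm a)\<^sup>2"
begin

lemma measurable_noise [measurable]: "i \<ge> 1 \<Longrightarrow> u i \<in> borel_measurable M"
  using indep_noise by (auto simp: indep_vars_def)

lemma linear_form_tail:
  fixes a :: "nat \<Rightarrow> real^'k"
  assumes \<kappa>: "0 < \<kappa>" "(\<Sum>i=1..m. (norm (a i))\<^sup>2) \<le> \<kappa>" and r: "0 \<le> r"
  shows "prob {\<omega> \<in> space M. r < \<bar>\<Sum>i=1..m. a i \<bullet> u i \<omega>\<bar>} \<le> 2 * exp (- (r\<^sup>2 / (2 * c * \<kappa>)))"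
proof -
  have ind: "indep_vars (\<lambda>_. borel) (\<lambda>i \<omega>. a i \<bullet> u i \<omega>) {1..m}"
    by (rule indep_vars_compose2[OF indep_vars_subset[OF indep_noise], where Y = "\<lambda>i x. a i \<bullet> x"]) auto
  have mgf: "(\<integral>\<^sup>+\<omega>. ennreal (exp (t * (a i \<bullet> u i \<omega>))) \<partial>M) \<le> ennreal (exp ((c / 2 * (norm (a i))\<^sup>2) * t\<^sup>2))"
    if "i \<in> {1..m}" for i t
  proof (cases "a i = 0")
    case True
    then show ?thesis by (simp add: emeasure_space_1)
  next
    case False
    have i: "i \<ge> 1" using that by simp
    note v = variance_pos[OF i False]
    have "(\<integral>\<^sup>+\<omega>. ennreal (exp (t * (a i \<bullet> u i \<omega>))) \<partial>M) = ennreal (exp (t\<^sup>2 * (a i \<bullet> (S i *v a i)) / 2))"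
      using nn_integral_exp_normal[OF _ normal_noise[OF i False], of t] v by simp
    also have "\<dots> \<le> ennreal (exp (t\<^sup>2 * (c * (norm (a i))\<^sup>2) / 2))"
      using variance_le[OF i] by (intro ennreal_leI) (simp add: mult_left_mono)
    finally show ?thesis by (simp add: mult_ac)
  qed
  have sum: "(\<Sum>i=1..m. c / 2 * (norm (a i))\<^sup>2) \<le> c / 2 * \<kappa>"
    unfolding sum_distrib_left[symmetric] using c_pos \<kappa> by (intro mult_left_mono) auto
  have pos: "0 < c / 2 * \<kappa>" using c_pos \<kappa> by simp
  have "prob {\<omega> \<in> space M. r < \<bar>\<Sum>i=1..m. a i \<bullet> u i \<omega>\<bar>} \<le> 2 * exp (- (r\<^sup>2 / (4 * (c / 2 * \<kappa>))))"
    \<comment> \<open>Linear forms obey the moment bound for every t, so t0 is taken to be the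
      optimal t itself.\<close>
    by (rule chernoff_sum[OF _ ind mgf pos sum r order_refl]) auto
  then show ?thesis by (simp add: mult_ac)
qed

text \<open>The constants depend on \<open>B\<close> only through \<open>V\<close>, so one
  application serves both weighted sums. The norm is at most the sum of the s absolute coordinates,
  hence the union bound with threshold x m / s for each.\<close>

lemma linear_tail:
  assumes "0 < V"
  obtains N p where "0 < N" "0 < p"
    "\<And>(B :: nat \<Rightarrow> real^'k^'s) m x. 1 \<le> m \<Longrightarrow> 0 \<le> x \<Longrightarrow> (\<Sum>i=1..m. (norm (B i))\<^sup>2) \<le> V * real m \<Longrightarrow>
       prob {\<omega> \<in> space M. x * real m < norm (\<Sum>i=1..m. B i *v u i \<omega>)} \<le> N * exp (- (p * x\<^sup>2 * real m))"
proof
  define s where "s = real CARD('s)"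
  have s: "0 < s" by (simp add: s_def)
  show "0 < s * 2" "0 < 1 / (s\<^sup>2 * (2 * c * V))" using s c_pos assms by auto
  fix B :: "nat \<Rightarrow> real^'k^'s" and m :: nat and x :: real
  assume m: "1 \<le> m" and x: "0 \<le> x" and B: "(\<Sum>i=1..m. (norm (B i))\<^sup>2) \<le> V * real m"
  have [measurable]: "(\<lambda>\<omega>. \<Sum>i=1..m. B i $ j \<bullet> u i \<omega>) \<in> borel_measurable M" for j
    by (intro borel_measurable_sum borel_measurable_inner) auto
  let ?E = "\<lambda>j. {\<omega> \<in> space M. x * real m / s < \<bar>\<Sum>i=1..m. B i $ j \<bullet> u i \<omega>\<bar>}"
  have "{\<omega> \<in> space M. x * real m < norm (\<Sum>i=1..m. B i *v u i \<omega>)} \<subseteq> (\<Union>j\<in>UNIV. ?E j)"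
  proof
    fix \<omega> assume \<omega>: "\<omega> \<in> {\<omega> \<in> space M. x * real m < norm (\<Sum>i=1..m. B i *v u i \<omega>)}"
    show "\<omega> \<in> (\<Union>j\<in>UNIV. ?E j)"
    proof (rule ccontr)
      assume "\<omega> \<notin> (\<Union>j\<in>UNIV. ?E j)"
      then have *: "\<bar>\<Sum>i=1..m. B i $ j \<bullet> u i \<omega>\<bar> \<le> x * real m / s" for j
        using \<omega> by (auto simp: not_less)
      have "norm (\<Sum>i=1..m. B i *v u i \<omega>) \<le> (\<Sum>j\<in>UNIV. \<bar>(\<Sum>i=1..m. B i *v u i \<omega>) $ j\<bar>)"
        by (rule norm_le_l1_cart)
      also have "\<dots> \<le> (\<Sum>j\<in>(UNIV :: 's set). x * real m / s)"
        using * by (intro sum_mono) (simp add: matrix_vector_mul_component)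
      also have "\<dots> = x * real m" using s by (simp add: s_def)
      finally show False using \<omega> by simp
    qed
  qed
  then have "prob {\<omega> \<in> space M. x * real m < norm (\<Sum>i=1..m. B i *v u i \<omega>)} \<le> prob (\<Union>j\<in>UNIV. ?E j)"
    by (intro finite_measure_mono) auto
  also have "\<dots> \<le> (\<Sum>j\<in>UNIV. prob (?E j))"
    by (rule finite_measure_subadditive_finite) auto
  also have "\<dots> \<le> (\<Sum>j\<in>(UNIV :: 's set). 2 * exp (- ((x * real m / s)\<^sup>2 / (2 * c * (V * real m)))))"
  proof (rule sum_mono)
    fix j
    have "(\<Sum>i=1..m. (norm (B i $ j))\<^sup>2) \<le> (\<Sum>i=1..m. (norm (B i))\<^sup>2)"
      by (intro sum_mono power_mono Finite_Cartesian_Product.norm_nth_le) simp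
    then show "prob (?E j) \<le> 2 * exp (- ((x * real m / s)\<^sup>2 / (2 * c * (V * real m))))"
      using B m x s assms by (intro linear_form_tail) auto
  qed
  also have "\<dots> = s * 2 * exp (- (1 / (s\<^sup>2 * (2 * c * V)) * x\<^sup>2 * real m))"
    using m by (simp add: s_def power2_eq_square field_simps)
  finally show "prob {\<omega> \<in> space M. x * real m < norm (\<Sum>i=1..m. B i *v u i \<omega>)}
      \<le> s * 2 * exp (- (1 / (s\<^sup>2 * (2 * c * V)) * x\<^sup>2 * real m))" .
qed

text \<open>As |a| <= 2, every variance is at most 4 c, which gives the moment constant 4 (4 c)^2 =
  64 c^2 for |t| <= 1 / (16 c). The optimal t is x / (128 c^2), admissible exactly when x <= 8
  c.\<close>

lemma square_form_tail:
  assumes a: "a \<noteq> 0" "norm a \<le> 2" and m: "1 \<le> m" and x: "0 \<le> x" "x \<le> 8 * c"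
  shows "prob {\<omega> \<in> space M. x * real m < \<bar>\<Sum>i=1..m. (a \<bullet> u i \<omega>)\<^sup>2 - a \<bullet> (S i *v a)\<bar>}
    \<le> 2 * exp (- (x\<^sup>2 * real m / (256 * c\<^sup>2)))"
proof -
  have ind: "indep_vars (\<lambda>_. borel) (\<lambda>i \<omega>. (a \<bullet> u i \<omega>)\<^sup>2 - a \<bullet> (S i *v a)) {1..m}"
    by (rule indep_vars_compose2[OF indep_vars_subset[OF indep_noise],
          where Y = "\<lambda>i x. (a \<bullet> x)\<^sup>2 - a \<bullet> (S i *v a)"]) auto
  have na: "(norm a)\<^sup>2 \<le> 4" using power_mono[OF a(2), of 2] by simp
  have mgf: "(\<integral>\<^sup>+\<omega>. ennreal (exp (t * ((a \<bullet> u i \<omega>)\<^sup>2 - a \<bullet> (S i *v a)))) \<partial>M)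
      \<le> ennreal (exp ((4 * (4 * c)\<^sup>2) * t\<^sup>2))"
    if "i \<in> {1..m}" and t: "\<bar>t\<bar> \<le> 1 / (4 * (4 * c))" for i t
  proof -
    have i: "i \<ge> 1" using that by simp
    note v = variance_pos[OF i a(1)]
    have v2: "a \<bullet> (S i *v a) \<le> 4 * c"
      using variance_le[OF i, of a] mult_left_mono[OF na less_imp_le[OF c_pos]] by linarith
    have "\<bar>t\<bar> * (4 * (a \<bullet> (S i *v a))) \<le> 1 / (4 * (4 * c)) * (4 * (4 * c))"
      using t v v2 c_pos by (intro mult_mono) auto
    then have "\<bar>t\<bar> * (4 * (a \<bullet> (S i *v a))) \<le> 1" using c_pos by simp
    then have "(\<integral>\<^sup>+\<omega>. ennreal (exp (t * ((a \<bullet> u i \<omega>)\<^sup>2 - a \<bullet> (S i *v a)))) \<partial>M)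
        \<le> ennreal (exp (4 * (a \<bullet> (S i *v a))\<^sup>2 * t\<^sup>2))"
      using nn_integral_exp_centered_normal_square[OF _ normal_noise[OF i a(1)], of t] v by simp
    also have "\<dots> \<le> ennreal (exp ((4 * (4 * c)\<^sup>2) * t\<^sup>2))"
      using power_mono[OF v2, of 2] v
      by (intro ennreal_leI exp_le_cancel_iff[THEN iffD2] mult_right_mono mult_left_mono) auto
    finally show ?thesis .
  qed
  have pos: "0 < 4 * (4 * c)\<^sup>2 * real m" using m c_pos by simp
  have "prob {\<omega> \<in> space M. x * real m < \<bar>\<Sum>i=1..m. (a \<bullet> u i \<omega>)\<^sup>2 - a \<bullet> (S i *v a)\<bar>}
      \<le> 2 * exp (- ((x * real m)\<^sup>2 / (4 * (4 * (4 * c)\<^sup>2 * real m))))"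
  proof (rule chernoff_sum[OF _ ind mgf pos])
    show "x * real m / (2 * (4 * (4 * c)\<^sup>2 * real m)) \<le> 1 / (4 * (4 * c))"
      using m c_pos x by (simp add: field_simps power2_eq_square)
  qed (use x in auto)
  also have "(x * real m)\<^sup>2 / (4 * (4 * (4 * c)\<^sup>2 * real m)) = x\<^sup>2 * real m / (256 * c\<^sup>2)"
    using m by (simp add: power2_eq_square field_simps)
  finally show ?thesis .
qed

text \<open>A union bound over the polarization vectors. With n the factor from
  \<open>norm_symmetric_matrix_le\<close>, each quadratic form gets the threshold x / n, so the
  range x <= 8 c becomes x <= 8 c n.\<close>

lemma centered_squares_tail:
  obtains N p x0 where "0 < N" "0 < p" "0 < x0"
    "\<And>m x. 1 \<le> m \<Longrightarrow> 0 \<le> x \<Longrightarrow> x \<le> x0 \<Longrightarrow>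
       prob {\<omega> \<in> space M. x * real m < norm (\<Sum>i=1..m. outer (u i \<omega>) (u i \<omega>) - S i)}
         \<le> N * exp (- (p * x\<^sup>2 * real m))"
proof
  define n where "n = 2 * (real CARD('k))\<^sup>2"
  have n: "0 < n" by (simp add: n_def)
  let ?V = "polarization_vectors :: (real^'k) set"
  have "?V \<noteq> {}" by (auto simp: polarization_vectors_def)
  then have V: "0 < card ?V" using finite_polarization_vectors card_gt_0_iff by blast
  show "0 < real (card ?V) * 2" "0 < 1 / (n\<^sup>2 * (256 * c\<^sup>2))" "0 < n * (8 * c)"
    using n c_pos V by auto
  fix m :: nat and x :: real
  assume m: "1 \<le> m" and x: "0 \<le> x" "x \<le> n * (8 * c)"
  let ?Q = "\<lambda>\<omega>. \<Sum>i=1..m. outer (u i \<omega>) (u i \<omega>) - S i"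
  let ?E = "\<lambda>a. {\<omega> \<in> space M. x / n * real m < \<bar>\<Sum>i=1..m. (a \<bullet> u i \<omega>)\<^sup>2 - a \<bullet> (S i *v a)\<bar>}"
  have [measurable]: "(\<lambda>\<omega>. \<Sum>i=1..m. (a \<bullet> u i \<omega>)\<^sup>2 - a \<bullet> (S i *v a)) \<in> borel_measurable M" for a
    by (intro borel_measurable_sum borel_measurable_diff borel_measurable_power
        borel_measurable_inner) auto
  have form: "a \<bullet> (?Q \<omega> *v a) = (\<Sum>i=1..m. (a \<bullet> u i \<omega>)\<^sup>2 - a \<bullet> (S i *v a))" for a \<omega>
    by (simp add: mat_vec.sum_left mat_vec.diff_left inner_sum_right inner_diff_right quadratic_form_outer
        power2_eq_square)
  have sym: "symmetric_matrix (?Q \<omega>)" for \<omega>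
    using cov_symmetric
    by (simp add: symmetric_matrix_def transpose_sum transpose_diff transpose_outer)
  have "{\<omega> \<in> space M. x * real m < norm (?Q \<omega>)} \<subseteq> (\<Union>a\<in>?V. ?E a)"
  proof
    fix \<omega> assume \<omega>: "\<omega> \<in> {\<omega> \<in> space M. x * real m < norm (?Q \<omega>)}"
    show "\<omega> \<in> (\<Union>a\<in>?V. ?E a)"
    proof (rule ccontr)
      assume "\<omega> \<notin> (\<Union>a\<in>?V. ?E a)"
      then have "\<bar>a \<bullet> (?Q \<omega> *v a)\<bar> \<le> x / n * real m" if "a \<in> ?V" for a
        using \<omega> that unfolding form by (auto simp: not_less)
      from norm_symmetric_matrix_le[OF sym this] have "norm (?Q \<omega>) \<le> n * (x / n * real m)"
        by (simp add: n_def)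
      then show False using \<omega> n by simp
    qed
  qed
  then have "prob {\<omega> \<in> space M. x * real m < norm (?Q \<omega>)} \<le> prob (\<Union>a\<in>?V. ?E a)"
    by (intro finite_measure_mono) (auto intro!: sets.finite_UN finite_polarization_vectors)
  also have "\<dots> \<le> (\<Sum>a\<in>?V. prob (?E a))"
    by (rule finite_measure_subadditive_finite) (auto simp: finite_polarization_vectors)
  also have "\<dots> \<le> (\<Sum>a\<in>?V. 2 * exp (- ((x / n)\<^sup>2 * real m / (256 * c\<^sup>2))))"
    using x n m
    by (intro sum_mono square_form_tail nonzero_polarization_vectors norm_polarization_vectors)
      (auto simp: field_simps)
  also have "\<dots> = real (card ?V) * 2 * exp (- (1 / (n\<^sup>2 * (256 * c\<^sup>2)) * x\<^sup>2 * real m))"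
    by (simp add: power_divide)
  finally show "prob {\<omega> \<in> space M. x * real m < norm (?Q \<omega>)}
      \<le> real (card ?V) * 2 * exp (- (1 / (n\<^sup>2 * (256 * c\<^sup>2)) * x\<^sup>2 * real m))" .
qed

lemma has_bochner_integral_linear_form:
  assumes i: "i \<ge> 1"
  shows "has_bochner_integral M (\<lambda>\<omega>. a \<bullet> u i \<omega>) 0"
    "has_bochner_integral M (\<lambda>\<omega>. (a \<bullet> u i \<omega>)\<^sup>2) (a \<bullet> (S i *v a))"
proof -
  have "has_bochner_integral M (\<lambda>\<omega>. a \<bullet> u i \<omega>) 0 \<and>
    has_bochner_integral M (\<lambda>\<omega>. (a \<bullet> u i \<omega>)\<^sup>2) (a \<bullet> (S i *v a))"
  proof (cases "a = 0")
    case True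
    then show ?thesis by (simp add: has_bochner_integral_zero)
  next
    case False
    let ?\<sigma> = "sqrt (a \<bullet> (S i *v a))"
    have \<sigma>: "0 < ?\<sigma>" using variance_pos[OF i False] by simp
    note N = normal_noise[OF i False]
    have m1: "has_bochner_integral lborel (\<lambda>x. normal_density 0 ?\<sigma> x * x) 0"
      using normal_moment_odd[OF \<sigma>, of 0 0] by simp
    have m2: "has_bochner_integral lborel (\<lambda>x. normal_density 0 ?\<sigma> x * x\<^sup>2) (a \<bullet> (S i *v a))"
      using normal_moment_even[OF \<sigma>, of 0 1] variance_pos[OF i False] by (simp add: fact_numeral)
    have "integrable M (\<lambda>\<omega>. a \<bullet> u i \<omega>)" "(\<integral>\<omega>. a \<bullet> u i \<omega> \<partial>M) = 0"
      using distributed_integrable[OF N, of "\<lambda>x. x"] distributed_integral[OF N, of "\<lambda>x. x"] m1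
      by (auto simp: has_bochner_integral_iff)
    moreover have "integrable M (\<lambda>\<omega>. (a \<bullet> u i \<omega>)\<^sup>2)" "(\<integral>\<omega>. (a \<bullet> u i \<omega>)\<^sup>2 \<partial>M) = a \<bullet> (S i *v a)"
      using distributed_integrable[OF N, of "\<lambda>x. x\<^sup>2"] distributed_integral[OF N, of "\<lambda>x. x\<^sup>2"] m2
      by (auto simp: has_bochner_integral_iff)
    ultimately show ?thesis by (simp add: has_bochner_integral_iff)
  qed
  then show "has_bochner_integral M (\<lambda>\<omega>. a \<bullet> u i \<omega>) 0"
    "has_bochner_integral M (\<lambda>\<omega>. (a \<bullet> u i \<omega>)\<^sup>2) (a \<bullet> (S i *v a))" by auto
qed

text \<open>For equal indices, polarization recovers the entries from second moments of linear
  forms. For distinct indices, independence factors the expectation into a product of zero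
  means.\<close>

lemma has_bochner_integral_noise_outer:
  assumes i: "i \<ge> 1" and j: "j \<ge> 1"
  shows "has_bochner_integral M (\<lambda>\<omega>. outer (u i \<omega>) (u j \<omega>)) (if i = j then S i else 0)"
proof (rule has_bochner_integral_matrix)
  fix p q :: 'k
  let ?e = "\<lambda>p. axis p 1 :: real^'k"
  have comp: "x $ p = ?e p \<bullet> x" for x :: "real^'k" and p by (simp add: inner_axis')
  show "has_bochner_integral M (\<lambda>\<omega>. outer (u i \<omega>) (u j \<omega>) $ p $ q) ((if i = j then S i else 0) $ p $ q)"
  proof (cases "i = j")
    case True
    have "has_bochner_integral M
       (\<lambda>\<omega>. (((?e p + ?e q) \<bullet> u i \<omega>)\<^sup>2 - (?e p \<bullet> u i \<omega>)\<^sup>2 - (?e q \<bullet> u i \<omega>)\<^sup>2) / 2)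
       (((?e p + ?e q) \<bullet> (S i *v (?e p + ?e q)) - ?e p \<bullet> (S i *v ?e p) - ?e q \<bullet> (S i *v ?e q)) / 2)"
      by (intro has_bochner_integral_divide_zero has_bochner_integral_diff
          has_bochner_integral_linear_form i)
    moreover have "((?e p + ?e q) \<bullet> (S i *v (?e p + ?e q)) - ?e p \<bullet> (S i *v ?e p) - ?e q \<bullet> (S i *v ?e q)) / 2
        = S i $ p $ q"
      using symmetric_matrix_entry_polarization[OF cov_symmetric[OF i], of p q] by simp
    moreover have "(((?e p + ?e q) \<bullet> u i \<omega>)\<^sup>2 - (?e p \<bullet> u i \<omega>)\<^sup>2 - (?e q \<bullet> u i \<omega>)\<^sup>2) / 2
        = outer (u i \<omega>) (u j \<omega>) $ p $ q" for \<omega>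
      using True by (simp add: outer_def inner_add_left inner_axis' power2_eq_square algebra_simps)
    ultimately show ?thesis using True by simp
  next
    case False
    \<comment> \<open>Independence of the pair comes from restricting the family to the disjoint
      index sets {i} and {j}.\<close>
    have ind: "indep_var borel (\<lambda>\<omega>. ?e p \<bullet> u i \<omega>) borel (\<lambda>\<omega>. ?e q \<bullet> u j \<omega>)"
    proof -
      have "indep_var borel ((\<lambda>f. ?e p \<bullet> f i) \<circ> (\<lambda>\<omega>. restrict (\<lambda>i. u i \<omega>) {i}))
         borel ((\<lambda>f. ?e q \<bullet> f j) \<circ> (\<lambda>\<omega>. restrict (\<lambda>i. u i \<omega>) {j}))"
        using i j False
        by (intro indep_var_compose[OF indep_var_restrict[OF indep_noise]] borel_measurable_inner) auto
      then show ?thesis by (simp add: comp_def)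
    qed
    note L = has_bochner_integral_linear_form(1)[OF i, of "?e p"]
      has_bochner_integral_linear_form(1)[OF j, of "?e q"]
    have "has_bochner_integral M (\<lambda>\<omega>. (?e p \<bullet> u i \<omega>) * (?e q \<bullet> u j \<omega>)) 0"
      using indep_var_lebesgue_integral[OF ind] indep_var_integrable[OF ind] L
      by (simp add: has_bochner_integral_iff)
    then show ?thesis using False by (simp add: outer_def inner_axis')
  qed
qed

end


section \<open>Consequences of concentration\<close>

text \<open>The constants are quantified before x, so x may vary with m in applications; the 1 / m
  leaves room for the bias correction.\<close>

definition concentrates :: "(nat \<Rightarrow> real \<Rightarrow> 'w set) \<Rightarrow> (nat \<Rightarrow> 'w \<Rightarrow> 'b::real_normed_vector) \<Rightarrow> bool" where
  "concentrates Good T \<longleftrightarrow> (\<exists>C>0. \<exists>\<delta>>0. \<exists>m2. \<forall>m\<ge>m2. \<forall>x. 0 \<le> x \<longrightarrow> x \<le> \<delta> \<longrightarrow>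
     (\<forall>\<omega>\<in>Good m x. norm (T m \<omega>) \<le> C * (x + 1 / real m)))"

text \<open>On the event \<open>Good m x\<close> the relevant noise averages are at most \<open>x\<close>.\<close>

locale good_events = prob_space M for M :: "'w measure" +
  fixes Good :: "nat \<Rightarrow> real \<Rightarrow> 'w set" and N p x0 :: real and m1 :: nat
  assumes Good_sets: "\<And>m x. m \<ge> m1 \<Longrightarrow> Good m x \<in> sets M"
    and tail_pos: "0 < N" "0 < p" "0 < x0"
    and tail: "\<And>m x. m \<ge> m1 \<Longrightarrow> 0 \<le> x \<Longrightarrow> x \<le> x0 \<Longrightarrow>
      prob (space M - Good m x) \<le> N * exp (- (p * x\<^sup>2 * real m))"
begin

text \<open>Monotonicity asks for measurability of the larger set only, so the outcomes satisfying
  \<open>P\<close> may form any set.\<close>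

lemma prob_le_tail:
  assumes "m \<ge> m1" "0 \<le> x" "x \<le> x0"
    and "\<And>\<omega>. \<omega> \<in> space M \<Longrightarrow> \<omega> \<in> Good m x \<Longrightarrow> \<not> P \<omega>"
  shows "prob {\<omega> \<in> space M. P \<omega>} \<le> N * exp (- (p * x\<^sup>2 * real m))"
proof -
  have "prob {\<omega> \<in> space M. P \<omega>} \<le> prob (space M - Good m x)"
    by (rule finite_measure_mono) (use assms(4) Good_sets[OF assms(1)] in auto)
  then show ?thesis using tail[OF assms(1-3)] by linarith
qed

text \<open>With x = L m^(-1/2) the tail N exp (- p x^2 m) equals N exp (- p L^2), which is free of
  m, and L is chosen to make it smaller than \<epsilon>.\<close>

lemma concentrates_bigo_prob:
  assumes "concentrates Good T" and meas: "\<forall>\<^sub>F m in sequentially. T m \<in> borel_measurable M"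
  shows "bigo_prob M T (\<lambda>m. real m powr (- 1 / 2))"
  unfolding bigo_prob_def
proof (intro conjI meas allI impI)
  obtain C \<delta> m2 where C: "0 < C" "0 < \<delta>"
    and bound: "\<And>m x \<omega>. m \<ge> m2 \<Longrightarrow> 0 \<le> x \<Longrightarrow> x \<le> \<delta> \<Longrightarrow> \<omega> \<in> Good m x \<Longrightarrow>
      norm (T m \<omega>) \<le> C * (x + 1 / real m)"
    using assms(1) unfolding concentrates_def by metis
  fix \<epsilon> :: real assume \<epsilon>: "0 < \<epsilon>"
  have "((\<lambda>L. N * exp (- (p * L\<^sup>2))) \<longlongrightarrow> 0) at_top"
    using tail_pos by real_asymp
  then have "\<forall>\<^sub>F L in at_top. N * exp (- (p * L\<^sup>2)) < \<epsilon>"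
    using \<epsilon> by (rule order_tendstoD)
  then obtain L where L: "1 \<le> L" "N * exp (- (p * L\<^sup>2)) < \<epsilon>"
    using eventually_conj[OF eventually_ge_at_top[of "1 :: real"]] eventually_happens'[OF trivial_limit_at_top_linorder]
    by (metis (no_types, lifting))
  have lim: "((\<lambda>m. L * real m powr (- 1 / 2)) \<longlongrightarrow> 0) sequentially" by real_asymp
  have "\<forall>\<^sub>F m in sequentially. L * real m powr (- 1 / 2) < min \<delta> x0"
    using C tail_pos by (intro order_tendstoD(2)[OF lim]) simp
  then have "\<forall>\<^sub>F m in sequentially. prob {\<omega> \<in> space M. norm (T m \<omega>) > (2 * C * L) * real m powr (- 1 / 2)} \<le> \<epsilon>"
    using eventually_ge_at_top[of "max 1 (max m1 m2)"]
  proof eventually_elim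
    case (elim m)
    define x where "x = L * real m powr (- 1 / 2)"
    have m: "1 \<le> real m" "m \<ge> m1" "m \<ge> m2" using elim by auto
    have x: "0 \<le> x" "x \<le> \<delta>" "x \<le> x0" using elim L by (auto simp: x_def)
    \<comment> \<open>Since L >= 1 and m >= 1, also 1 / m <= x; this accounts for the factor 2 in 2
      C L.\<close>
    have "real m powr (- 1) \<le> real m powr (- 1 / 2)" using m(1) by (intro powr_mono) auto
    also have "\<dots> \<le> x" using mult_right_mono[OF L(1), of "real m powr (- 1 / 2)"] by (simp add: x_def)
    finally have "1 / real m \<le> x" using m(1) by (simp add: powr_minus_divide)
    then have "C * (x + 1 / real m) \<le> (2 * C * L) * real m powr (- 1 / 2)"
      using mult_left_mono[of "x + 1 / real m" "2 * x" C] C by (simp add: x_def mult_ac)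
    then have "prob {\<omega> \<in> space M. norm (T m \<omega>) > (2 * C * L) * real m powr (- 1 / 2)}
        \<le> N * exp (- (p * x\<^sup>2 * real m))"
      using bound[OF m(3) x(1,2)] by (intro prob_le_tail m x) (meson not_less order_trans)
    also have "x\<^sup>2 * real m = L\<^sup>2"
    proof -
      have "(real m powr (- 1 / 2))\<^sup>2 = real m powr (- 1)"
        by (simp only: power2_eq_square powr_add[symmetric]) simp
      then show ?thesis using m(1) by (simp add: x_def power_mult_distrib power_divide powr_minus_divide)
    qed
    then have "p * x\<^sup>2 * real m = p * L\<^sup>2" by (simp add: mult.assoc)
    finally show ?case using L(2) by simp
  qed
  then show "\<exists>C>0. \<forall>\<^sub>F m in sequentially.
      prob {\<omega> \<in> space M. norm (T m \<omega>) > C * real m powr (- 1 / 2)} \<le> \<epsilon>"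
    using C L by (intro exI[of _ "2 * C * L"]) auto
qed

text \<open>Formulated for predicates that fail whenever \<open>T m\<close> is small, so that it
  applies both to the distance of the projected estimate from \<Psi> and to the event that
  projection changes the estimate.\<close>

lemma concentrates_exponential:
  assumes "concentrates Good T" "0 < \<eta>"
  obtains r m2 where "0 < r"
    "\<And>m P. m \<ge> m2 \<Longrightarrow> (\<And>\<omega>. \<omega> \<in> space M \<Longrightarrow> norm (T m \<omega>) \<le> \<eta> \<Longrightarrow> \<not> P \<omega>) \<Longrightarrow>
       prob {\<omega> \<in> space M. P \<omega>} \<le> N * exp (- (r * real m))"
proof -
  obtain C \<delta> m2 where C: "0 < C" "0 < \<delta>"
    and bound: "\<And>m x \<omega>. m \<ge> m2 \<Longrightarrow> 0 \<le> x \<Longrightarrow> x \<le> \<delta> \<Longrightarrow> \<omega> \<in> Good m x \<Longrightarrow>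
      norm (T m \<omega>) \<le> C * (x + 1 / real m)"
    using assms(1) unfolding concentrates_def by metis
  \<comment> \<open>The allowance \<eta> is halved: C x uses one half, and m >= m3 keeps C / m
    within the other.\<close>
  define x where "x = min (min \<delta> x0) (\<eta> / (2 * C))"
  have x: "0 < x" "x \<le> \<delta>" "x \<le> x0" "x \<le> \<eta> / (2 * C)"
    using C tail_pos assms(2) by (auto simp: x_def)
  obtain m3 :: nat where m3: "2 * C / \<eta> \<le> real m3" using real_arch_simple by blast
  show thesis
  proof (rule that[of "p * x\<^sup>2" "max (max m1 m2) (max m3 1)"])
    show "0 < p * x\<^sup>2" using tail_pos x by simp
    fix m P
    assume m: "m \<ge> max (max m1 m2) (max m3 1)"
      and P: "\<And>\<omega>. \<omega> \<in> space M \<Longrightarrow> norm (T m \<omega>) \<le> \<eta> \<Longrightarrow> \<not> P \<omega>"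
    have mp: "0 < real m" using m by simp
    have "2 * C / \<eta> \<le> real m" using m m3 by linarith
    then have "1 / real m \<le> \<eta> / (2 * C)" using C assms(2) mp by (simp add: field_simps)
    then have "C * (x + 1 / real m) \<le> C * (\<eta> / (2 * C) + \<eta> / (2 * C))"
      using x C by (intro mult_left_mono) auto
    also have "\<dots> = \<eta>" using C by simp
    finally have "norm (T m \<omega>) \<le> \<eta>" if "\<omega> \<in> Good m x" for \<omega>
      using order_trans[OF bound[of m x \<omega>]] that m x by simp
    then show "prob {\<omega> \<in> space M. P \<omega>} \<le> N * exp (- (p * x\<^sup>2 * real m))"
      using m x by (intro prob_le_tail P) auto
  qed
qed

end


section \<open>The model\<close>

lemma has_bochner_integral_matrix_mult:
  fixes A :: "real^'n^'m" and B :: "real^'q^'p"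
  assumes "has_bochner_integral M f Z"
  shows "has_bochner_integral M (\<lambda>\<omega>. A ** f \<omega> ** B) (A ** Z ** B)"
  by (intro has_bochner_integral_bounded_linear[OF mat_mult.bounded_linear_left]
      has_bochner_integral_bounded_linear[OF mat_mult.bounded_linear_right] assms)

lemma (in prob_space) has_bochner_integral_constant: "has_bochner_integral M (\<lambda>_. a) a"
  for a :: "real^'n^'m"
  by (simp add: has_bochner_integral_iff prob_space)

context gaussian_noise
begin

lemma has_bochner_integral_noise_transform:
  fixes A :: "real^'k^'n" and B :: "real^'k^'p"
  assumes "i \<ge> 1" "j \<ge> 1"
  shows "has_bochner_integral M (\<lambda>\<omega>. outer (A *v u i \<omega>) (B *v u j \<omega>))
    (if i = j then A ** S i ** transpose B else 0)"
proof -
  have "has_bochner_integral M (\<lambda>\<omega>. A ** outer (u i \<omega>) (u j \<omega>) ** transpose B)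
      (A ** (if i = j then S i else 0) ** transpose B)"
    by (intro has_bochner_integral_matrix_mult has_bochner_integral_noise_outer assms)
  moreover have "A ** (if i = j then S i else 0) ** transpose B = (if i = j then A ** S i ** transpose B else 0)"
    by (simp add: mat_mult.zero_left mat_mult.zero_right)
  ultimately show ?thesis by (simp add: outer_mult_left outer_mult_right matrix_mul_assoc)
qed

lemma has_bochner_integral_psi_hat0:
  fixes X :: "nat \<Rightarrow> real^'s^'k"
  assumes S: "\<And>i. i \<ge> 1 \<Longrightarrow> S i = \<Psi> + D i" and m: "m \<ge> 1" and inv: "invertible (gram X m)"
    and y: "\<And>i \<omega>. i \<ge> 1 \<Longrightarrow> \<omega> \<in> space M \<Longrightarrow> y i \<omega> = X i *v \<beta> + u i \<omega>"
  shows "has_bochner_integral M (\<lambda>\<omega>. psi_hat0 X D m (\<lambda>i. y i \<omega>)) (\<Psi> + bias0 X D m \<Psi>)"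
proof -
  define A where "A = matrix_inv (gram X m)"
  \<comment> \<open>Block (i, j) of the projection X (X^T X)^-1 X^T. Then X_i b is the sum over j of
    H_ij u_j, and in the expectation of a product only equal noise indices survive.\<close>
  define H where "H i j = X i ** A ** transpose (X j)" for i j
  have tA: "transpose A = A" unfolding A_def by (rule matrix_inv_symmetric[OF inv symmetric_gram])
  have tH: "transpose (H i j) = H j i" for i j
    by (simp add: H_def matrix_transpose_mul tA matrix_mul_assoc)
  define b where "b \<omega> = A *v (\<Sum>j=1..m. transpose (X j) *v u j \<omega>)" for \<omega>
  have Xb: "X i *v b \<omega> = (\<Sum>j=1..m. H i j *v u j \<omega>)" for i \<omega>
    by (simp add: b_def H_def mat_vec.sum_right matrix_vector_mul_assoc matrix_mul_assoc)
  have I1: "has_bochner_integral M (\<lambda>\<omega>. \<Sum>i=1..m. outer (u i \<omega>) (u i \<omega>) - (\<Psi> + D i)) (\<Sum>i=1..m. 0)"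
  proof (rule has_bochner_integral_sum)
    fix i assume "i \<in> {1..m}"
    then have i: "i \<ge> 1" by simp
    have "has_bochner_integral M (\<lambda>\<omega>. outer (u i \<omega>) (u i \<omega>) - (\<Psi> + D i)) (S i - (\<Psi> + D i))"
      using has_bochner_integral_noise_outer[OF i i]
      by (intro has_bochner_integral_diff has_bochner_integral_constant) simp
    then show "has_bochner_integral M (\<lambda>\<omega>. outer (u i \<omega>) (u i \<omega>) - (\<Psi> + D i)) 0"
      by (simp add: S[OF i])
  qed
  have I2: "has_bochner_integral M (\<lambda>\<omega>. \<Sum>i=1..m. outer (u i \<omega>) (X i *v b \<omega>)) (\<Sum>i=1..m. S i ** H i i)"
  proof (rule has_bochner_integral_sum)
    fix i assume i: "i \<in> {1..m}"
    have "has_bochner_integral M (\<lambda>\<omega>. \<Sum>j=1..m. outer (mat 1 *v u i \<omega>) (H i j *v u j \<omega>))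
       (\<Sum>j=1..m. if i = j then mat 1 ** S i ** transpose (H i j) else 0)"
      using i by (intro has_bochner_integral_sum has_bochner_integral_noise_transform) auto
    moreover have "(\<Sum>j=1..m. if i = j then mat 1 ** S i ** transpose (H i j) else 0) = S i ** H i i"
      using i by (simp add: tH)
    ultimately show "has_bochner_integral M (\<lambda>\<omega>. outer (u i \<omega>) (X i *v b \<omega>)) (S i ** H i i)"
      by (simp add: Xb outer_bilin.sum_right)
  qed
  have I3: "has_bochner_integral M (\<lambda>\<omega>. \<Sum>i=1..m. outer (X i *v b \<omega>) (u i \<omega>)) (\<Sum>i=1..m. H i i ** S i)"
  proof (rule has_bochner_integral_sum)
    fix i assume i: "i \<in> {1..m}"
    have "has_bochner_integral M (\<lambda>\<omega>. \<Sum>j=1..m. outer (H i j *v u j \<omega>) (mat 1 *v u i \<omega>))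
       (\<Sum>j=1..m. if j = i then H i j ** S j ** transpose (mat 1) else 0)"
      using i by (intro has_bochner_integral_sum has_bochner_integral_noise_transform) auto
    moreover have "(\<Sum>j=1..m. if j = i then H i j ** S j ** transpose (mat 1) else 0) = H i i ** S i"
      using i by simp
    ultimately show "has_bochner_integral M (\<lambda>\<omega>. outer (X i *v b \<omega>) (u i \<omega>)) (H i i ** S i)"
      by (simp add: Xb outer_bilin.sum_left)
  qed
  have I4: "has_bochner_integral M (\<lambda>\<omega>. \<Sum>i=1..m. outer (X i *v b \<omega>) (X i *v b \<omega>))
      (\<Sum>i=1..m. \<Sum>j=1..m. H i j ** S j ** H j i)"
  proof (rule has_bochner_integral_sum)
    fix i assume i: "i \<in> {1..m}"
    have "has_bochner_integral M (\<lambda>\<omega>. \<Sum>j=1..m. \<Sum>l=1..m. outer (H i j *v u j \<omega>) (H i l *v u l \<omega>))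
       (\<Sum>j=1..m. \<Sum>l=1..m. if j = l then H i j ** S j ** transpose (H i l) else 0)"
      by (intro has_bochner_integral_sum has_bochner_integral_noise_transform) auto
    moreover have "(\<Sum>j=1..m. \<Sum>l=1..m. if j = l then H i j ** S j ** transpose (H i l) else 0)
        = (\<Sum>j=1..m. H i j ** S j ** H j i)"
      by (intro sum.cong refl) (simp add: tH)
    ultimately show "has_bochner_integral M (\<lambda>\<omega>. outer (X i *v b \<omega>) (X i *v b \<omega>))
        (\<Sum>j=1..m. H i j ** S j ** H j i)"
      by (simp add: Xb outer_bilin.sum_left outer_bilin.sum_right)
        \<comment> \<open>Expanding both arguments yields the double sum with its order of summation
          exchanged.\<close>
        (simp add: sum.swap[of "\<lambda>i' j'. outer (H i j' *v u j' _) (H i i' *v u i' _)"])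
  qed
  have "has_bochner_integral M (\<lambda>\<omega>. \<Psi> + (1 / real m) *\<^sub>R
      ((\<Sum>i=1..m. outer (u i \<omega>) (u i \<omega>) - (\<Psi> + D i))
        - (\<Sum>i=1..m. outer (u i \<omega>) (X i *v b \<omega>)) - (\<Sum>i=1..m. outer (X i *v b \<omega>) (u i \<omega>))
        + (\<Sum>i=1..m. outer (X i *v b \<omega>) (X i *v b \<omega>))))
     (\<Psi> + (1 / real m) *\<^sub>R ((\<Sum>i=1..m. 0) - (\<Sum>i=1..m. S i ** H i i) - (\<Sum>i=1..m. H i i ** S i)
        + (\<Sum>i=1..m. \<Sum>j=1..m. H i j ** S j ** H j i)))"
    by (intro has_bochner_integral_add has_bochner_integral_diff has_bochner_integral_scaleR_right
        I1 I2 I3 I4 has_bochner_integral_constant)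
  also have "\<Psi> + (1 / real m) *\<^sub>R ((\<Sum>i=1..m. 0) - (\<Sum>i=1..m. S i ** H i i) - (\<Sum>i=1..m. H i i ** S i)
        + (\<Sum>i=1..m. \<Sum>j=1..m. H i j ** S j ** H j i)) = \<Psi> + bias0 X D m \<Psi>"
  proof -
    have "(\<Sum>i=1..m. S i ** H i i) = (\<Sum>i=1..m. (\<Psi> + D i) ** X i ** A ** transpose (X i))"
      by (intro sum.cong refl) (simp add: S H_def matrix_mul_assoc)
    moreover have "(\<Sum>i=1..m. H i i ** S i) = (\<Sum>i=1..m. X i ** A ** transpose (X i) ** (\<Psi> + D i))"
      by (intro sum.cong refl) (simp add: S H_def)
    moreover have "(\<Sum>i=1..m. \<Sum>j=1..m. H i j ** S j ** H j i)
        = (\<Sum>i=1..m. X i ** A ** (\<Sum>j=1..m. transpose (X j) ** (\<Psi> + D j) ** X j) ** A ** transpose (X i))"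
      unfolding mat_mult.sum_left mat_mult.sum_right
      by (intro sum.cong refl) (simp add: S H_def matrix_mul_assoc)
    ultimately show ?thesis
      by (simp add: bias0_def A_def[symmetric] scaleR_right_diff_distrib scaleR_right_distrib)
  qed
  finally show ?thesis
  proof (rule has_bochner_integral_cong[THEN iffD1, OF refl _ refl, rotated])
    fix \<omega> assume \<omega>: "\<omega> \<in> space M"
    have "psi_hat0 X D m (\<lambda>i. y i \<omega>) - \<Psi> = (1 / real m) *\<^sub>R
      ((\<Sum>i=1..m. outer (u i \<omega>) (u i \<omega>) - (\<Psi> + D i))
        - (\<Sum>i=1..m. outer (u i \<omega>) (X i *v b \<omega>)) - (\<Sum>i=1..m. outer (X i *v b \<omega>) (u i \<omega>))
        + (\<Sum>i=1..m. outer (X i *v b \<omega>) (X i *v b \<omega>)))"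
      using psi_hat0_error[OF m inv, of "\<lambda>i. y i \<omega>" \<beta> "\<lambda>i. u i \<omega>" "b \<omega>" D \<Psi>] y \<omega>
      by (simp add: centered_squares_def b_def A_def)
    then show "\<Psi> + (1 / real m) *\<^sub>R
      ((\<Sum>i=1..m. outer (u i \<omega>) (u i \<omega>) - (\<Psi> + D i))
        - (\<Sum>i=1..m. outer (u i \<omega>) (X i *v b \<omega>)) - (\<Sum>i=1..m. outer (X i *v b \<omega>) (u i \<omega>))
        + (\<Sum>i=1..m. outer (X i *v b \<omega>) (X i *v b \<omega>))) = psi_hat0 X D m (\<lambda>i. y i \<omega>)"
      by (simp add: algebra_simps)
  qed
qed

text \<open>The bias correction is affine in its argument, so applying it to an estimator with bias \<open>b\<close>
  leaves the linear part of the bias map evaluated at \<open>- b\<close>.\<close>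

lemma has_bochner_integral_psi_hat1:
  fixes X :: "nat \<Rightarrow> real^'s^'k"
  assumes S: "\<And>i. i \<ge> 1 \<Longrightarrow> S i = \<Psi> + D i" and m: "m \<ge> 1" and inv: "invertible (gram X m)"
    and y: "\<And>i \<omega>. i \<ge> 1 \<Longrightarrow> \<omega> \<in> space M \<Longrightarrow> y i \<omega> = X i *v \<beta> + u i \<omega>"
  shows "has_bochner_integral M (\<lambda>\<omega>. psi_hat1 X D m (\<lambda>i. y i \<omega>))
    (\<Psi> - bias_map X m (\<lambda>_. bias0 X D m \<Psi>))"
proof -
  let ?L = "\<lambda>P. bias_map X m (\<lambda>_. P)"
  note I = has_bochner_integral_psi_hat0[OF assms]
  have "has_bochner_integral M (\<lambda>\<omega>. psi_hat0 X D m (\<lambda>i. y i \<omega>)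
      - (?L (psi_hat0 X D m (\<lambda>i. y i \<omega>)) + bias_map X m D))
    (\<Psi> + bias0 X D m \<Psi> - (?L (\<Psi> + bias0 X D m \<Psi>) + bias_map X m D))"
    by (intro has_bochner_integral_diff has_bochner_integral_add I
        has_bochner_integral_bounded_linear[OF bounded_linear_bias_map I]
        has_bochner_integral_constant)
  moreover have "\<Psi> + bias0 X D m \<Psi> - (?L (\<Psi> + bias0 X D m \<Psi>) + bias_map X m D)
      = \<Psi> - ?L (bias0 X D m \<Psi>)"
    by (simp add: bias_map_add) (simp add: bias0_bias_map bias_map_add)
  moreover have "psi_hat1 X D m z = psi_hat0 X D m z - (?L (psi_hat0 X D m z) + bias_map X m D)" for z
    by (simp add: psi_hat1_def bias0_bias_map bias_map_add)
  ultimately show ?thesis by simp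
qed

end

section \<open>From the assumptions of the model to uniform bounds and independent noise\<close>

lemma gram_convergent_bounds:
  fixes X :: "nat \<Rightarrow> real^'s^'k"
  assumes "(\<lambda>m. (1 / real m) *\<^sub>R gram X m) \<longlonglongrightarrow> G" "pos_definite G"
  obtains m1 g h where "m1 \<ge> 1" "0 < g" "0 < h"
    "\<And>m x. m \<ge> m1 \<Longrightarrow> g * real m * (norm x)\<^sup>2 \<le> x \<bullet> (gram X m *v x)"
    "\<And>m. m \<ge> m1 \<Longrightarrow> (\<Sum>i=1..m. (norm (X i))\<^sup>2) \<le> h * real m"
proof -
  obtain c where c: "0 < c" "\<And>x. c * (norm x)\<^sup>2 \<le> x \<bullet> (G *v x)"
    using pos_definite_coercive[OF assms(2)] by blast
  \<comment> \<open>Half of the coercivity of the limit absorbs the deviation of the averaged Gram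
    matrix from it.\<close>
  define g where "g = c / 2"
  have g: "0 < g" using c by (simp add: g_def)
  obtain m2 where m2: "\<And>m. m \<ge> m2 \<Longrightarrow> norm ((1 / real m) *\<^sub>R gram X m - G) < g"
    using LIMSEQ_D[OF assms(1) g] by blast
  define h where "h = real CARD('s) * (norm G + g)"
  show thesis
  proof
    show "max m2 1 \<ge> 1" "0 < g" by (simp_all add: g)
    show "0 < h" using g by (simp add: h_def add_nonneg_pos)
    fix m assume m: "m \<ge> max m2 1"
    have mp: "0 < real m" using m by simp
    define E where "E = (1 / real m) *\<^sub>R gram X m - G"
    have E: "norm E \<le> g" using m2[of m] m by (simp add: E_def)
    have gr: "gram X m = real m *\<^sub>R (G + E)" using mp by (simp add: E_def)
    show "g * real m * (norm x)\<^sup>2 \<le> x \<bullet> (gram X m *v x)" for x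
    proof -
      have "\<bar>x \<bullet> (E *v x)\<bar> \<le> g * (norm x)\<^sup>2"
        by (rule order_trans[OF quadratic_form_le mult_right_mono[OF E]]) simp
      then have "g * (norm x)\<^sup>2 \<le> x \<bullet> (G *v x) + x \<bullet> (E *v x)"
        using c(2)[of x] by (simp add: g_def abs_le_iff)
      then have "real m * (g * (norm x)\<^sup>2) \<le> real m * (x \<bullet> (G *v x) + x \<bullet> (E *v x))"
        using mp by (intro mult_left_mono) auto
      then show ?thesis
        by (simp add: gr mat_vec.scaleR_left mat_vec.add_left inner_add_right mult_ac)
    qed
    \<comment> \<open>The sum of |X_i|^2 is the trace of the Gram matrix, and each of its s diagonal
      entries is at most its norm.\<close>
    have "(\<Sum>i=1..m. (norm (X i))\<^sup>2) = (\<Sum>i=1..m. \<Sum>j\<in>UNIV. (norm (X i *v axis j 1))\<^sup>2)"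
    proof (rule sum.cong[OF refl])
      fix i
      have "(norm (X i))\<^sup>2 = (norm (transpose (X i)))\<^sup>2" by (simp add: norm_matrix_transpose)
      also have "\<dots> = (\<Sum>j\<in>UNIV. (norm (X i *v axis j 1))\<^sup>2)"
        unfolding norm_sum_components[of "transpose (X i)"]
        by (simp add: matrix_vector_mult_basis column_def transpose_def)
      finally show "(norm (X i))\<^sup>2 = (\<Sum>j\<in>UNIV. (norm (X i *v axis j 1))\<^sup>2)" .
    qed
    also have "\<dots> = (\<Sum>j\<in>UNIV. axis j 1 \<bullet> (gram X m *v axis j 1))"
      unfolding quadratic_form_gram by (rule sum.swap)
    also have "\<dots> \<le> (\<Sum>j\<in>(UNIV :: 's set). real m * (norm G + g))"
    proof (rule sum_mono)
      fix j :: 's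
      have "axis j 1 \<bullet> (gram X m *v axis j 1) \<le> norm (gram X m)"
        using quadratic_form_le[of "axis j 1" "gram X m"] by simp
      also have "\<dots> \<le> real m * (norm G + g)"
        using norm_triangle_ineq[of G E] E mp by (simp add: gr)
      finally show "axis j 1 \<bullet> (gram X m *v axis j 1) \<le> real m * (norm G + g)" .
    qed
    also have "\<dots> = h * real m" by (simp add: h_def mult_ac)
    finally show "(\<Sum>i=1..m. (norm (X i))\<^sup>2) \<le> h * real m" .
  qed
qed

lemma loewner_le_scaled_identity:
  assumes "loewner_le (r *\<^sub>R mat 1) A"
  shows "symmetric_matrix A" "r * (norm x)\<^sup>2 \<le> x \<bullet> (A *v x)"
proof -
  have "transpose (A - r *\<^sub>R mat 1) = A - r *\<^sub>R mat 1" and "0 \<le> x \<bullet> ((A - r *\<^sub>R mat 1) *v x)"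
    using assms by (auto simp: loewner_le_def nonneg_definite_def symmetric_matrix_def)
  then show "symmetric_matrix A" "r * (norm x)\<^sup>2 \<le> x \<bullet> (A *v x)"
    by (simp_all add: symmetric_matrix_def transpose_diff transpose_scalar mat_vec.diff_left
        mat_vec.scaleR_left inner_diff_right power2_norm_eq_inner)
qed

lemma loewner_le_identity_scaled:
  assumes "loewner_le A (r *\<^sub>R mat 1)"
  shows "x \<bullet> (A *v x) \<le> r * (norm x)\<^sup>2"
  using assms
  by (simp add: loewner_le_def nonneg_definite_def mat_vec.diff_left mat_vec.scaleR_left inner_diff_right
      power2_norm_eq_inner)

text \<open>Functions of disjoint blocks of an independent family are independent; each block here
  pairs the two summands with the same index.\<close>

lemma (in prob_space) indep_vars_add_pairs:
  fixes v e :: "nat \<Rightarrow> 'a \<Rightarrow> real^'k"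
  assumes ind: "indep_vars (\<lambda>_. borel) (case_sum v e) ({1..} <+> {1..})"
  shows "indep_vars (\<lambda>_. borel) (\<lambda>i \<omega>. v i \<omega> + e i \<omega>) {1..}"
proof -
  let ?K = "\<lambda>j :: nat. {Inl j, Inr j}"
  have "indep_vars (\<lambda>j. PiM (?K j) (\<lambda>_. borel)) (\<lambda>j \<omega>. restrict (\<lambda>i. case_sum v e i \<omega>) (?K j)) {1..}"
    by (rule indep_vars_restrict[OF ind]) (auto simp: disjoint_family_on_def)
  then have "indep_vars (\<lambda>_. borel)
      (\<lambda>j \<omega>. (\<lambda>f. f (Inl j) + f (Inr j)) (restrict (\<lambda>i. case_sum v e i \<omega>) (?K j))) {1..}"
    by (rule indep_vars_compose2) (auto intro!: borel_measurable_add measurable_component_singleton)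
  then show ?thesis by simp
qed

text \<open>Positive variances select the density branch of \<open>normal_variable\<close>, where
  the sum of two independent normal variables is again normal with added variances.\<close>

lemma (in prob_space) normal_vector_add:
  fixes V W :: "'a \<Rightarrow> real^'k"
  assumes V: "normal_vector M V 0 P" and W: "normal_vector M W 0 Q"
    and ind: "indep_var borel V borel W"
    and pos: "0 < a \<bullet> (P *v a)" "0 < a \<bullet> (Q *v a)"
  shows "distributed M lborel (\<lambda>\<omega>. a \<bullet> (V \<omega> + W \<omega>)) (normal_density 0 (sqrt (a \<bullet> ((P + Q) *v a))))"
proof -
  have V': "distributed M lborel (\<lambda>\<omega>. a \<bullet> V \<omega>) (normal_density 0 (sqrt (a \<bullet> (P *v a))))"
    and W': "distributed M lborel (\<lambda>\<omega>. a \<bullet> W \<omega>) (normal_density 0 (sqrt (a \<bullet> (Q *v a))))"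
    using V W pos by (auto simp: normal_vector_def normal_variable_def dest!: spec[of _ a])
  have "indep_var borel ((\<lambda>x. a \<bullet> x) \<circ> V) borel ((\<lambda>x. a \<bullet> x) \<circ> W)"
    by (intro indep_var_compose[OF ind] borel_measurable_inner) auto
  then have "indep_var borel (\<lambda>\<omega>. a \<bullet> V \<omega>) borel (\<lambda>\<omega>. a \<bullet> W \<omega>)" by (simp add: comp_def)
  from add_indep_normal[OF this _ _ V' W'] pos show ?thesis
    by (simp add: inner_add_right mat_vec.add_left)
qed


section \<open>Concentration of the estimators in the Fay-Herriot model\<close>

locale fay_herriot = bounded_design X D \<Psi> m1 g h c d + gaussian_noise M u "\<lambda>i. \<Psi> + D i" c
  for X :: "nat \<Rightarrow> real^'s^'k" and D :: "nat \<Rightarrow> real^'k^'k" and \<Psi> :: "real^'k^'k"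
    and m1 :: nat and g h c d :: real and M :: "'w measure" and u :: "nat \<Rightarrow> 'w \<Rightarrow> real^'k" +
  fixes y :: "nat \<Rightarrow> 'w \<Rightarrow> real^'k" and \<beta> :: "real^'s" and q :: real
  assumes observation: "\<And>i \<omega>. i \<ge> 1 \<Longrightarrow> \<omega> \<in> space M \<Longrightarrow> y i \<omega> = X i *v \<beta> + u i \<omega>"
    and \<Psi>_symmetric: "symmetric_matrix \<Psi>"
    and \<Psi>_coercive: "0 < q" "\<And>x. q * (norm x)\<^sup>2 \<le> x \<bullet> (\<Psi> *v x)"
begin

text \<open>The third sum uses the weights of the true \<Psi>, which are nonrandom; the effect of
  estimating them is controlled through the first sum.\<close>

definition Good :: "nat \<Rightarrow> real \<Rightarrow> 'w set" where
  "Good m x = {\<omega> \<in> space M.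
     norm (centered_squares (\<lambda>i. \<Psi> + D i) m (\<lambda>i. u i \<omega>)) \<le> x * real m \<and>
     norm (\<Sum>i=1..m. transpose (X i) *v u i \<omega>) \<le> x * real m \<and>
     norm (\<Sum>i=1..m. (transpose (X i) ** matrix_inv (\<Psi> + D i)) *v u i \<omega>) \<le> x * real m}"

lemma measurable_linear_noise [measurable]:
  fixes B :: "nat \<Rightarrow> real^'k^'s"
  shows "(\<lambda>\<omega>. \<Sum>i=1..m. B i *v u i \<omega>) \<in> borel_measurable M"
proof (rule borel_measurable_sum)
  fix i assume "i \<in> {1..m}"
  then show "(\<lambda>\<omega>. B i *v u i \<omega>) \<in> borel_measurable M"
    by (intro measurable_compose[OF measurable_noise] borel_measurable_continuous_onI
        linear_continuous_on mat_vec.bounded_linear_right) auto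
qed

lemma measurable_centered_squares [measurable]:
  "(\<lambda>\<omega>. centered_squares (\<lambda>i. \<Psi> + D i) m (\<lambda>i. u i \<omega>)) \<in> borel_measurable M"
  unfolding centered_squares_def
  by (intro borel_measurable_sum borel_measurable_diff borel_measurable_const
      borel_measurable_has_bochner_integral[OF has_bochner_integral_noise_outer]) auto

lemma Good_events:
  obtains N p x0 where "good_events M Good N p x0 m1"
proof -
  obtain N1 p1 x0 where 1: "0 < N1" "0 < p1" "0 < x0"
    "\<And>m x. 1 \<le> m \<Longrightarrow> 0 \<le> x \<Longrightarrow> x \<le> x0 \<Longrightarrow>
       prob {\<omega> \<in> space M. x * real m < norm (\<Sum>i=1..m. outer (u i \<omega>) (u i \<omega>) - (\<Psi> + D i))}
         \<le> N1 * exp (- (p1 * x\<^sup>2 * real m))"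
    using centered_squares_tail by blast
  \<comment> \<open>One constant for both linear forms: the coefficient matrices have norm |X_i| in
    the first and at most |X_i| k / d in the second.\<close>
  define V where "V = max 1 ((real CARD('k) / d)\<^sup>2) * h"
  have V: "0 < V" using pos by (simp add: V_def)
  obtain N2 p2 where 2: "0 < N2" "0 < p2"
    "\<And>(B :: nat \<Rightarrow> real^'k^'s) m x. 1 \<le> m \<Longrightarrow> 0 \<le> x \<Longrightarrow> (\<Sum>i=1..m. (norm (B i))\<^sup>2) \<le> V * real m \<Longrightarrow>
       prob {\<omega> \<in> space M. x * real m < norm (\<Sum>i=1..m. B i *v u i \<omega>)} \<le> N2 * exp (- (p2 * x\<^sup>2 * real m))"
    using linear_tail[OF V] by blast
  define p where "p = min p1 p2"
  have "good_events M Good (N1 + 2 * N2) p x0 m1"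
  proof unfold_locales
    show "0 < N1 + 2 * N2" "0 < p" "0 < x0" using 1 2 by (auto simp: p_def)
    show "Good m x \<in> sets M" for m x unfolding Good_def by measurable
    fix m x assume m: "m \<ge> m1" and x: "0 \<le> x" "x \<le> x0"
    have m': "1 \<le> m" using m m1 by simp
    let ?Q = "\<lambda>\<omega>. centered_squares (\<lambda>i. \<Psi> + D i) m (\<lambda>i. u i \<omega>)"
    let ?T = "\<lambda>\<omega>. \<Sum>i=1..m. transpose (X i) *v u i \<omega>"
    let ?W = "\<lambda>\<omega>. \<Sum>i=1..m. (transpose (X i) ** matrix_inv (\<Psi> + D i)) *v u i \<omega>"
    let ?E = "\<lambda>Z. {\<omega> \<in> space M. x * real m < norm (Z \<omega>)}"
    have exp1: "exp (- (p' * x\<^sup>2 * real m)) \<le> exp (- (p * x\<^sup>2 * real m))" if "p \<le> p'" for p'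
      using that by (simp add: mult_right_mono)
    have Q: "prob (?E ?Q) \<le> N1 * exp (- (p * x\<^sup>2 * real m))"
      using 1(4)[OF m' x] mult_left_mono[OF exp1[of p1] less_imp_le[OF 1(1)]]
      unfolding centered_squares_def p_def by linarith
    have lin: "prob (?E (\<lambda>\<omega>. \<Sum>i=1..m. B i *v u i \<omega>)) \<le> N2 * exp (- (p * x\<^sup>2 * real m))"
      if "\<And>i. i \<in> {1..m} \<Longrightarrow> (norm (B i))\<^sup>2 \<le> max 1 ((real CARD('k) / d)\<^sup>2) * (norm (X i))\<^sup>2"
      for B :: "nat \<Rightarrow> real^'k^'s"
    proof -
      have "(\<Sum>i=1..m. (norm (B i))\<^sup>2) \<le> (\<Sum>i=1..m. max 1 ((real CARD('k) / d)\<^sup>2) * (norm (X i))\<^sup>2)"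
        by (intro sum_mono that)
      also have "\<dots> \<le> V * real m"
        unfolding V_def sum_distrib_left[symmetric] mult.assoc
        by (intro mult_left_mono design_sq m) auto
      finally have "prob (?E (\<lambda>\<omega>. \<Sum>i=1..m. B i *v u i \<omega>)) \<le> N2 * exp (- (p2 * x\<^sup>2 * real m))"
        by (rule 2(3)[OF m' x(1)])
      also have "\<dots> \<le> N2 * exp (- (p * x\<^sup>2 * real m))"
        using exp1[of p2] 2(1) by (intro mult_left_mono) (auto simp: p_def)
      finally show ?thesis .
    qed
    have T: "prob (?E ?T) \<le> N2 * exp (- (p * x\<^sup>2 * real m))"
    proof (rule lin)
      fix i
      show "(norm (transpose (X i)))\<^sup>2 \<le> max 1 ((real CARD('k) / d)\<^sup>2) * (norm (X i))\<^sup>2"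
        using mult_right_mono[of 1 "max 1 ((real CARD('k) / d)\<^sup>2)" "(norm (X i))\<^sup>2"]
        by (simp add: norm_matrix_transpose)
    qed
    have W: "prob (?E ?W) \<le> N2 * exp (- (p * x\<^sup>2 * real m))"
    proof (rule lin)
      fix i assume "i \<in> {1..m}"
      then have "norm (transpose (X i) ** matrix_inv (\<Psi> + D i)) \<le> norm (X i) * (real CARD('k) / d)"
        by (intro norm_matrix_mult_mono norm_inv_cov) (auto simp: norm_matrix_transpose)
      from power_mono[OF this norm_ge_zero, of 2]
      have "(norm (transpose (X i) ** matrix_inv (\<Psi> + D i)))\<^sup>2 \<le> (real CARD('k) / d)\<^sup>2 * (norm (X i))\<^sup>2"
        by (simp only: power_mult_distrib mult.commute)
      also have "\<dots> \<le> max 1 ((real CARD('k) / d)\<^sup>2) * (norm (X i))\<^sup>2"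
        by (intro mult_right_mono) auto
      finally show "(norm (transpose (X i) ** matrix_inv (\<Psi> + D i)))\<^sup>2
          \<le> max 1 ((real CARD('k) / d)\<^sup>2) * (norm (X i))\<^sup>2" .
    qed
    have sets: "?E ?Q \<in> sets M" "?E ?T \<in> sets M" "?E ?W \<in> sets M" by measurable
    have "space M - Good m x = (?E ?Q \<union> ?E ?T) \<union> ?E ?W" by (auto simp: Good_def not_le)
    then have "prob (space M - Good m x) \<le> prob (?E ?Q \<union> ?E ?T) + prob (?E ?W)"
      using measure_Un_le[of "?E ?Q \<union> ?E ?T" M "?E ?W"] sets by simp
    also have "\<dots> \<le> prob (?E ?Q) + prob (?E ?T) + prob (?E ?W)"
      using measure_Un_le[OF sets(1,2)] by simp
    also have "\<dots> \<le> (N1 + 2 * N2) * exp (- (p * x\<^sup>2 * real m))"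
      using Q T W by (simp add: algebra_simps)
    finally show "prob (space M - Good m x) \<le> (N1 + 2 * N2) * exp (- (p * x\<^sup>2 * real m))" .
  qed
  then show thesis by (rule that)
qed

lemma psi_hat0_concentrates:
  "concentrates Good (\<lambda>m \<omega>. psi_hat0 X D m (\<lambda>i. y i \<omega>) - \<Psi>)"
proof -
  obtain C where C: "0 < C"
    "\<And>m u y \<beta> x. m \<ge> m1 \<Longrightarrow> 0 \<le> x \<Longrightarrow> x \<le> 1 \<Longrightarrow> (\<And>i. i \<in> {1..m} \<Longrightarrow> y i = X i *v \<beta> + u i) \<Longrightarrow>
       norm (centered_squares (\<lambda>i. \<Psi> + D i) m u) \<le> x * real m \<Longrightarrow>
       norm (\<Sum>i=1..m. transpose (X i) *v u i) \<le> x * real m \<Longrightarrow>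
       norm (psi_hat0 X D m y - \<Psi>) \<le> C * x"
    using psi_hat0_bound by blast
  show ?thesis
    unfolding concentrates_def
  proof (rule exI[of _ C], intro conjI exI[of _ "1 :: real"] exI[of _ m1] allI impI ballI C(1))
    fix m x \<omega>
    assume m: "m \<ge> m1" and x: "0 \<le> x" "x \<le> 1" and \<omega>: "\<omega> \<in> Good m x"
    have "norm (psi_hat0 X D m (\<lambda>i. y i \<omega>) - \<Psi>) \<le> C * x"
      using \<omega> by (intro C(2)[OF m x, of "\<lambda>i. y i \<omega>" \<beta> "\<lambda>i. u i \<omega>"] observation) (auto simp: Good_def)
    also have "\<dots> \<le> C * (x + 1 / real m)" using C(1) by (intro mult_left_mono) auto
    finally show "norm (psi_hat0 X D m (\<lambda>i. y i \<omega>) - \<Psi>) \<le> C * (x + 1 / real m)" .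
  qed simp
qed

lemma psi_hat1_concentrates:
  "concentrates Good (\<lambda>m \<omega>. psi_hat1 X D m (\<lambda>i. y i \<omega>) - \<Psi>)"
proof -
  obtain C1 where C1: "0 < C1"
    "\<And>m y x. m \<ge> m1 \<Longrightarrow> norm (psi_hat0 X D m y - \<Psi>) \<le> x \<Longrightarrow>
       norm (psi_hat1 X D m y - \<Psi>) \<le> C1 * (x + 1 / real m)"
    using psi_hat1_bound by blast
  obtain C \<delta> m2 where C: "0 < C" "0 < \<delta>"
    and bound: "\<And>m x \<omega>. m \<ge> m2 \<Longrightarrow> 0 \<le> x \<Longrightarrow> x \<le> \<delta> \<Longrightarrow> \<omega> \<in> Good m x \<Longrightarrow>
      norm (psi_hat0 X D m (\<lambda>i. y i \<omega>) - \<Psi>) \<le> C * (x + 1 / real m)"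
    using psi_hat0_concentrates unfolding concentrates_def by metis
  show ?thesis
    unfolding concentrates_def
  proof (rule exI[of _ "C1 * (C + 1)"], intro conjI exI[of _ \<delta>] exI[of _ "max m1 m2"] allI impI ballI C(2))
    show "0 < C1 * (C + 1)" using C C1 by simp
    fix m x \<omega>
    assume m: "max m1 m2 \<le> m" and x: "0 \<le> x" "x \<le> \<delta>" and \<omega>: "\<omega> \<in> Good m x"
    have "norm (psi_hat1 X D m (\<lambda>i. y i \<omega>) - \<Psi>) \<le> C1 * (C * (x + 1 / real m) + 1 / real m)"
      using m by (intro C1(2) bound x \<omega>) auto
    also have "\<dots> \<le> C1 * ((C + 1) * (x + 1 / real m))"
      using C1(1) x by (intro mult_left_mono) (auto simp: algebra_simps add_divide_distrib)
    finally show "norm (psi_hat1 X D m (\<lambda>i. y i \<omega>) - \<Psi>) \<le> C1 * (C + 1) * (x + 1 / real m)"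
      by (simp add: mult.assoc)
  qed
qed

text \<open>The estimator \<beta>h is prescribed only where the formula is defined; on good events
  with small x and large m the estimate lies within d / 2 of \<Psi>, and there
  \<open>gls_bound\<close> ensures that the formula is defined.\<close>

lemma gls_concentrates:
  assumes est: "concentrates Good (\<lambda>m \<omega>. est m \<omega> - \<Psi>)"
    and \<beta>h: "\<And>m \<omega>. m \<ge> m0 \<Longrightarrow> \<omega> \<in> space M \<Longrightarrow> gls_defined X D m (est m \<omega>) \<Longrightarrow>
      \<beta>h m \<omega> = gls X D m (est m \<omega>) (\<lambda>i. y i \<omega>)"
  shows "concentrates Good (\<lambda>m \<omega>. \<beta>h m \<omega> - \<beta>)"
proof -
  obtain C \<delta> m2 where C: "0 < C" "0 < \<delta>"
    and bound: "\<And>m x \<omega>. m \<ge> m2 \<Longrightarrow> 0 \<le> x \<Longrightarrow> x \<le> \<delta> \<Longrightarrow> \<omega> \<in> Good m x \<Longrightarrow>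
      norm (est m \<omega> - \<Psi>) \<le> C * (x + 1 / real m)"
    using est unfolding concentrates_def by metis
  obtain C1 where C1: "0 < C1"
    "\<And>m u y \<beta> x t P. m \<ge> m1 \<Longrightarrow> (\<And>i. i \<in> {1..m} \<Longrightarrow> y i = X i *v \<beta> + u i) \<Longrightarrow>
       norm (centered_squares (\<lambda>i. \<Psi> + D i) m u) \<le> real m \<Longrightarrow>
       norm (\<Sum>i=1..m. (transpose (X i) ** matrix_inv (\<Psi> + D i)) *v u i) \<le> x * real m \<Longrightarrow>
       norm (P - \<Psi>) \<le> t \<Longrightarrow> t \<le> d / 2 \<Longrightarrow>
       gls_defined X D m P \<and> norm (gls X D m P y - \<beta>) \<le> C1 * (x + t)"
    using gls_bound by blast
  \<comment> \<open>With m >= m3 this makes C x and C / m at most d / 4 each; x <= 1 brings the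
    centered squares below m.\<close>
  define \<delta>' where "\<delta>' = min (min \<delta> 1) (d / (4 * C))"
  obtain m3 :: nat where m3: "4 * C / d \<le> real m3" using real_arch_simple by blast
  show ?thesis
    unfolding concentrates_def
  proof (rule exI[of _ "C1 * (C + 1)"],
      intro conjI exI[of _ \<delta>'] exI[of _ "max (max m0 m1) (max m2 m3)"] allI impI ballI)
    show "0 < C1 * (C + 1)" "0 < \<delta>'" using C C1 pos by (auto simp: \<delta>'_def)
    fix m x \<omega>
    assume m: "max (max m0 m1) (max m2 m3) \<le> m" and x: "0 \<le> x" "x \<le> \<delta>'" and \<omega>: "\<omega> \<in> Good m x"
    have mp: "0 < real m" using m m_pos by simp
    have x': "x \<le> \<delta>" "x \<le> 1" "x \<le> d / (4 * C)" using x by (auto simp: \<delta>'_def)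
    have "4 * C / d \<le> real m" using m m3 by linarith
    then have "1 / real m \<le> d / (4 * C)" using C pos mp by (simp add: field_simps)
    then have "C * (x + 1 / real m) \<le> C * (d / (4 * C) + d / (4 * C))"
      using x' C by (intro mult_left_mono) auto
    then have t: "C * (x + 1 / real m) \<le> d / 2" using C by (simp add: field_simps)
    have \<omega>M: "\<omega> \<in> space M" using \<omega> by (simp add: Good_def)
    have Q: "norm (centered_squares (\<lambda>i. \<Psi> + D i) m (\<lambda>i. u i \<omega>)) \<le> real m"
      using \<omega> mult_right_mono[OF x'(2), of "real m"] by (auto simp: Good_def)
    have "gls_defined X D m (est m \<omega>) \<and>
        norm (gls X D m (est m \<omega>) (\<lambda>i. y i \<omega>) - \<beta>) \<le> C1 * (x + C * (x + 1 / real m))"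
      using m x x' \<omega> \<omega>M
      by (intro C1(2)[of m "\<lambda>i. y i \<omega>" \<beta> "\<lambda>i. u i \<omega>"] Q t bound observation) (auto simp: Good_def)
    then have "norm (\<beta>h m \<omega> - \<beta>) \<le> C1 * (x + C * (x + 1 / real m))"
      using \<beta>h[of m \<omega>] m \<omega>M by simp
    also have "\<dots> \<le> C1 * ((C + 1) * (x + 1 / real m))"
      using C1(1) x by (intro mult_left_mono) (auto simp: algebra_simps add_divide_distrib)
    finally show "norm (\<beta>h m \<omega> - \<beta>) \<le> C1 * (C + 1) * (x + 1 / real m)"
      by (simp add: mult.assoc)
  qed
qed

text \<open>A perturbation no larger than the coercivity constant q of \<Psi> cannot make the form
  negative, so the projection fixes symmetric matrices this close to \<Psi>.\<close>

lemma nonneg_definite_near_\<Psi>: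
  assumes "symmetric_matrix P" "norm (P - \<Psi>) \<le> q"
  shows "nonneg_definite P"
proof -
  have "0 \<le> x \<bullet> (P *v x)" for x
  proof -
    have "\<bar>x \<bullet> ((P - \<Psi>) *v x)\<bar> \<le> q * (norm x)\<^sup>2"
      by (rule order_trans[OF quadratic_form_le mult_right_mono[OF assms(2)]]) simp
    then show ?thesis
      using \<Psi>_coercive(2)[of x] by (simp add: mat_vec.diff_left inner_diff_right abs_le_iff)
  qed
  then show ?thesis using assms(1) by (simp add: nonneg_definite_def)
qed

lemma nonneg_part_consistent:
  assumes est: "concentrates Good (\<lambda>m \<omega>. est m \<omega> - \<Psi>)"
    and meas: "\<And>m. m \<ge> m1 \<Longrightarrow> est m \<in> borel_measurable M"
    and sym: "\<And>m \<omega>. m \<ge> m1 \<Longrightarrow> \<omega> \<in> space M \<Longrightarrow> symmetric_matrix (est m \<omega>)"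
  shows "consistent_for M (\<lambda>m \<omega>. nonneg_part (est m \<omega>)) \<Psi>"
  unfolding consistent_for_def
proof (intro conjI allI impI)
  obtain N p x0 where "good_events M Good N p x0 m1" using Good_events .
  then interpret good_events M Good N p x0 m1 .
  have "nonneg_definite \<Psi>" using nonneg_definite_near_\<Psi>[OF \<Psi>_symmetric] \<Psi>_coercive by simp
  then have \<Psi>: "closest_point psd_cone \<Psi> = \<Psi>" by (intro closest_point_self) (simp add: psd_cone_def)
  show "\<forall>\<^sub>F m in sequentially. (\<lambda>\<omega>. nonneg_part (est m \<omega>)) \<in> borel_measurable M"
    using eventually_ge_at_top[of m1]
  proof eventually_elim
    case (elim m)
    have "(\<lambda>\<omega>. closest_point psd_cone (est m \<omega>)) \<in> borel_measurable M"
      by (intro measurable_compose[OF meas[OF elim]] borel_measurable_continuous_onI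
          continuous_on_closest_point convex_psd_cone closed_psd_cone psd_cone_nonempty)
    then show ?case
      by (subst measurable_cong[of M _ "\<lambda>\<omega>. closest_point psd_cone (est m \<omega>)"])
        (auto simp: nonneg_part_closest_point sym[OF elim])
  qed
  fix \<epsilon> :: real assume "0 < \<epsilon>"
  then obtain r m2 where r: "0 < r"
    "\<And>m P. m \<ge> m2 \<Longrightarrow> (\<And>\<omega>. \<omega> \<in> space M \<Longrightarrow> norm (est m \<omega> - \<Psi>) \<le> \<epsilon> \<Longrightarrow> \<not> P \<omega>) \<Longrightarrow>
       prob {\<omega> \<in> space M. P \<omega>} \<le> N * exp (- (r * real m))"
    using concentrates_exponential[OF est] by blast
  show "(\<lambda>m. prob {\<omega> \<in> space M. \<epsilon> < dist (nonneg_part (est m \<omega>)) \<Psi>}) \<longlonglongrightarrow> 0"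
  proof (rule tendsto_sandwich[OF _ _ tendsto_const])
    show "(\<lambda>m. N * exp (- (r * real m))) \<longlonglongrightarrow> 0" using r(1) tail_pos by real_asymp
    show "\<forall>\<^sub>F m in sequentially. prob {\<omega> \<in> space M. \<epsilon> < dist (nonneg_part (est m \<omega>)) \<Psi>}
        \<le> N * exp (- (r * real m))"
      using eventually_ge_at_top[of "max m1 m2"]
    proof eventually_elim
      case (elim m)
      show ?case
      proof (rule r(2))
        fix \<omega> assume \<omega>: "\<omega> \<in> space M" "norm (est m \<omega> - \<Psi>) \<le> \<epsilon>"
        have "dist (nonneg_part (est m \<omega>)) \<Psi> = dist (closest_point psd_cone (est m \<omega>)) (closest_point psd_cone \<Psi>)"
          using sym[of m \<omega>] elim \<omega> by (simp add: \<Psi> nonneg_part_closest_point)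
        also have "\<dots> \<le> dist (est m \<omega>) \<Psi>"
          by (intro closest_point_lipschitz convex_psd_cone closed_psd_cone psd_cone_nonempty)
        finally show "\<not> \<epsilon> < dist (nonneg_part (est m \<omega>)) \<Psi>" using \<omega>(2) by (simp add: dist_norm)
      qed (use elim in auto)
    qed
  qed auto
qed

lemma nonneg_part_eq_superpolynomial:
  assumes est: "concentrates Good (\<lambda>m \<omega>. est m \<omega> - \<Psi>)"
    and sym: "\<And>m \<omega>. m \<ge> m1 \<Longrightarrow> \<omega> \<in> space M \<Longrightarrow> symmetric_matrix (est m \<omega>)"
  shows "(\<lambda>m. prob {\<omega> \<in> space M. nonneg_part (est m \<omega>) \<noteq> est m \<omega>}) \<in> O(\<lambda>m. real m powr (- K))"
proof -
  obtain N p x0 where "good_events M Good N p x0 m1" using Good_events .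
  then interpret good_events M Good N p x0 m1 .
  obtain r m2 where r: "0 < r"
    "\<And>m P. m \<ge> m2 \<Longrightarrow> (\<And>\<omega>. \<omega> \<in> space M \<Longrightarrow> norm (est m \<omega> - \<Psi>) \<le> q \<Longrightarrow> \<not> P \<omega>) \<Longrightarrow>
       prob {\<omega> \<in> space M. P \<omega>} \<le> N * exp (- (r * real m))"
    using concentrates_exponential[OF est \<Psi>_coercive(1)] by blast
  have "\<forall>\<^sub>F m in sequentially. prob {\<omega> \<in> space M. nonneg_part (est m \<omega>) \<noteq> est m \<omega>}
      \<le> N * exp (- (r * real m))"
    using eventually_ge_at_top[of "max m1 m2"]
  proof eventually_elim
    case (elim m)
    show ?case
    proof (rule r(2))
      fix \<omega> assume \<omega>: "\<omega> \<in> space M" "norm (est m \<omega> - \<Psi>) \<le> q"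
      have s: "symmetric_matrix (est m \<omega>)" using sym elim \<omega> by simp
      have "est m \<omega> \<in> psd_cone" using nonneg_definite_near_\<Psi>[OF s \<omega>(2)] by (simp add: psd_cone_def)
      then show "\<not> nonneg_part (est m \<omega>) \<noteq> est m \<omega>"
        by (simp add: nonneg_part_closest_point[OF s] closest_point_self)
    qed (use elim in auto)
  qed
  then have "(\<lambda>m. prob {\<omega> \<in> space M. nonneg_part (est m \<omega>) \<noteq> est m \<omega>})
      \<in> O(\<lambda>m. N * exp (- (r * real m)))"
    using tail_pos by (intro bigoI[of _ 1]) (auto elim!: eventually_mono)
  also have "(\<lambda>m. N * exp (- (r * real m))) \<in> O(\<lambda>m. real m powr (- K))"
    using r(1) tail_pos by real_asymp
  finally show ?thesis .
qed

text \<open>Both estimators of \<Psi> are instances. Symmetry is asked from m0 on because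
  definiteness of the modified estimate is claimed there; measurability is asked from m1 on because
  stochastic orders concern large m.\<close>

lemma estimator_conclusions:
  assumes est: "concentrates Good (\<lambda>m \<omega>. est m \<omega> - \<Psi>)"
    and meas: "\<And>m. m \<ge> m1 \<Longrightarrow> est m \<in> borel_measurable M"
    and sym: "\<And>m \<omega>. m \<ge> m0 \<Longrightarrow> \<omega> \<in> space M \<Longrightarrow> symmetric_matrix (est m \<omega>)"
    and "m0 \<le> m1"
  shows "bigo_prob M (\<lambda>m \<omega>. est m \<omega> - \<Psi>) (\<lambda>m. real m powr (- 1 / 2))
       \<and> (\<forall>\<beta>h. (\<forall>m\<ge>m0. \<beta>h m \<in> borel_measurable M \<and>
                  (\<forall>\<omega>\<in>space M. gls_defined X D m (est m \<omega>) \<longrightarrow>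
                     \<beta>h m \<omega> = gls X D m (est m \<omega>) (\<lambda>i. y i \<omega>))) \<longrightarrow>
              bigo_prob M (\<lambda>m \<omega>. \<beta>h m \<omega> - \<beta>) (\<lambda>m. real m powr (- 1 / 2)))
       \<and> (\<forall>m\<ge>m0. \<forall>\<omega>\<in>space M. nonneg_definite (nonneg_part (est m \<omega>)))
       \<and> consistent_for M (\<lambda>m \<omega>. nonneg_part (est m \<omega>)) \<Psi>
       \<and> (\<forall>K::real>0. (\<lambda>m. measure M {\<omega> \<in> space M. nonneg_part (est m \<omega>) \<noteq> est m \<omega>})
              \<in> O(\<lambda>m. real m powr (- K)))"
proof -
  obtain N p x0 where "good_events M Good N p x0 m1" using Good_events .
  then interpret good_events M Good N p x0 m1 .
  have sym1: "symmetric_matrix (est m \<omega>)" if "m \<ge> m1" "\<omega> \<in> space M" for m \<omega>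
    using sym that \<open>m0 \<le> m1\<close> by simp
  show ?thesis
  proof (intro conjI allI ballI impI)
    show "bigo_prob M (\<lambda>m \<omega>. est m \<omega> - \<Psi>) (\<lambda>m. real m powr (- 1 / 2))"
      by (intro concentrates_bigo_prob est eventually_mono[OF eventually_ge_at_top[of m1]]
          borel_measurable_diff meas) auto
    fix \<beta>h
    assume \<beta>h: "\<forall>m\<ge>m0. \<beta>h m \<in> borel_measurable M \<and>
      (\<forall>\<omega>\<in>space M. gls_defined X D m (est m \<omega>) \<longrightarrow> \<beta>h m \<omega> = gls X D m (est m \<omega>) (\<lambda>i. y i \<omega>))"
    show "bigo_prob M (\<lambda>m \<omega>. \<beta>h m \<omega> - \<beta>) (\<lambda>m. real m powr (- 1 / 2))"
    proof (rule concentrates_bigo_prob)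
      show "concentrates Good (\<lambda>m \<omega>. \<beta>h m \<omega> - \<beta>)"
        by (rule gls_concentrates[OF est, of m0]) (use \<beta>h in auto)
      show "\<forall>\<^sub>F m in sequentially. (\<lambda>\<omega>. \<beta>h m \<omega> - \<beta>) \<in> borel_measurable M"
        using eventually_ge_at_top[of m0] by eventually_elim (use \<beta>h in auto)
    qed
  next
    fix m \<omega> assume "m \<ge> m0" "\<omega> \<in> space M"
    then show "nonneg_definite (nonneg_part (est m \<omega>))"
      using closest_point_in_set[OF closed_psd_cone psd_cone_nonempty, of "est m \<omega>"] sym
      by (simp add: nonneg_part_closest_point psd_cone_def)
  qed (use nonneg_part_consistent[OF est meas sym1] nonneg_part_eq_superpolynomial[OF est sym1] in auto)
qed

end

theorem theorem1:
  fixes M :: "'w measure"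
    and X :: "nat \<Rightarrow> real^'s^'k"
    and D :: "nat \<Rightarrow> real^'k^'k"
    and \<beta> :: "real^'s"
    and \<Psi> :: "real^'k^'k"
    and v \<epsilon> y :: "nat \<Rightarrow> 'w \<Rightarrow> real^'k"
    and d_low d_up :: real
    and m0 :: nat
    and \<Psi>0 \<Psi>1 :: "nat \<Rightarrow> 'w \<Rightarrow> real^'k^'k"
    and G :: "real^'s^'s"
  assumes prob: "prob_space M"
    and model: "\<And>i \<omega>. i \<ge> 1 \<Longrightarrow> \<omega> \<in> space M \<Longrightarrow> y i \<omega> = X i *v \<beta> + v i \<omega> + \<epsilon> i \<omega>"
    and v_normal: "\<And>i. i \<ge> 1 \<Longrightarrow> normal_vector M (v i) 0 \<Psi>"
    and \<epsilon>_normal: "\<And>i. i \<ge> 1 \<Longrightarrow> normal_vector M (\<epsilon> i) 0 (D i)"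
    and indep: "prob_space.indep_vars M (\<lambda>_. borel) (case_sum v \<epsilon>) ({1..} <+> {1..})"
    and \<Psi>_cov: "nonneg_definite \<Psi>"
    and \<Psi>_nonsing: "invertible \<Psi>"
    and d_pos: "0 < d_low" "0 < d_up"
    and D_bounds: "\<And>i. i \<ge> 1 \<Longrightarrow> loewner_le (d_low *\<^sub>R mat 1) (D i)"
                  "\<And>i. i \<ge> 1 \<Longrightarrow> loewner_le (D i) (d_up *\<^sub>R mat 1)"
    and gram_nonsing: "\<And>m. m \<ge> m0 \<Longrightarrow> invertible (gram X m)"
    and gram_limit: "(\<lambda>m. (1 / real m) *\<^sub>R gram X m) \<longlonglongrightarrow> G"
    and G_pos: "pos_definite G"
    and \<Psi>0_eq: "\<Psi>0 = (\<lambda>m \<omega>. psi_hat0 X D m (\<lambda>i. y i \<omega>))"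
    and \<Psi>1_eq: "\<Psi>1 = (\<lambda>m \<omega>. psi_hat1 X D m (\<lambda>i. y i \<omega>))"
  shows
    "((\<forall>m\<ge>m0. integrable M (\<Psi>0 m) \<and> (\<integral>\<omega>. \<Psi>0 m \<omega> \<partial>M) - \<Psi> = bias0 X D m \<Psi>)
       \<and> (\<lambda>m. norm (bias0 X D m \<Psi>)) \<in> O(\<lambda>m. real m powr (- 1))
       \<and> (\<forall>m\<ge>m0. integrable M (\<Psi>1 m))
       \<and> (\<lambda>m. norm ((\<integral>\<omega>. \<Psi>1 m \<omega> \<partial>M) - \<Psi>)) \<in> O(\<lambda>m. real m powr (- 3 / 2)))
     \<and> (\<forall>\<Psi>h\<in>{\<Psi>0, \<Psi>1}.
         bigo_prob M (\<lambda>m \<omega>. \<Psi>h m \<omega> - \<Psi>) (\<lambda>m. real m powr (- 1 / 2))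
       \<and> (\<forall>\<beta>h. (\<forall>m\<ge>m0. \<beta>h m \<in> borel_measurable M \<and>
                  (\<forall>\<omega>\<in>space M. gls_defined X D m (\<Psi>h m \<omega>) \<longrightarrow>
                     \<beta>h m \<omega> = gls X D m (\<Psi>h m \<omega>) (\<lambda>i. y i \<omega>))) \<longrightarrow>
              bigo_prob M (\<lambda>m \<omega>. \<beta>h m \<omega> - \<beta>) (\<lambda>m. real m powr (- 1 / 2)))
       \<and> (\<forall>m\<ge>m0. \<forall>\<omega>\<in>space M. nonneg_definite (nonneg_part (\<Psi>h m \<omega>)))
       \<and> consistent_for M (\<lambda>m \<omega>. nonneg_part (\<Psi>h m \<omega>)) \<Psi>
       \<and> (\<forall>K::real>0. (\<lambda>m. measure M {\<omega> \<in> space M. nonneg_part (\<Psi>h m \<omega>) \<noteq> \<Psi>h m \<omega>})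
              \<in> O(\<lambda>m. real m powr (- K))))"
proof -
  interpret P: prob_space M by (rule prob)
  define u where "u i \<omega> = v i \<omega> + \<epsilon> i \<omega>" for i \<omega>
  have y: "y i \<omega> = X i *v \<beta> + u i \<omega>" if "i \<ge> 1" "\<omega> \<in> space M" for i \<omega>
    using model[OF that] by (simp add: u_def add.assoc)
  obtain q where q: "0 < q" "\<And>x. q * (norm x)\<^sup>2 \<le> x \<bullet> (\<Psi> *v x)"
    using pos_definite_coercive[OF nonneg_definite_invertible_pos_definite[OF \<Psi>_cov \<Psi>_nonsing]] by blast
  have \<Psi>_sym: "symmetric_matrix \<Psi>" using \<Psi>_cov by (simp add: nonneg_definite_def)
  note D_sym = loewner_le_scaled_identity(1)[OF D_bounds(1)]
    and D_low = loewner_le_scaled_identity(2)[OF D_bounds(1)]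
    and D_up = loewner_le_identity_scaled[OF D_bounds(2)]
  obtain m2 g h where gram: "m2 \<ge> 1" "0 < g" "0 < h"
    "\<And>m x. m \<ge> m2 \<Longrightarrow> g * real m * (norm x)\<^sup>2 \<le> x \<bullet> (gram X m *v x)"
    "\<And>m. m \<ge> m2 \<Longrightarrow> (\<Sum>i=1..m. (norm (X i))\<^sup>2) \<le> h * real m"
    using gram_convergent_bounds[OF gram_limit G_pos] by blast
  define m1 where "m1 = max m0 m2"
  \<comment> \<open>The second summand bounds |D_i| by \<open>norm_symmetric_matrix_le\<close>: on
    polarization vectors |a|^2 <= 4, so the form of D_i is at most 4 \<open>d_up\<close>.\<close>
  define c where "c = norm \<Psi> + 2 * (real CARD('k))\<^sup>2 * (d_up * 4)"
  have c: "0 < c" using d_pos by (simp add: c_def add_nonneg_pos)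
  have cov_norm: "norm (\<Psi> + D i) \<le> c" if i: "i \<ge> 1" for i
  proof -
    have "\<bar>a \<bullet> (D i *v a)\<bar> \<le> d_up * 4" if "a \<in> polarization_vectors" for a :: "real^'k"
    proof -
      have "(norm a)\<^sup>2 \<le> 4" using power_mono[OF norm_polarization_vectors[OF that], of 2] by simp
      then have "d_up * (norm a)\<^sup>2 \<le> d_up * 4" using d_pos by simp
      moreover have "0 \<le> d_low * (norm a)\<^sup>2" using d_pos by simp
      ultimately show ?thesis using D_low[OF i, of a] D_up[OF i, of a] by linarith
    qed
    from norm_symmetric_matrix_le[OF D_sym[OF i] this] show ?thesis
      unfolding c_def by (intro order_trans[OF norm_triangle_ineq] add_mono) auto
  qed
  have cov_low: "d_low * (norm x)\<^sup>2 \<le> x \<bullet> ((\<Psi> + D i) *v x)" if "i \<ge> 1" for i x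
    using D_low[OF that, of x] q(2)[of x] mult_nonneg_nonneg[OF less_imp_le[OF q(1)] zero_le_power2[of "norm x"]]
    by (simp add: mat_vec.add_left inner_add_right)
  interpret fay_herriot X D \<Psi> m1 g h c d_low M u y \<beta> q
  proof unfold_locales
    show "P.indep_vars (\<lambda>_. borel) u {1..}"
      using P.indep_vars_add_pairs[OF indep] by (simp add: u_def[abs_def])
    fix i :: nat assume i: "i \<ge> 1"
    show "symmetric_matrix (\<Psi> + D i)" by (intro symmetric_matrix_add \<Psi>_sym D_sym i)
    show "a \<bullet> ((\<Psi> + D i) *v a) \<le> c * (norm a)\<^sup>2" for a
      using quadratic_form_le[of a "\<Psi> + D i"] mult_right_mono[OF cov_norm[OF i], of "(norm a)\<^sup>2"]
      by (simp add: abs_le_iff)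
    fix a :: "real^'k" assume a: "a \<noteq> 0"
    have "0 < d_low * (norm a)\<^sup>2" "0 < q * (norm a)\<^sup>2" using a d_pos q by auto
    then have pos: "0 < a \<bullet> (\<Psi> *v a)" "0 < a \<bullet> (D i *v a)" "0 < a \<bullet> ((\<Psi> + D i) *v a)"
      using D_low[OF i, of a] q(2)[of a] cov_low[OF i, of a] by linarith+
    then show "0 < a \<bullet> ((\<Psi> + D i) *v a)" by simp
    have "P.indep_var borel ((\<lambda>f. f (Inl i)) \<circ> (\<lambda>\<omega>. restrict (\<lambda>j. case_sum v \<epsilon> j \<omega>) {Inl i}))
       borel ((\<lambda>f. f (Inr i)) \<circ> (\<lambda>\<omega>. restrict (\<lambda>j. case_sum v \<epsilon> j \<omega>) {Inr i}))"
      using i by (intro P.indep_var_compose[OF P.indep_var_restrict[OF indep]]) auto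
    then have "P.indep_var borel (v i) borel (\<epsilon> i)" by (simp add: comp_def)
    from P.normal_vector_add[OF v_normal[OF i] \<epsilon>_normal[OF i] this pos(1,2)]
    show "distributed M lborel (\<lambda>\<omega>. a \<bullet> u i \<omega>) (normal_density 0 (sqrt (a \<bullet> ((\<Psi> + D i) *v a))))"
      by (simp add: u_def)
  qed (use gram c d_pos q cov_norm cov_low \<Psi>_sym y in \<open>auto simp: m1_def\<close>)
  \<comment> \<open>Invertibility excludes m = 0, where the Gram matrix is an empty sum and 1 / m
    would be 0; the exact bias formulas can therefore be claimed from m0 on.\<close>
  have m0_pos: "m \<ge> 1" if "m \<ge> m0" for m
  proof (rule ccontr)
    assume "\<not> m \<ge> 1"
    then have "gram X m = 0" by (simp add: gram_def)
    then have "(0 :: real^'s^'s) = mat 1"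
      using matrix_inv_mult(1)[OF gram_nonsing[OF that]] by (simp add: mat_mult.zero_right)
    then have "(0 :: real^'s^'s) $ i $ i = mat 1 $ i $ i" for i by simp
    then show False by (simp add: mat_def)
  qed
  have B0: "has_bochner_integral M (\<Psi>0 m) (\<Psi> + bias0 X D m \<Psi>)" if "m \<ge> m0" for m
    unfolding \<Psi>0_eq by (rule has_bochner_integral_psi_hat0[OF refl m0_pos gram_nonsing y]) (use that in auto)
  have B1: "has_bochner_integral M (\<Psi>1 m) (\<Psi> - bias_map X m (\<lambda>_. bias0 X D m \<Psi>))" if "m \<ge> m0" for m
    unfolding \<Psi>1_eq by (rule has_bochner_integral_psi_hat1[OF refl m0_pos gram_nonsing y]) (use that in auto)
  obtain \<kappa> where \<kappa>: "0 < \<kappa>"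
    "\<And>m F f. m \<ge> m1 \<Longrightarrow> 0 \<le> f \<Longrightarrow> (\<And>i. i \<in> {1..m} \<Longrightarrow> norm (F i) \<le> f) \<Longrightarrow>
       norm (bias_map X m F) \<le> \<kappa> * f / real m"
    using bias_map_bound by blast
  have bias: "norm (bias0 X D m \<Psi>) \<le> \<kappa> * c / real m" if "m \<ge> m1" for m
    unfolding bias0_bias_map using c by (intro \<kappa>(2)[OF that]) (auto intro: cov_norm)
  have bias1: "norm ((\<integral>\<omega>. \<Psi>1 m \<omega> \<partial>M) - \<Psi>) \<le> \<kappa> * \<kappa> * c * real m powr (- 3 / 2)" if m: "m \<ge> m1" for m
  proof -
    have mp: "1 \<le> real m" using m m0_pos[of m] by (simp add: m1_def)
    have "norm ((\<integral>\<omega>. \<Psi>1 m \<omega> \<partial>M) - \<Psi>) = norm (bias_map X m (\<lambda>_. bias0 X D m \<Psi>))"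
      using has_bochner_integral_integral_eq[OF B1[of m]] m by (simp add: m1_def)
    also have "\<dots> \<le> \<kappa> * (\<kappa> * c / real m) / real m"
      using \<kappa>(1) c mp by (intro \<kappa>(2)[OF m] bias[OF m]) auto
    also have "\<dots> = \<kappa> * \<kappa> * c * real m powr (- 2)"
      using mp by (simp add: powr_minus_divide power2_eq_square)
    also have "\<dots> \<le> \<kappa> * \<kappa> * c * real m powr (- 3 / 2)"
      using mp \<kappa>(1) c by (intro mult_left_mono powr_mono) auto
    finally show ?thesis .
  qed
  have part1: "(\<forall>m\<ge>m0. integrable M (\<Psi>0 m) \<and> (\<integral>\<omega>. \<Psi>0 m \<omega> \<partial>M) - \<Psi> = bias0 X D m \<Psi>)
       \<and> (\<lambda>m. norm (bias0 X D m \<Psi>)) \<in> O(\<lambda>m. real m powr (- 1))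
       \<and> (\<forall>m\<ge>m0. integrable M (\<Psi>1 m))
       \<and> (\<lambda>m. norm ((\<integral>\<omega>. \<Psi>1 m \<omega> \<partial>M) - \<Psi>)) \<in> O(\<lambda>m. real m powr (- 3 / 2))"
  proof (intro conjI allI impI)
    show "(\<lambda>m. norm (bias0 X D m \<Psi>)) \<in> O(\<lambda>m. real m powr (- 1))"
      by (intro bigoI[of _ "\<kappa> * c"] eventually_mono[OF eventually_ge_at_top[of m1]])
        (use bias in \<open>simp add: powr_minus_divide\<close>)
    show "(\<lambda>m. norm ((\<integral>\<omega>. \<Psi>1 m \<omega> \<partial>M) - \<Psi>)) \<in> O(\<lambda>m. real m powr (- 3 / 2))"
      by (intro bigoI[of _ "\<kappa> * \<kappa> * c"] eventually_mono[OF eventually_ge_at_top[of m1]])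
        (use bias1 in simp)
  qed (use B0 B1 in \<open>auto simp: has_bochner_integral_iff\<close>)
  have D_sym': "symmetric_matrix (D i)" if "i \<in> {1..m}" for i m :: nat using D_sym that by simp
  have "m0 \<le> m1" by (simp add: m1_def)
  note part23 = estimator_conclusions[OF _ _ _ this]
  have "concentrates Good (\<lambda>m \<omega>. \<Psi>0 m \<omega> - \<Psi>)" "concentrates Good (\<lambda>m \<omega>. \<Psi>1 m \<omega> - \<Psi>)"
    unfolding \<Psi>0_eq \<Psi>1_eq by (rule psi_hat0_concentrates psi_hat1_concentrates)+
  moreover have "\<Psi>0 m \<in> borel_measurable M" "\<Psi>1 m \<in> borel_measurable M" if "m \<ge> m1" for m
    using B0[of m] B1[of m] that by (auto simp: m1_def dest: borel_measurable_has_bochner_integral)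
  moreover have "symmetric_matrix (\<Psi>0 m \<omega>)" "symmetric_matrix (\<Psi>1 m \<omega>)" if "m \<ge> m0" for m \<omega>
    unfolding \<Psi>0_eq \<Psi>1_eq using gram_nonsing[OF that] D_sym'
    by (auto intro!: symmetric_psi_hat0 symmetric_psi_hat1)
  ultimately show ?thesis
    by (intro conjI[OF part1] ballI part23) auto
qed

end
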